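(* Let $W=\bigoplus_{k=1}^r V_{d_k}$ ($r\ge1$) be a finite-dimensional $\mathrm{SL}_2$-representation with $W^{\mathrm{SL}_2}=\{0\}$ and $d_1\le d_2\le\cdots\le d_r$, and assume that $W$ is not isomorphic to $V_d$ for $d\le4$, $2V_1$, $V_1\oplus V_2$, nor $2V_2$. Let $L\ge0$ be an integer. If at least one $d_k$ is odd, then the degree $4-D$ coefficient $\gamma_{1,L}$ of the Laurent series of $\mathrm{Hilb}_{(\mathbb{C}[W]\otimes V_L)^{\mathrm{SL}_2}}(t)$ at $t=1$ is $$\gamma_{1,L}=(L+1)\gamma_1=\frac{3(L+1)\,s_\rho(\boldsymbol a)}{2\,s_\delta(\boldsymbol a)},$$ where $\rho=(C-3,C-3,C-3,C-4,\dots,1,0)$ and $\delta=(C-1,C-2,\dots,1,0)$. If all $d_k$ are even, then $$\gamma_{1,L}=\frac{\big(1+(-1)^L\big)(L+1)\gamma_1}{2}=\frac{3\big(1+(-1)^L\big)(L+1)\,s_\rho(\boldsymbol a)}{2\,s_\delta(\boldsymbol a)}.$$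
   Context: $V_d$ denotes the irreducible $\mathrm{SL}_2=\mathrm{SL}_2(\mathbb C)$-module of dimension $d+1$ (binary forms of degree $d$), with weights $2i-d$, $0\le i\le d$; $2V_d=V_d\oplus V_d$. $D=\dim_{\mathbb C}W$; $\boldsymbol a$ is the list of positive weights of $W$ with multiplicity, and $C$ is its length. $\mathrm{Hilb}_{(\mathbb{C}[W]\otimes V_L)^{\mathrm{SL}_2}}(t)=\sum_{n\ge0}\dim_{\mathbb C}\big((\mathbb{C}[W]_n\otimes V_L)^{\mathrm{SL}_2}\big)t^n$, a rational function. $\gamma_{m,L}$ denotes the coefficient of $(1-t)^{m+3-D}$ in its Laurent expansion at $t=1$, and $\gamma_m=\gamma_{m,0}$ is the corresponding coefficient for the invariant ring $\mathbb{C}[W]^{\mathrm{SL}_2}$. For $\rho\in\mathbb Z^n$, $s_\rho(x_1,\dots,x_n)=\det(x_i^{\rho_j+n-j})/\det(x_i^{n-j})$, the Schur polynomial (evaluated as a polynomial, so repeated entries of $\boldsymbol a$ cause no problem). The sequences $\rho,\delta$ have length $C$; explicitly $\rho_j=C-3$ for $j=1,2$ and $\rho_j=C-j$ for $j\ge3$. *)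

theory Defs
  imports
    "HOL-Analysis.Determinants"
    "HOL-Computational_Algebra.Computational_Algebra"
    "HOL-Library.Function_Algebras"
    "Jordan_Normal_Form.Determinant"
begin

text \<open>
  Every representation below is a space of complex-valued functions on some set of points on
  which $\mathrm{SL}_2$ acts, with $(g \cdot f)(x) = f(g^{-1} x)$. Addition of functions is
  pointwise (\<^theory>\<open>HOL-Library.Function_Algebras\<close>).
\<close>

definition cscale :: "complex \<Rightarrow> ('x \<Rightarrow> complex) \<Rightarrow> 'x \<Rightarrow> complex" where
  "cscale c f = (\<lambda>x. c * f x)"

global_interpretation cfun: vector_space cscale
  by unfold_locales (auto simp: cscale_def fun_eq_iff algebra_simps)

definition SL2 :: "(complex^2^2) set" where
  "SL2 = {g. Determinants.det g = 1}"

definition pullback ::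
  "(complex^2^2 \<Rightarrow> 'x \<Rightarrow> 'x) \<Rightarrow> complex^2^2 \<Rightarrow> ('x \<Rightarrow> complex) \<Rightarrow> 'x \<Rightarrow> complex" where
  "pullback act g f = (\<lambda>x. f (act (matrix_inv g) x))"

definition invariants ::
  "(complex^2^2 \<Rightarrow> 'x \<Rightarrow> 'x) \<Rightarrow> ('x \<Rightarrow> complex) set \<Rightarrow> ('x \<Rightarrow> complex) set" where
  "invariants act U = {f \<in> U. \<forall>g\<in>SL2. pullback act g f = f}"

text \<open>
  Isomorphism of representations. Since every linear map defined on a subspace extends to the
  ambient space, it is no restriction to take \<open>\<phi>\<close> linear on the whole ambient space.
\<close>

definition rep_iso ::
  "(complex^2^2 \<Rightarrow> 'x \<Rightarrow> 'x) \<Rightarrow> ('x \<Rightarrow> complex) set \<Rightarrow>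
   (complex^2^2 \<Rightarrow> 'y \<Rightarrow> 'y) \<Rightarrow> ('y \<Rightarrow> complex) set \<Rightarrow> bool" where
  "rep_iso act U act' U' \<longleftrightarrow>
     (\<exists>\<phi>. Vector_Spaces.linear cscale cscale \<phi> \<and> bij_betw \<phi> U U' \<and>
          (\<forall>g\<in>SL2. \<forall>u\<in>U. \<phi> (pullback act g u) = pullback act' g (\<phi> u)))"


section \<open>Binary forms and their direct sums\<close>

definition V :: "nat \<Rightarrow> (complex^2 \<Rightarrow> complex) set" where
  "V d = {f. \<exists>c. \<forall>v. f v = (\<Sum>i\<le>d. c i * vec_nth v 1 ^ i * vec_nth v 2 ^ (d - i))}"

text \<open>
  A tuple \<open>(w\<^sub>0, \<dots>, w\<^sub>r\<^sub>-\<^sub>1)\<close> of binary forms is encoded as the function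
  \<open>(k, v) \<mapsto> w\<^sub>k v\<close> on \<open>r\<close> disjoint copies of the plane, extended by zero.
\<close>

definition W :: "nat list \<Rightarrow> (nat \<times> (complex^2) \<Rightarrow> complex) set" where
  "W ds = {w. (\<forall>k < length ds. (\<lambda>v. w (k, v)) \<in> V (ds ! k)) \<and>
              (\<forall>k \<ge> length ds. \<forall>v. w (k, v) = 0)}"

definition copies_act :: "complex^2^2 \<Rightarrow> nat \<times> (complex^2) \<Rightarrow> nat \<times> (complex^2)" where
  "copies_act g = (\<lambda>(k, v). (k, g *v v))"

text \<open>The positive weights of \<open>W ds\<close>, with multiplicity.\<close>

definition pos_weights :: "nat list \<Rightarrow> int list" where
  "pos_weights ds = filter (\<lambda>a. a > 0) (concat (map (\<lambda>d. map (\<lambda>i. 2 * int i - int d) [0..<d+1]) ds))"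


section \<open>Covariants and their Hilbert series\<close>

text \<open>
  The homogeneous polynomial functions of degree \<open>n\<close> on a subspace \<open>U\<close>: the span of the products
  of \<open>n\<close> linear functionals. They are extended by zero outside \<open>U\<close>, so that a function
  on \<open>U\<close> has a unique representative; the functionals may again be taken linear on the
  ambient space.
\<close>

definition homogeneous_polys ::
  "('x \<Rightarrow> complex) set \<Rightarrow> nat \<Rightarrow> (('x \<Rightarrow> complex) \<Rightarrow> complex) set" where
  "homogeneous_polys U n =
     cfun.span {\<lambda>u. if u \<in> U then (\<Prod>i<n. l i u) else 0 | l.
                  \<forall>i<n. Vector_Spaces.linear cscale (*) (l i)}"

text \<open>The tensor product of two function spaces, realised by functions on the product.\<close>

definition tensor ::
  "('x \<Rightarrow> complex) set \<Rightarrow> ('y \<Rightarrow> complex) set \<Rightarrow> ('x \<times> 'y \<Rightarrow> complex) set" where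
  "tensor A B = cfun.span {\<lambda>(x, y). f x * h y | f h. f \<in> A \<and> h \<in> B}"

definition covariants ::
  "nat list \<Rightarrow> nat \<Rightarrow> nat \<Rightarrow> ((nat \<times> (complex^2) \<Rightarrow> complex) \<times> (complex^2) \<Rightarrow> complex) set" where
  "covariants ds L n =
     invariants (\<lambda>g (w, v). (pullback copies_act g w, g *v v))
       (tensor (homogeneous_polys (W ds) n) (V L))"

definition Hilb :: "nat list \<Rightarrow> nat \<Rightarrow> complex fps" where
  "Hilb ds L = Abs_fps (\<lambda>n. of_nat (cfun.dim (covariants ds L n)))"

text \<open>
  The Laurent expansion at $t = 1$ of a rational function, as a formal Laurent series
  in $u = 1 - t$ (not $t - 1$).
\<close>

definition expand_at_1 :: "complex poly \<Rightarrow> complex fls" where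
  "expand_at_1 P = fps_to_fls (fps_of_poly (pcompose P [:1, -1:]))"

definition laurent_at_1 :: "complex fps \<Rightarrow> complex fls" where
  "laurent_at_1 H = (THE F. \<exists>P Q. Q \<noteq> 0 \<and> fps_of_poly Q * H = fps_of_poly P \<and>
                                  F = expand_at_1 P / expand_at_1 Q)"

lemma expand_at_1_mult: "expand_at_1 (P * Q) = expand_at_1 P * expand_at_1 Q"
  by (simp add: expand_at_1_def pcompose_mult fps_of_poly_mult fls_times_fps_to_fls)

lemma expand_at_1_eq_0_iff: "expand_at_1 P = 0 \<longleftrightarrow> P = 0"
  by (auto simp: expand_at_1_def pcompose_eq_0_iff)

lemma laurent_at_1_eq:
  assumes Q: "Q \<noteq> 0" and H: "fps_of_poly Q * H = fps_of_poly P"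
  shows "laurent_at_1 H = expand_at_1 P / expand_at_1 Q"
  unfolding laurent_at_1_def
proof (rule the_equality)
  fix F
  assume "\<exists>P Q. Q \<noteq> 0 \<and> fps_of_poly Q * H = fps_of_poly P \<and> F = expand_at_1 P / expand_at_1 Q"
  then obtain P' Q' where Q': "Q' \<noteq> 0" and H': "fps_of_poly Q' * H = fps_of_poly P'"
    and F: "F = expand_at_1 P' / expand_at_1 Q'"
    by blast
  have "fps_of_poly (P' * Q) = fps_of_poly (P * Q')"
    by (simp add: fps_of_poly_mult H [symmetric] H' [symmetric] ac_simps)
  then have "expand_at_1 P' * expand_at_1 Q = expand_at_1 P * expand_at_1 Q'"
    by (simp add: expand_at_1_mult [symmetric] fps_of_poly_eq_iff)
  then show "F = expand_at_1 P / expand_at_1 Q"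
    using Q Q' by (simp add: F frac_eq_eq expand_at_1_eq_0_iff)
qed (use assms in blast)

text \<open>\<open>\<gamma> ds m L\<close> is $\gamma_{m,L}$; in particular $\gamma_m$ is \<open>\<gamma> ds m 0\<close>, as \<open>V 0\<close> is trivial.\<close>

definition \<gamma> :: "nat list \<Rightarrow> nat \<Rightarrow> nat \<Rightarrow> complex" where
  "\<gamma> ds m L = fls_nth (laurent_at_1 (Hilb ds L)) (int m + 3 - int (cfun.dim (W ds)))"


section \<open>Schur polynomials\<close>

definition polynomial_functions :: "nat \<Rightarrow> ((nat \<Rightarrow> complex) \<Rightarrow> complex) set" where
  "polynomial_functions n = cfun.span (range (\<lambda>e x. \<Prod>i<n. x i ^ e i))"

text \<open>
  The quotient of determinants is taken among polynomial functions, so that it can be evaluated at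
  points with repeated coordinates. Indices are shifted to start at zero.
\<close>

definition alternant :: "nat list \<Rightarrow> (nat \<Rightarrow> complex) \<Rightarrow> complex" where
  "alternant \<rho> x = (let n = length \<rho> in
     Determinant.det (Matrix.mat n n (\<lambda>(i, j). x i ^ (\<rho> ! j + (n - 1 - j)))))"

definition schur :: "nat list \<Rightarrow> (nat \<Rightarrow> complex) \<Rightarrow> complex" where
  "schur \<rho> = (THE s. s \<in> polynomial_functions (length \<rho>) \<and>
     (\<forall>x. s x * alternant (replicate (length \<rho>) 0) x = alternant \<rho> x))"

text \<open>
  The two exponent sequences of length \<open>C\<close>. Truncated subtraction is harmless
  for \<open>\<delta>_seq\<close>, and for \<open>\<rho>_seq\<close> as soon as \<open>C \<ge> 3\<close>.
\<close>

definition \<rho>_seq :: "nat \<Rightarrow> nat list" where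
  "\<rho>_seq C = map (\<lambda>j. if j \<le> 2 then C - 3 else C - j) [1..<C+1]"

definition \<delta>_seq :: "nat \<Rightarrow> nat list" where
  "\<delta>_seq C = map (\<lambda>j. C - j) [1..<C+1]"

end

theory Submission
  imports Defs "HOL-Complex_Analysis.Complex_Analysis"
begin

text \<open>
  By the representation theory of the Lie algebra, the covariants in degree \<open>n\<close> have dimension
  \<open>N n (- L) - N n (L + 2)\<close>, where \<open>N n c\<close> counts the monomials of degree \<open>n\<close> and weight \<open>c\<close> on
  \<open>W ds\<close>. Hence for \<open>0 < t < 1\<close> the Hilbert series is an integral over the torus, namely, up to
  the powers \<open>t ^ C\<close> and \<open>(1 - t) ^ E\<close> with \<open>E\<close> the multiplicity of the weight zero,
  \[ \frac{1}{2 \pi} \int_{-\pi}^{\pi} \frac{2 \sin ((L + 1) \theta) \sin \theta}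
     {\prod_a (\sigma^2 + 4 \sin^2 (a \theta / 2))} \, d\theta, \qquad \sigma = (1 - t) / \sqrt t. \]
  As \<open>\<sigma>\<close> tends to zero only \<open>\<theta> = 0\<close> contributes to the two leading orders, and \<open>\<theta> = \<pi>\<close> if all
  weights are even; every other angle has at least two nonvanishing factors. The expansion is in
  powers of \<open>\<sigma>\<^sup>2\<close>, so the second Laurent coefficient is a fixed multiple of the first. The first
  one is the integral of $x^2 / \prod_a (1 + a^2 x^2)$, which partial fractions turn into a
  quotient of alternants.
\<close>

text \<open>\<open>V L\<close> enters as the forms of degree \<open>L\<close> in the coordinates of
  one further plane, so covariants become bihomogeneous invariants and a single argument serves
  every \<open>L\<close>. Invariance under the whole group is cut down to two linear conditions,
  weight zero and annihilation by the raising derivation: bounded weights force the lowering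
  derivation to vanish too, and the two unipotent subgroups generate the group. The analysis has to
  be sharp to relative order \<sigma>^2, because \<sigma> behaves like 1 - t and an error of order
  \<sigma> would spoil the second coefficient. The count is this: away from the peaks two of the
  \<open>C\<close> factors are bounded, \<open>C - 3\<close> are estimated by \<sigma>^(-2) each,
  and the last one is integrated to order 1/\<sigma>; against the main term of order \<sigma>^(3 - 2
  C) this saves exactly \<sigma>^2. So three positive weights are required, and among
  representations without invariants the excluded ones are those with fewer. Rationality of the
  series is proved separately: it is what lets limits along real t determine a formal Laurent
  coefficient.\<close>

global_interpretation cfun_pair: vector_space_pair
  "cscale :: complex \<Rightarrow> ('x \<Rightarrow> complex) \<Rightarrow> 'x \<Rightarrow> complex"
  "cscale :: complex \<Rightarrow> ('y \<Rightarrow> complex) \<Rightarrow> 'y \<Rightarrow> complex"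
  by unfold_locales

lemma vector_space_complex_times: "vector_space ((*) :: complex \<Rightarrow> complex \<Rightarrow> complex)"
  by unfold_locales (auto simp: algebra_simps)

global_interpretation cfun_functional: vector_space_pair
  "cscale :: complex \<Rightarrow> ('x \<Rightarrow> complex) \<Rightarrow> 'x \<Rightarrow> complex" "(*) :: complex \<Rightarrow> complex \<Rightarrow> complex"
  using vector_space_complex_times by (simp add: vector_space_pair_def cfun.vector_space_axioms)

section \<open>Linear algebra in spaces of functions\<close>

lemma cfun_independent_finite:
  "finite B \<Longrightarrow> cfun.independent S \<Longrightarrow> S \<subseteq> cfun.span B \<Longrightarrow> finite S"
  using cfun.independent_span_bound by blast

text \<open>A vector outside the span of \<open>S\<close> could be added to \<open>S\<close>, giving
  an independent set with more elements than \<open>B\<close>, against the exchange bound.\<close>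

lemma cfun_independent_spans:
  assumes "finite B" "cfun.independent S" "S \<subseteq> cfun.span B" "card S = card B"
  shows "cfun.span B \<subseteq> cfun.span S"
proof -
  have fin: "finite S" using cfun_independent_finite assms by blast
  show ?thesis
  proof
    fix v assume v: "v \<in> cfun.span B"
    show "v \<in> cfun.span S"
    proof (rule ccontr)
      assume "v \<notin> cfun.span S"
      moreover from this have "v \<notin> S" using cfun.span_base by blast
      ultimately have "cfun.independent (insert v S)" "card (insert v S) = Suc (card B)"
        using assms fin by (auto simp: cfun.independent_insert)
      then show False
        using cfun.independent_span_bound[OF assms(1), of "insert v S"] assms(3) v by auto
    qed
  qed
qed

text \<open>The ambient function space may be infinite-dimensional; finiteness is carried by
  \<open>B\<close>. A basis of the kernel is extended to a basis of \<open>U\<close>, and the added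
  vectors \<open>R\<close> map bijectively onto a basis of the image.\<close>

lemma cfun_rank_nullity:
  assumes lin: "Vector_Spaces.linear cscale cscale h"
    and U: "cfun.subspace U" and B: "finite B" "U \<subseteq> cfun.span B"
  shows "cfun.dim (U \<inter> {x. h x = 0}) + cfun.dim (h ` U) = cfun.dim U"
proof -
  interpret h: Vector_Spaces.linear cscale cscale h by fact
  define K where "K = U \<inter> {x. h x = 0}"
  have sK: "cfun.subspace K"
    unfolding K_def using U h.subspace_kernel by (intro cfun.subspace_inter)
  obtain BK where BK: "BK \<subseteq> K" "cfun.independent BK" "K \<subseteq> cfun.span BK" "card BK = cfun.dim K"
    using cfun.basis_exists by metis
  obtain BU where BU: "BK \<subseteq> BU" "BU \<subseteq> U" "cfun.independent BU" "U \<subseteq> cfun.span BU"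
    using cfun.maximal_independent_subset_extend[of BK U] BK by (auto simp: K_def)
  have fin: "finite BU" using cfun_independent_finite[OF B(1) BU(3)] BU(2) B(2) by blast
  define R where "R = BU - BK"
  have spR: "cfun.span R \<subseteq> U" using BU U by (intro cfun.span_minimal) (auto simp: R_def)
  have disj: "x = 0" if xR: "x \<in> cfun.span R" and xK: "x \<in> cfun.span BK" for x
  proof -
    have fin': "finite R" "finite BK" using fin BU(1) by (auto simp: R_def intro: finite_subset)
    obtain u where u: "x = (\<Sum>v\<in>R. cscale (u v) v)"
      using xR[unfolded cfun.span_finite[OF fin'(1)]] by (rule rangeE)
    obtain w where w: "x = (\<Sum>v\<in>BK. cscale (w v) v)"
      using xK[unfolded cfun.span_finite[OF fin'(2)]] by (rule rangeE)
    \<comment> \<open>The two expansions of \<open>x\<close>, over \<open>R\<close> and over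
      \<open>BK\<close>, are merged into one relation x - x = 0 over the basis
      \<open>BU\<close>.\<close>
    define c where "c v = (if v \<in> R then u v else - w v)" for v
    have "(\<Sum>v\<in>BU. cscale (c v) v) = (\<Sum>v\<in>R. cscale (c v) v) + (\<Sum>v\<in>BK. cscale (c v) v)"
      using fin BU(1) by (subst sum.union_disjoint [symmetric]) (auto simp: R_def intro: finite_subset intro!: sum.cong)
    also have "(\<Sum>v\<in>R. cscale (c v) v) = x" unfolding u by (rule sum.cong) (auto simp: c_def)
    also have "(\<Sum>v\<in>BK. cscale (c v) v) = - x" unfolding w sum_negf[symmetric]
      by (rule sum.cong) (auto simp: c_def R_def cscale_def fun_eq_iff)
    finally have "(\<Sum>v\<in>BU. cscale (c v) v) = 0" by (simp only: right_minus)
    then have "\<And>v. v \<in> BU \<Longrightarrow> c v = 0" using cfun.independentD[OF BU(3) fin] by blast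
    moreover have "R \<subseteq> BU" by (auto simp: R_def)
    ultimately have "\<And>v. v \<in> R \<Longrightarrow> u v = 0" by (metis (no_types) c_def subsetD)
    then show "x = 0" unfolding u by (simp only: cfun.scale_zero_left sum.neutral_const cong: sum.cong)
  qed
  have inj: "inj_on h (cfun.span R)"
  proof (subst h.inj_on_iff_eq_0)
    show "cfun.subspace (cfun.span R)" by simp
    show "\<forall>x\<in>cfun.span R. h x = 0 \<longrightarrow> x = 0"
      using disj BK(3) spR by (auto simp: K_def)
  qed
  have ind: "cfun.independent (h ` R)"
    using h.independent_injective_image[OF _ inj] BU(3) cfun.independent_mono R_def by blast
  have "cfun.span (h ` R) = h ` cfun.span R" by (rule h.span_image)
  have "h ` U \<subseteq> h ` cfun.span R"
  proof
    fix y assume "y \<in> h ` U"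
    then obtain x where x: "x \<in> U" "y = h x" by auto
    have "x \<in> cfun.span (R \<union> BK)" using x BU by (auto simp: R_def Un_absorb2)
    then obtain p q where "x = p + q" "p \<in> cfun.span R" "q \<in> cfun.span BK"
      by (auto simp: cfun.span_Un)
    moreover have "cfun.span BK \<subseteq> K" using BK sK by (simp add: cfun.span_minimal)
    ultimately have "h x = h p" by (auto simp: h.add K_def)
    then show "y \<in> h ` cfun.span R" using x \<open>p \<in> _\<close> by auto
  qed
  then have "h ` U = cfun.span (h ` R)" using spR h.span_image[of R] by auto
  then have "cfun.dim (h ` U) = card (h ` R)" using cfun.dim_span_eq_card_independent[OF ind] by (simp only:)
  also have "\<dots> = card R" using inj cfun.span_superset[of R] by (meson card_image inj_on_subset)
  finally have "cfun.dim (h ` U) = card BU - card BK"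
    using fin BU(1) by (simp add: R_def card_Diff_subset finite_subset)
  moreover have "cfun.dim U = card BU" using cfun.basis_card_eq_dim BU by metis
  moreover have "card BK \<le> card BU" using BU fin by (simp add: card_mono)
  ultimately show ?thesis using BK(4) by (simp add: K_def)
qed

text \<open>The third generator of the Lie algebra acts on \<open>U c\<close> as the scalar
  \<open>c\<close>, so it needs no operator of its own. The relations are asked only on weight
  vectors, because \<open>e\<close> and \<open>f\<close> will be linear extensions to the whole
  function space, with no meaning outside the module.\<close>

locale sl2_weight_module =
  fixes e f :: "('x \<Rightarrow> complex) \<Rightarrow> 'x \<Rightarrow> complex" and U :: "int \<Rightarrow> ('x \<Rightarrow> complex) set" and N :: int
  assumes lin_e: "Vector_Spaces.linear cscale cscale e"
    and lin_f: "Vector_Spaces.linear cscale cscale f"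
    and sub_U: "cfun.subspace (U c)"
    and e_U: "x \<in> U c \<Longrightarrow> e x \<in> U (c + 2)"
    and f_U: "x \<in> U c \<Longrightarrow> f x \<in> U (c - 2)"
    and commutator: "x \<in> U c \<Longrightarrow> e (f x) - f (e x) = cscale (of_int c) x"
    and weights_bounded: "\<bar>c\<bar> > N \<Longrightarrow> U c = {0}"
begin

text \<open>The symmetry that exchanges raising and lowering and negates the weights; it transfers
  statements about positive weights to negative ones.\<close>

lemma swap: "sl2_weight_module f e (\<lambda>c. U (- c)) N"
proof (intro sl2_weight_module.intro)
  fix x c assume x: "x \<in> U (- c)"
  show "f x \<in> U (- (c + 2))" using f_U[OF x] by (simp add: algebra_simps)
  show "e x \<in> U (- (c - 2))" using e_U[OF x] by (simp add: algebra_simps)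
  show "f (e x) - e (f x) = cscale (of_int c) x"
    using arg_cong[OF commutator[OF x], of uminus] by (simp add: cscale_def fun_eq_iff)
qed (simp_all add: lin_e lin_f sub_U weights_bounded)

lemma pow_U: "x \<in> U c \<Longrightarrow> (e ^^ r) x \<in> U (c + 2 * int r)"
proof (induction r)
  case (Suc r)
  then show ?case using e_U[of "(e ^^ r) x" "c + 2 * int r"] by (simp add: algebra_simps)
qed simp

text \<open>Moving \<open>f\<close> to the left past the r + 1 copies of \<open>e\<close> picks up
  the weights k, k + 2, ..., k + 2 r, whose sum is (r + 1)(k + r).\<close>

lemma pow_commutator:
  assumes x: "x \<in> U k"
  shows "(e ^^ Suc r) (f x) = f ((e ^^ Suc r) x) + cscale (of_int ((int r + 1) * (k + int r))) ((e ^^ r) x)"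
proof (induction r)
  interpret e: Vector_Spaces.linear cscale cscale e by (rule lin_e)
  case 0
  show ?case using commutator[OF x] by (simp add: algebra_simps)
next
  interpret e: Vector_Spaces.linear cscale cscale e by (rule lin_e)
  case (Suc r)
  define y where "y = (e ^^ Suc r) x"
  have y: "y \<in> U (k + 2 * int (Suc r))" unfolding y_def by (rule pow_U[OF x])
  have "(e ^^ Suc (Suc r)) (f x) = e ((e ^^ Suc r) (f x))" by simp
  also have "\<dots> = e (f y) + cscale (of_int ((int r + 1) * (k + int r))) y"
    by (subst Suc) (simp add: y_def e.add e.scale)
  also have "e (f y) = f (e y) + cscale (of_int (k + 2 * int (Suc r))) y"
    using commutator[OF y] by (simp add: algebra_simps)
  finally show ?case
    by (simp add: y_def cscale_def fun_eq_iff algebra_simps)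
qed

text \<open>If \<open>x\<close> is nonzero, take the last nonzero power \<open>(e ^^ r) x\<close>.
  Applying \<open>e ^^ Suc r\<close> to \<open>f x\<close> gives (r + 1)(k + r) times that vector,
  which is nonzero for positive \<open>k\<close>, while \<open>e (f x) = 0\<close> makes it
  vanish.\<close>

lemma ef_injective:
  assumes x: "x \<in> U k" and k: "k > 0" and ef: "e (f x) = 0"
  shows "x = 0"
proof (rule ccontr)
  interpret e: Vector_Spaces.linear cscale cscale e by (rule lin_e)
  interpret f: Vector_Spaces.linear cscale cscale f by (rule lin_f)
  assume "x \<noteq> 0"
  define P where "P r \<longleftrightarrow> (e ^^ r) x = 0" for r
  have "P (nat (N + 1 + \<bar>k\<bar>))"
  proof -
    have "\<bar>k + 2 * int (nat (N + 1 + \<bar>k\<bar>))\<bar> > N" using k by linarith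
    then show ?thesis
      using pow_U[OF x, of "nat (N + 1 + \<bar>k\<bar>)"] weights_bounded by (auto simp: P_def)
  qed
  then have least: "P (LEAST r. P r)" by (rule LeastI)
  have "\<not> P 0" using \<open>x \<noteq> 0\<close> by (simp add: P_def)
  then obtain r where r: "(LEAST r. P r) = Suc r" using least by (metis not0_implies_Suc)
  have "\<not> P r" using r by (metis lessI not_less_Least)
  have 1: "(e ^^ Suc r) (f x) = 0"
    using ef by (simp only: funpow_Suc_right o_apply) (induction r, auto simp: e.zero)
  have "(e ^^ Suc r) x = 0" using least r by (simp add: P_def)
  then have "cscale (of_int ((int r + 1) * (k + int r))) ((e ^^ r) x) = 0"
    using pow_commutator[OF x, of r] 1 by (simp add: f.zero)
  moreover have "(int r + 1) * (k + int r) \<noteq> 0" using k by simp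
  ultimately show False using \<open>\<not> P r\<close> unfolding P_def
    by (metis cfun.scale_eq_0_iff of_int_eq_0_iff)
qed

text \<open>The composition of \<open>e\<close> and \<open>f\<close> is an injective endomorphism of
  the finite-dimensional space \<open>U 2\<close>, hence onto; since \<open>f\<close> maps
  \<open>U 2\<close> into \<open>U 0\<close>, every vector of \<open>U 2\<close> is hit from
  \<open>U 0\<close>.\<close>

lemma e_surjective:
  assumes B: "finite B" "U 2 \<subseteq> cfun.span B"
  shows "e ` U 0 = U 2"
proof
  interpret e: Vector_Spaces.linear cscale cscale e by (rule lin_e)
  interpret f: Vector_Spaces.linear cscale cscale f by (rule lin_f)
  show "e ` U 0 \<subseteq> U 2" using e_U[of _ 0] by auto
  have lin: "Vector_Spaces.linear cscale cscale (e \<circ> f)"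
    using lin_e lin_f by (rule Vector_Spaces.linear_compose[rotated])
  interpret ef: Vector_Spaces.linear cscale cscale "e \<circ> f" by (rule lin)
  obtain S where S: "S \<subseteq> U 2" "cfun.independent S" "U 2 \<subseteq> cfun.span S"
    using cfun.basis_exists by metis
  have fin: "finite S" using cfun_independent_finite B S by blast
  have sp: "cfun.span S = U 2" using S sub_U by (metis cfun.span_subspace)
  have inj: "inj_on (e \<circ> f) (cfun.span S)"
    using ef_injective[of _ 2] sub_U by (subst ef.inj_on_iff_eq_0) (auto simp: sp)
  have "cfun.independent ((e \<circ> f) ` S)" by (rule ef.independent_injective_image[OF S(2) inj])
  moreover have "(e \<circ> f) ` S \<subseteq> cfun.span S"
    using S(1) e_U[of _ 0] f_U[of _ 2] by (auto simp: sp)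
  moreover have "card ((e \<circ> f) ` S) = card S"
    using inj cfun.span_superset by (meson card_image inj_on_subset)
  ultimately have "cfun.span S \<subseteq> cfun.span ((e \<circ> f) ` S)"
    using cfun_independent_spans[OF fin] by blast
  then have "U 2 \<subseteq> (e \<circ> f) ` U 2" unfolding ef.span_image sp .
  then show "U 2 \<subseteq> e ` U 0" using f_U[of _ 2] by force
qed

text \<open>Rank and nullity of \<open>e\<close> between \<open>U 0\<close> and \<open>U 2\<close>;
  the additive form avoids truncated subtraction.\<close>

lemma dim_highest_weight:
  assumes "finite B" "U 0 \<subseteq> cfun.span B" "finite B'" "U 2 \<subseteq> cfun.span B'"
  shows "cfun.dim (U 0 \<inter> {x. e x = 0}) + cfun.dim (U 2) = cfun.dim (U 0)"
  using cfun_rank_nullity[OF lin_e sub_U assms(1,2)] e_surjective[OF assms(3,4)] by simp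

end

text \<open>On weight zero the commutator vanishes, so \<open>e (f x) = f (e x) = 0\<close>. In the
  swapped module \<open>f x\<close> has weight 2, where the injectivity result applies. This is why
  one unipotent subgroup and the torus already test invariance under the group.\<close>

lemma (in sl2_weight_module) f_eq_0:
  assumes x: "x \<in> U 0" and e: "e x = 0"
  shows "f x = 0"
proof (rule sl2_weight_module.ef_injective[OF swap])
  interpret f: Vector_Spaces.linear cscale cscale f by (rule lin_f)
  have fx: "f x \<in> U (- 2)" using f_U[OF x] by simp
  then show "f x \<in> U (- 2)" .
  show "f (e (f x)) = 0"
    using commutator[OF x] e by (simp add: f.zero)
qed simp

section \<open>Matrices and binary forms\<close>

lemma fun_sum_apply: "(sum f A) x = (\<Sum>a\<in>A. f a x)"
  by (induction A rule: infinite_finite_induct) auto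

definition mat2 :: "complex \<Rightarrow> complex \<Rightarrow> complex \<Rightarrow> complex \<Rightarrow> complex^2^2" where
  "mat2 a b c d = vector [vector [a, b], vector [c, d]]"

lemma mat2_nth [simp]:
  "vec_nth (vec_nth (mat2 a b c d) 1) 1 = a" "vec_nth (vec_nth (mat2 a b c d) 1) 2 = b"
  "vec_nth (vec_nth (mat2 a b c d) 2) 1 = c" "vec_nth (vec_nth (mat2 a b c d) 2) 2 = d"
  by (simp_all add: mat2_def)

lemma mat2_eq_iff: "g = mat2 a b c d \<longleftrightarrow> vec_nth (vec_nth g 1) 1 = a \<and> vec_nth (vec_nth g 1) 2 = b
   \<and> vec_nth (vec_nth g 2) 1 = c \<and> vec_nth (vec_nth g 2) 2 = d"
  unfolding Finite_Cartesian_Product.vec_eq_iff forall_2 by auto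

lemma mat2_cases: obtains a b c d where "g = mat2 a b c d"
  by (metis mat2_eq_iff)

lemma mat2_mult: "mat2 a b c d ** mat2 a' b' c' d' =
    mat2 (a * a' + b * c') (a * b' + b * d') (c * a' + d * c') (c * b' + d * d')"
  by (simp add: mat2_eq_iff matrix_matrix_mult_def sum_2)

lemma mat2_one: "Finite_Cartesian_Product.mat 1 = mat2 1 0 0 1"
  by (simp add: mat2_eq_iff Finite_Cartesian_Product.mat_def)

lemma mat2_vector [simp]: "vec_nth (mat2 a b c d *v v) 1 = a * vec_nth v 1 + b * vec_nth v 2"
   "vec_nth (mat2 a b c d *v v) 2 = c * vec_nth v 1 + d * vec_nth v 2"
  by (simp_all add: matrix_vector_mult_def sum_2)

lemma mat2_SL2: "mat2 a b c d \<in> SL2 \<longleftrightarrow> a * d - b * c = 1"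
  by (simp add: SL2_def det_2)

lemma matrix_inv_unique:
  assumes "A ** B = Finite_Cartesian_Product.mat 1" "B ** A = Finite_Cartesian_Product.mat 1"
  shows "matrix_inv A = (B :: 'a::semiring_1^'n^'n)"
proof -
  have "\<exists>B. A ** B = Finite_Cartesian_Product.mat 1 \<and> B ** A = Finite_Cartesian_Product.mat 1" using assms by blast
  then have "A ** matrix_inv A = Finite_Cartesian_Product.mat 1 \<and> matrix_inv A ** A = Finite_Cartesian_Product.mat 1"
    unfolding matrix_inv_def by (rule someI_ex)
  then have "matrix_inv A = (B ** A) ** matrix_inv A" "A ** matrix_inv A = Finite_Cartesian_Product.mat 1"
    using assms by simp_all
  then show ?thesis by (simp add: matrix_mul_assoc[symmetric])
qed

lemma mat2_inv: "a * d - b * c = 1 \<Longrightarrow> matrix_inv (mat2 a b c d) = mat2 d (-b) (-c) a"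
  by (rule matrix_inv_unique) (simp_all add: mat2_mult mat2_one mat2_eq_iff algebra_simps)

lemma SL2_mult: "g \<in> SL2 \<Longrightarrow> h \<in> SL2 \<Longrightarrow> g ** h \<in> SL2"
  by (simp add: SL2_def det_mul)

lemma SL2_inv: "g \<in> SL2 \<Longrightarrow> matrix_inv g \<in> SL2"
  by (cases g rule: mat2_cases) (simp add: mat2_SL2 mat2_inv algebra_simps)

lemma SL2_inv_inv: "g \<in> SL2 \<Longrightarrow> matrix_inv (matrix_inv g) = g"
  by (cases g rule: mat2_cases) (simp add: mat2_SL2 mat2_inv algebra_simps)

lemma SL2_inv_mult: "g \<in> SL2 \<Longrightarrow> h \<in> SL2 \<Longrightarrow> matrix_inv (g ** h) = matrix_inv h ** matrix_inv g"
proof (rule matrix_inv_unique)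
  assume gh: "g \<in> SL2" "h \<in> SL2"
  have *: "x ** matrix_inv x = Finite_Cartesian_Product.mat 1 \<and> matrix_inv x ** x = Finite_Cartesian_Product.mat 1"
    if "x \<in> SL2" for x
  proof (cases x rule: mat2_cases)
    case (1 a b c d)
    then have "a * d - b * c = 1" using that by (simp add: mat2_SL2)
    then show ?thesis by (simp add: 1 mat2_inv mat2_mult mat2_one mat2_eq_iff algebra_simps)
  qed
  have "g ** h ** (matrix_inv h ** matrix_inv g) = g ** (h ** matrix_inv h) ** matrix_inv g"
    by (simp add: matrix_mul_assoc)
  then show "g ** h ** (matrix_inv h ** matrix_inv g) = Finite_Cartesian_Product.mat 1" using gh by (simp add: *)
  have "matrix_inv h ** matrix_inv g ** (g ** h) = matrix_inv h ** (matrix_inv g ** g) ** h"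
    by (simp add: matrix_mul_assoc)
  then show "matrix_inv h ** matrix_inv g ** (g ** h) = Finite_Cartesian_Product.mat 1" using gh by (simp add: *)
qed

definition upper :: "complex \<Rightarrow> complex^2^2" where "upper s = mat2 1 s 0 1"
definition lower :: "complex \<Rightarrow> complex^2^2" where "lower s = mat2 1 0 s 1"
definition torus :: "complex \<Rightarrow> complex^2^2" where "torus z = mat2 z 0 0 (inverse z)"

lemma upper_SL2 [simp]: "upper s \<in> SL2" and lower_SL2 [simp]: "lower s \<in> SL2"
  and torus_SL2 [simp]: "z \<noteq> 0 \<Longrightarrow> torus z \<in> SL2"
  by (simp_all add: upper_def lower_def torus_def mat2_SL2)

lemma upper_inv: "matrix_inv (upper s) = upper (- s)" and lower_inv: "matrix_inv (lower s) = lower (- s)"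
  and torus_inv: "z \<noteq> 0 \<Longrightarrow> matrix_inv (torus z) = torus (inverse z)"
  by (simp_all add: upper_def lower_def torus_def mat2_inv)

lemma upper_add: "upper (s + t) = upper s ** upper t" and lower_add: "lower (s + t) = lower s ** lower t"
  by (simp_all add: upper_def lower_def mat2_mult add.commute)

lemma upper_0: "upper 0 = mat2 1 0 0 1" and lower_0: "lower 0 = mat2 1 0 0 1"
  by (simp_all add: upper_def lower_def)

text \<open>The big cell: an entry below the diagonal that does not vanish can be made the only pivot.\<close>

lemma SL2_unipotent:
  assumes "g \<in> SL2" obtains x y z w where "g = upper x ** lower y ** upper z ** lower w"
proof (cases g rule: mat2_cases)
  case (1 a b c d)
  have big: "mat2 a b c d = upper ((a - 1) / c) ** lower c ** upper ((d - 1) / c)"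
    if "c \<noteq> 0" "a * d - b * c = 1" for a b c d :: complex
    using that by (simp add: upper_def lower_def mat2_mult mat2_eq_iff field_simps)
  have det: "a * d - b * c = 1" using assms 1 by (simp add: mat2_SL2)
  have l0: "m ** lower 0 = m" for m :: "complex^2^2"
    by (cases m rule: mat2_cases) (simp add: lower_def mat2_mult)
  show thesis
  proof (cases "c = 0")
    case False
    then show thesis using that[of _ _ _ 0] big[OF _ det] 1 by (simp add: l0)
  next
    case True
    \<comment> \<open>With \<open>c = 0\<close>, adding the second column to the first puts the
      nonzero \<open>d\<close> into the corner; the factor \<open>lower (- 1)\<close> undoes
      this.\<close>
    then have "d \<noteq> 0" using det by auto
    then have "mat2 (a + b) b (c + d) d = upper ((a + b - 1) / (c + d)) ** lower (c + d) ** upper ((d - 1) / (c + d))"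
      using det True by (intro big) (auto simp: algebra_simps)
    moreover have "g = mat2 (a + b) b (c + d) d ** lower (- 1)"
      using 1 by (simp add: lower_def mat2_mult)
    ultimately show thesis using that by metis
  qed
qed

section \<open>Coordinates on tuples of binary forms\<close>

definition indices :: "nat list \<Rightarrow> (nat \<times> nat) set" where
  "indices ds = Sigma {..<length ds} (\<lambda>k. {..ds ! k})"

lemma finite_indices [simp]: "finite (indices ds)"
  by (simp add: indices_def)

definition form_basis :: "nat list \<Rightarrow> nat \<times> nat \<Rightarrow> nat \<times> (complex^2) \<Rightarrow> complex" where
  "form_basis ds \<alpha> = (\<lambda>(k, v). if k = fst \<alpha> then vec_nth v 1 ^ snd \<alpha> * vec_nth v 2 ^ (ds ! fst \<alpha> - snd \<alpha>) else 0)"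

lemma form_basis_sum:
  "(\<Sum>\<alpha>\<in>indices ds. cscale (c \<alpha>) (form_basis ds \<alpha>)) (k, v) =
     (if k < length ds then \<Sum>i\<le>ds ! k. c (k, i) * vec_nth v 1 ^ i * vec_nth v 2 ^ (ds ! k - i) else 0)"
proof -
  have "(\<Sum>\<alpha>\<in>indices ds. cscale (c \<alpha>) (form_basis ds \<alpha>)) (k, v)
    = (\<Sum>k'<length ds. \<Sum>i\<le>ds ! k'. c (k', i) * form_basis ds (k', i) (k, v))"
    by (simp add: fun_sum_apply cscale_def indices_def sum.Sigma)
  also have "\<dots> = (\<Sum>k'<length ds. if k' = k then \<Sum>i\<le>ds ! k. c (k, i) * vec_nth v 1 ^ i * vec_nth v 2 ^ (ds ! k - i) else 0)"
    by (intro sum.cong) (auto simp: form_basis_def intro!: sum.cong)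
  finally show ?thesis by simp
qed

lemma W_iff: "w \<in> W ds \<longleftrightarrow> (\<exists>c. w = (\<Sum>\<alpha>\<in>indices ds. cscale (c \<alpha>) (form_basis ds \<alpha>)))"
proof
  assume w: "w \<in> W ds"
  then have "\<forall>k. \<exists>c. k < length ds \<longrightarrow> (\<forall>v. w (k, v) = (\<Sum>i\<le>ds ! k. c i * vec_nth v 1 ^ i * vec_nth v 2 ^ (ds ! k - i)))"
    by (auto simp: W_def V_def)
  then obtain c where c: "\<And>k v. k < length ds \<Longrightarrow> w (k, v) = (\<Sum>i\<le>ds ! k. c k i * vec_nth v 1 ^ i * vec_nth v 2 ^ (ds ! k - i))"
    by metis
  have "w = (\<Sum>\<alpha>\<in>indices ds. cscale (c (fst \<alpha>) (snd \<alpha>)) (form_basis ds \<alpha>))"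
  proof
    fix p show "w p = (\<Sum>\<alpha>\<in>indices ds. cscale (c (fst \<alpha>) (snd \<alpha>)) (form_basis ds \<alpha>)) p"
      using w c by (cases p) (auto simp: form_basis_sum W_def)
  qed
  then show "\<exists>c. w = (\<Sum>\<alpha>\<in>indices ds. cscale (c \<alpha>) (form_basis ds \<alpha>))" by (metis)
next
  assume "\<exists>c. w = (\<Sum>\<alpha>\<in>indices ds. cscale (c \<alpha>) (form_basis ds \<alpha>))"
  then show "w \<in> W ds" by (auto simp: W_def V_def form_basis_sum)
qed

text \<open>On the points (x, 1) of a single block the relation is a polynomial identity in
  x.\<close>

lemma form_basis_coeffs:
  assumes "(\<Sum>\<alpha>\<in>indices ds. cscale (c \<alpha>) (form_basis ds \<alpha>)) = 0" "\<alpha> \<in> indices ds"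
  shows "c \<alpha> = 0"
proof -
  obtain k i where \<alpha>: "\<alpha> = (k, i)" "k < length ds" "i \<le> ds ! k" using assms(2) by (auto simp: indices_def)
  have "(\<Sum>j\<le>ds ! k. c (k, j) * x ^ j) = 0" for x
    using fun_cong[OF assms(1), of "(k, vector [x, 1])"] \<alpha> by (simp add: form_basis_sum)
  then show ?thesis using \<alpha> polyfun_eq_0[of "\<lambda>j. c (k, j)" "ds ! k"] by auto
qed

lemma inj_form_basis: "inj_on (form_basis ds) (indices ds)"
proof (rule inj_onI)
  fix \<alpha> \<beta> assume ab: "\<alpha> \<in> indices ds" "\<beta> \<in> indices ds" "form_basis ds \<alpha> = form_basis ds \<beta>"
  show "\<alpha> = \<beta>"
  proof (rule ccontr)
    assume ne: "\<alpha> \<noteq> \<beta>"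
    define c where "c \<gamma> = (if \<gamma> = \<alpha> then 1 else if \<gamma> = \<beta> then -1 else (0::complex))" for \<gamma>
    have "(\<Sum>\<gamma>\<in>indices ds. cscale (c \<gamma>) (form_basis ds \<gamma>)) = (\<Sum>\<gamma>\<in>{\<alpha>, \<beta>}. cscale (c \<gamma>) (form_basis ds \<gamma>))"
      using ab by (intro sum.mono_neutral_right) (auto simp: c_def)
    also have "\<dots> = 0" using ne ab(3) by (simp add: c_def cscale_def fun_eq_iff)
    finally have "c \<alpha> = 0" using form_basis_coeffs ab by blast
    then show False by (simp add: c_def)
  qed
qed

lemma independent_form_basis: "cfun.independent (form_basis ds ` indices ds)"
proof (rule cfun.independent_if_scalars_zero)
  fix f x assume s: "(\<Sum>x\<in>form_basis ds ` indices ds. cscale (f x) x) = 0" and x: "x \<in> form_basis ds ` indices ds"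
  have "(\<Sum>\<alpha>\<in>indices ds. cscale (f (form_basis ds \<alpha>)) (form_basis ds \<alpha>)) = 0"
    using s by (simp add: sum.reindex inj_form_basis)
  then show "f x = 0" using form_basis_coeffs[of "\<lambda>\<alpha>. f (form_basis ds \<alpha>)"] x by auto
qed simp

lemma W_eq_span: "W ds = cfun.span (form_basis ds ` indices ds)"
proof
  show "W ds \<subseteq> cfun.span (form_basis ds ` indices ds)"
  proof
    fix w assume "w \<in> W ds"
    then obtain c where w: "w = (\<Sum>\<alpha>\<in>indices ds. cscale (c \<alpha>) (form_basis ds \<alpha>))" by (auto simp only: W_iff)
    show "w \<in> cfun.span (form_basis ds ` indices ds)"
      unfolding w by (rule cfun.span_sum) (rule cfun.span_scale, rule cfun.span_base, rule imageI)
  qed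
  show "cfun.span (form_basis ds ` indices ds) \<subseteq> W ds"
  proof
    fix w assume "w \<in> cfun.span (form_basis ds ` indices ds)"
    then obtain u where "w = (\<Sum>v\<in>form_basis ds ` indices ds. cscale (u v) v)"
      by (subst (asm) cfun.span_finite) auto
    then have "w = (\<Sum>\<alpha>\<in>indices ds. cscale (u (form_basis ds \<alpha>)) (form_basis ds \<alpha>))"
      by (simp add: sum.reindex inj_form_basis)
    then show "w \<in> W ds" unfolding W_iff by (intro exI)
  qed
qed

lemma dim_W: "cfun.dim (W ds) = card (indices ds)"
  by (simp add: W_eq_span cfun.dim_eq_card_independent independent_form_basis card_image inj_form_basis)

text \<open>A dual basis, but made of functionals on the whole function space, the kind that
  \<open>homogeneous_polys\<close> multiplies. On \<open>W ds\<close> the values are determined by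
  the basis; elsewhere they are arbitrary.\<close>

definition coord :: "nat list \<Rightarrow> nat \<times> nat \<Rightarrow> (nat \<times> (complex^2) \<Rightarrow> complex) \<Rightarrow> complex" where
  "coord ds \<alpha> = (SOME l. Vector_Spaces.linear cscale (*) l \<and>
      (\<forall>\<beta>\<in>indices ds. l (form_basis ds \<beta>) = (if \<beta> = \<alpha> then 1 else 0)))"

lemma coord: "Vector_Spaces.linear cscale (*) (coord ds \<alpha>)"
    "\<beta> \<in> indices ds \<Longrightarrow> coord ds \<alpha> (form_basis ds \<beta>) = (if \<beta> = \<alpha> then 1 else 0)"
proof -
  have "\<exists>l. Vector_Spaces.linear cscale (*) l \<and>
      (\<forall>x\<in>form_basis ds ` indices ds. l x = (if x = form_basis ds \<alpha> \<and> \<alpha> \<in> indices ds then 1 else 0))"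
    by (rule cfun_functional.linear_independent_extend[OF independent_form_basis])
  then have "\<exists>l. Vector_Spaces.linear cscale (*) l \<and>
      (\<forall>\<beta>\<in>indices ds. l (form_basis ds \<beta>) = (if \<beta> = \<alpha> then 1 else 0))"
  proof (elim exE conjE)
    fix l assume l: "Vector_Spaces.linear cscale (*) l"
      "\<forall>x\<in>form_basis ds ` indices ds. l x = (if x = form_basis ds \<alpha> \<and> \<alpha> \<in> indices ds then 1 else 0)"
    have "l (form_basis ds \<beta>) = (if \<beta> = \<alpha> then 1 else 0)" if "\<beta> \<in> indices ds" for \<beta>
      using l(2) that inj_onD[OF inj_form_basis, of ds \<beta> \<alpha>] by auto
    then show ?thesis using l(1) by blast
  qed
  from someI_ex[OF this, folded coord_def]
  show "Vector_Spaces.linear cscale (*) (coord ds \<alpha>)"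
    "\<beta> \<in> indices ds \<Longrightarrow> coord ds \<alpha> (form_basis ds \<beta>) = (if \<beta> = \<alpha> then 1 else 0)"
    by auto
qed

lemma functional_sum:
  assumes "Vector_Spaces.linear cscale (*) l"
  shows "l (\<Sum>\<alpha>\<in>A. cscale (c \<alpha>) (F \<alpha>)) = (\<Sum>\<alpha>\<in>A. c \<alpha> * l (F \<alpha>))"
proof -
  interpret l: Vector_Spaces.linear cscale "(*)" l by fact
  show ?thesis by (simp add: l.sum l.scale)
qed

lemma coord_sum: "\<alpha> \<in> indices ds \<Longrightarrow> coord ds \<alpha> (\<Sum>\<beta>\<in>indices ds. cscale (c \<beta>) (form_basis ds \<beta>)) = c \<alpha>"
  by (simp add: functional_sum coord if_distrib cong: if_cong)

lemma W_expand: "w \<in> W ds \<Longrightarrow> w = (\<Sum>\<alpha>\<in>indices ds. cscale (coord ds \<alpha> w) (form_basis ds \<alpha>))"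
  by (auto simp: W_iff coord_sum cong: sum.cong)

lemma W_apply:
  "w \<in> W ds \<Longrightarrow> w (k, v) = (if k < length ds then \<Sum>i\<le>ds ! k. coord ds (k, i) w * vec_nth v 1 ^ i * vec_nth v 2 ^ (ds ! k - i) else 0)"
  by (subst W_expand, assumption) (simp only: form_basis_sum)

lemma functional_on_W:
  assumes "Vector_Spaces.linear cscale (*) l" "w \<in> W ds"
  shows "l w = (\<Sum>\<alpha>\<in>indices ds. l (form_basis ds \<alpha>) * coord ds \<alpha> w)"
  by (subst W_expand[OF assms(2)]) (simp add: functional_sum[OF assms(1)] mult.commute)

lemma W_coordI:
  assumes "\<And>k v. w (k, v) = (if k < length ds then \<Sum>i\<le>ds ! k. c (k, i) * vec_nth v 1 ^ i * vec_nth v 2 ^ (ds ! k - i) else 0)"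
  shows "w \<in> W ds" "\<alpha> \<in> indices ds \<Longrightarrow> coord ds \<alpha> w = c \<alpha>"
proof -
  have w: "w = (\<Sum>\<beta>\<in>indices ds. cscale (c \<beta>) (form_basis ds \<beta>))"
    using assms by (auto simp: fun_eq_iff form_basis_sum)
  then show "w \<in> W ds" by (auto simp: W_iff)
  show "\<alpha> \<in> indices ds \<Longrightarrow> coord ds \<alpha> w = c \<alpha>" unfolding w by (rule coord_sum)
qed

text \<open>\<open>pullback\<close> substitutes the inverse matrix, so the first variable x becomes
  x - s y and the binomial theorem gives the new coefficients. They are polynomials in
  \<open>s\<close>, ready to be differentiated at zero.\<close>

lemma pullback_upper:
  assumes w: "w \<in> W ds"
  shows "pullback copies_act (upper s) w \<in> W ds"
    and "(k, j) \<in> indices ds \<Longrightarrow> coord ds (k, j) (pullback copies_act (upper s) w) =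
      (\<Sum>i\<le>ds ! k. coord ds (k, i) w * (if j \<le> i then of_nat (i choose j) * (- s) ^ (i - j) else 0))"
proof -
  define c where "c = (\<lambda>(k, j). \<Sum>i\<le>ds ! k. coord ds (k, i) w * (if j \<le> i then of_nat (i choose j) * (- s) ^ (i - j) else 0))"
  have *: "pullback copies_act (upper s) w (k, v) =
     (if k < length ds then \<Sum>i\<le>ds ! k. c (k, i) * vec_nth v 1 ^ i * vec_nth v 2 ^ (ds ! k - i) else 0)" for k v
  proof (cases "k < length ds")
    case True
    define x y d where xy: "x = vec_nth v 1" "y = vec_nth v 2" "d = ds ! k"
    have bin: "(x - s * y) ^ i * y ^ (d - i) = (\<Sum>j\<le>d. (if j \<le> i then of_nat (i choose j) * (- s) ^ (i - j) else 0) * (x ^ j * y ^ (d - j)))"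
      if "i \<le> d" for i
    proof -
      have "(x + (- s * y)) ^ i * y ^ (d - i) = (\<Sum>j\<le>i. of_nat (i choose j) * x ^ j * (- s * y) ^ (i - j)) * y ^ (d - i)"
        by (subst binomial_ring) simp
      also have "\<dots> = (\<Sum>j\<le>i. of_nat (i choose j) * (- s) ^ (i - j) * (x ^ j * y ^ (d - j)))"
        unfolding sum_distrib_right
      proof (rule sum.cong, simp)
        fix j assume "j \<in> {..i}"
        then have "d - j = (i - j) + (d - i)" using that by auto
        then have "y ^ (d - j) = y ^ (i - j) * y ^ (d - i)" by (simp add: power_add)
        then show "of_nat (i choose j) * x ^ j * (- s * y) ^ (i - j) * y ^ (d - i) = of_nat (i choose j) * (- s) ^ (i - j) * (x ^ j * y ^ (d - j))"
          by (simp only: power_mult_distrib mult_ac)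
      qed
      also have "\<dots> = (\<Sum>j\<le>d. (if j \<le> i then of_nat (i choose j) * (- s) ^ (i - j) else 0) * (x ^ j * y ^ (d - j)))"
        using that by (intro sum.mono_neutral_cong_left) auto
      finally show ?thesis by simp
    qed
    have "pullback copies_act (upper s) w (k, v) = (\<Sum>i\<le>d. coord ds (k, i) w * ((x - s * y) ^ i * y ^ (d - i)))"
      unfolding pullback_def copies_act_def using True
      by (simp add: W_apply[OF w] upper_inv) (simp add: upper_def xy mult.assoc)
    also have "\<dots> = (\<Sum>i\<le>d. coord ds (k, i) w * (\<Sum>j\<le>d. (if j \<le> i then of_nat (i choose j) * (- s) ^ (i - j) else 0) * (x ^ j * y ^ (d - j))))"
      by (intro sum.cong) (simp_all add: bin)
    also have "\<dots> = (\<Sum>j\<le>d. c (k, j) * (x ^ j * y ^ (d - j)))"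
      unfolding c_def prod.case xy(3)[symmetric] sum_distrib_left sum_distrib_right
      by (subst sum.swap) (simp add: mult.assoc)
    finally show ?thesis using True by (simp add: xy mult.assoc)
  qed (simp add: pullback_def copies_act_def W_apply[OF w])
  from W_coordI[of _ ds c, OF this] show "pullback copies_act (upper s) w \<in> W ds"
    "(k, j) \<in> indices ds \<Longrightarrow> coord ds (k, j) (pullback copies_act (upper s) w) =
      (\<Sum>i\<le>ds ! k. coord ds (k, i) w * (if j \<le> i then of_nat (i choose j) * (- s) ^ (i - j) else 0))"
    by (simp_all add: c_def)
qed

text \<open>Here y becomes y - s x, so the binomial expansion is that of the power of y, with
  exponent \<open>ds ! k - i\<close>.\<close>

lemma pullback_lower:
  assumes w: "w \<in> W ds"
  shows "pullback copies_act (lower s) w \<in> W ds"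
    and "(k, j) \<in> indices ds \<Longrightarrow> coord ds (k, j) (pullback copies_act (lower s) w) =
      (\<Sum>i\<le>ds ! k. coord ds (k, i) w * (if i \<le> j then of_nat ((ds ! k - i) choose (j - i)) * (- s) ^ (j - i) else 0))"
proof -
  define c where "c = (\<lambda>(k, j). \<Sum>i\<le>ds ! k. coord ds (k, i) w * (if i \<le> j then of_nat ((ds ! k - i) choose (j - i)) * (- s) ^ (j - i) else 0))"
  have *: "pullback copies_act (lower s) w (k, v) =
     (if k < length ds then \<Sum>i\<le>ds ! k. c (k, i) * vec_nth v 1 ^ i * vec_nth v 2 ^ (ds ! k - i) else 0)" for k v
  proof (cases "k < length ds")
    case True
    define x y d where xy: "x = vec_nth v 1" "y = vec_nth v 2" "d = ds ! k"
    have bin: "x ^ i * (y - s * x) ^ (d - i) = (\<Sum>j\<le>d. (if i \<le> j then of_nat ((d - i) choose (j - i)) * (- s) ^ (j - i) else 0) * (x ^ j * y ^ (d - j)))"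
      if "i \<le> d" for i
    proof -
      have "x ^ i * ((- s * x) + y) ^ (d - i) = x ^ i * (\<Sum>m\<le>d - i. of_nat ((d - i) choose m) * (- s * x) ^ m * y ^ (d - i - m))"
        by (subst binomial_ring) simp
      also have "\<dots> = (\<Sum>m\<le>d - i. of_nat ((d - i) choose m) * (- s) ^ m * (x ^ (m + i) * y ^ (d - (m + i))))"
        unfolding sum_distrib_left
        by (simp only: power_mult_distrib power_add mult_ac diff_diff_eq add.commute)
      also have "\<dots> = (\<Sum>j\<in>{i..d}. of_nat ((d - i) choose (j - i)) * (- s) ^ (j - i) * (x ^ j * y ^ (d - j)))"
        by (rule sum.reindex_bij_witness[of _ "\<lambda>j. j - i" "\<lambda>m. m + i"]) (use that in auto)
      also have "\<dots> = (\<Sum>j\<le>d. (if i \<le> j then of_nat ((d - i) choose (j - i)) * (- s) ^ (j - i) else 0) * (x ^ j * y ^ (d - j)))"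
        by (intro sum.mono_neutral_cong_left) auto
      finally show ?thesis by simp
    qed
    have "pullback copies_act (lower s) w (k, v) = (\<Sum>i\<le>d. coord ds (k, i) w * (x ^ i * (y - s * x) ^ (d - i)))"
      unfolding pullback_def copies_act_def using True
      by (simp add: W_apply[OF w] lower_inv) (simp add: lower_def xy mult.assoc)
    also have "\<dots> = (\<Sum>i\<le>d. coord ds (k, i) w * (\<Sum>j\<le>d. (if i \<le> j then of_nat ((d - i) choose (j - i)) * (- s) ^ (j - i) else 0) * (x ^ j * y ^ (d - j))))"
      by (intro sum.cong) (simp_all add: bin)
    also have "\<dots> = (\<Sum>j\<le>d. c (k, j) * (x ^ j * y ^ (d - j)))"
      unfolding c_def prod.case xy(3)[symmetric] sum_distrib_left sum_distrib_right
      by (subst sum.swap) (simp add: mult.assoc)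
    finally show ?thesis using True by (simp add: xy mult.assoc)
  qed (simp add: pullback_def copies_act_def W_apply[OF w])
  from W_coordI[of _ ds c, OF this] show "pullback copies_act (lower s) w \<in> W ds"
    "(k, j) \<in> indices ds \<Longrightarrow> coord ds (k, j) (pullback copies_act (lower s) w) =
      (\<Sum>i\<le>ds ! k. coord ds (k, i) w * (if i \<le> j then of_nat ((ds ! k - i) choose (j - i)) * (- s) ^ (j - i) else 0))"
    by (simp_all add: c_def)
qed

text \<open>The exponent is the negative of the weight 2 j - d, again because the inverse matrix is
  substituted.\<close>

lemma pullback_torus:
  assumes w: "w \<in> W ds" and z: "z \<noteq> 0"
  shows "pullback copies_act (torus z) w \<in> W ds"
    and "(k, j) \<in> indices ds \<Longrightarrow> coord ds (k, j) (pullback copies_act (torus z) w) =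
      z powi (int (ds ! k) - 2 * int j) * coord ds (k, j) w"
proof -
  define c where "c = (\<lambda>(k, j). z powi (int (ds ! k) - 2 * int j) * coord ds (k, j) w)"
  have *: "pullback copies_act (torus z) w (k, v) =
     (if k < length ds then \<Sum>i\<le>ds ! k. c (k, i) * vec_nth v 1 ^ i * vec_nth v 2 ^ (ds ! k - i) else 0)" for k v
  proof (cases "k < length ds")
    case True
    have "inverse z ^ i * z ^ (d - i) = z powi (int d - 2 * int i)" if "i \<le> d" for i d
    proof -
      have "inverse z ^ i * z ^ (d - i) = z powi (- int i) * z powi (int (d - i))"
        by (simp add: power_int_minus power_inverse)
      also have "\<dots> = z powi (- int i + int (d - i))" using z by (subst power_int_add) auto
      finally show ?thesis using that by (simp add: algebra_simps of_nat_diff)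
    qed
    note pw = this
    have "pullback copies_act (torus z) w (k, v) =
      (\<Sum>i\<le>ds ! k. coord ds (k, i) w * (inverse z * vec_nth v 1) ^ i * (z * vec_nth v 2) ^ (ds ! k - i))"
      using True z
      by (simp add: pullback_def copies_act_def W_apply[OF w] torus_inv) (simp add: torus_def)
    also have "\<dots> = (\<Sum>i\<le>ds ! k. (inverse z ^ i * z ^ (ds ! k - i)) * coord ds (k, i) w * vec_nth v 1 ^ i * vec_nth v 2 ^ (ds ! k - i))"
      by (simp only: power_mult_distrib mult_ac)
    also have "\<dots> = (\<Sum>i\<le>ds ! k. c (k, i) * vec_nth v 1 ^ i * vec_nth v 2 ^ (ds ! k - i))"
      by (rule sum.cong) (simp_all add: c_def pw)
    finally show ?thesis using True by simp
  qed (simp add: pullback_def copies_act_def W_apply[OF w])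
  from W_coordI[of _ ds c, OF this] show "pullback copies_act (torus z) w \<in> W ds"
    "(k, j) \<in> indices ds \<Longrightarrow> coord ds (k, j) (pullback copies_act (torus z) w) =
      z powi (int (ds ! k) - 2 * int j) * coord ds (k, j) w"
    by (simp_all add: c_def)
qed

lemma cfun_span_image_finite:
  assumes "finite A" "inj_on g A" "F \<in> cfun.span (g ` A)"
  obtains c where "F = (\<Sum>a\<in>A. cscale (c a) (g a))"
proof -
  have "F \<in> range (\<lambda>u. \<Sum>v\<in>g ` A. cscale (u v) v)"
    using assms by (simp only: cfun.span_finite finite_imageI)
  then obtain u where "F = (\<Sum>v\<in>g ` A. cscale (u v) v)" by (rule rangeE)
  then have "F = (\<Sum>a\<in>A. cscale (u (g a)) (g a))" by (simp only: sum.reindex[OF assms(2)] o_def)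
  then show thesis by (rule that)
qed

text \<open>The vanishing of all power sums extends to all polynomials; the polynomial with roots at
  every node except \<open>y a\<close> then isolates \<open>c a\<close>.\<close>

lemma powers_independent:
  fixes y :: "'a \<Rightarrow> complex"
  assumes fin: "finite A" and inj: "inj_on y A" and zero: "\<And>m::nat. (\<Sum>a\<in>A. c a * y a ^ m) = 0" and a: "a \<in> A"
  shows "c a = 0"
proof -
  have poly0: "(\<Sum>a\<in>A. c a * poly p (y a)) = 0" for p
  proof -
    have "(\<Sum>a\<in>A. c a * poly p (y a)) = (\<Sum>i\<le>degree p. coeff p i * (\<Sum>a\<in>A. c a * y a ^ i))"
      by (simp add: poly_altdef sum_distrib_left sum.swap[of _ A] mult_ac)
    then show ?thesis using zero by simp
  qed
  define p where "p = (\<Prod>b\<in>A - {a}. [:- y b, 1:])"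
  have p: "poly p x = (\<Prod>b\<in>A - {a}. x - y b)" for x by (simp add: p_def poly_prod)
  have "(\<Sum>b\<in>A. c b * poly p (y b)) = (\<Sum>b\<in>A. if b = a then c a * poly p (y a) else 0)"
    using fin by (intro sum.cong refl) (auto simp: p intro!: prod_zero)
  then have "c a * poly p (y a) = 0" using poly0 fin a by simp
  moreover have "poly p (y a) \<noteq> 0" using inj a fin by (auto simp: p inj_on_def)
  ultimately show ?thesis by simp
qed

lemma infinite_prime_nats: "infinite {p::nat. prime p}"
  using primes_infinite by simp

text \<open>The number called \<open>N n c\<close> in the overview: a multiset of indices stands for
  a monomial.\<close>

definition wcount :: "('i \<Rightarrow> int) \<Rightarrow> 'i set \<Rightarrow> nat \<Rightarrow> int \<Rightarrow> nat" where
  "wcount wt I n c = card {\<mu>. set_mset \<mu> \<subseteq> I \<and> size \<mu> = n \<and> (\<Sum>\<alpha>\<in>#\<mu>. wt \<alpha>) = c}"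

definition SL2_act :: "complex^2^2 \<Rightarrow> (nat \<times> (complex^2) \<Rightarrow> complex) \<times> (complex^2) \<Rightarrow>
    (nat \<times> (complex^2) \<Rightarrow> complex) \<times> (complex^2)" where
  "SL2_act g = (\<lambda>(w, v). (pullback copies_act g w, g *v v))"

lemma mat2_one_vector: "mat2 1 0 0 1 *v v = v"
  by (simp add: Finite_Cartesian_Product.vec_eq_iff forall_2)

lemma SL2_act_one: "SL2_act (mat2 1 0 0 1) p = p"
proof -
  have "matrix_inv (mat2 1 0 0 1) = mat2 1 0 0 1" by (subst mat2_inv) simp_all
  then show ?thesis
    by (cases p) (auto simp: SL2_act_def pullback_def copies_act_def mat2_one_vector fun_eq_iff)
qed

lemma SL2_act_mult: "g \<in> SL2 \<Longrightarrow> h \<in> SL2 \<Longrightarrow> SL2_act (g ** h) p = SL2_act g (SL2_act h p)"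
  by (cases p) (auto simp: SL2_act_def pullback_def copies_act_def SL2_inv_mult matrix_vector_mul_assoc fun_eq_iff)

text \<open>A relation rather than an operator, since an arbitrary function need not be
  differentiable along an orbit; sums, multiples and products enter as closure properties.\<close>

definition der :: "(complex \<Rightarrow> complex^2^2) \<Rightarrow> ((nat \<times> (complex^2) \<Rightarrow> complex) \<times> (complex^2) \<Rightarrow> complex) \<Rightarrow>
    ((nat \<times> (complex^2) \<Rightarrow> complex) \<times> (complex^2) \<Rightarrow> complex) \<Rightarrow> bool" where
  "der \<tau> F G \<longleftrightarrow> (\<forall>p. ((\<lambda>s. F (SL2_act (\<tau> s) p)) has_field_derivative G p) (at 0))"

lemma der_unique: "der \<tau> F G \<Longrightarrow> der \<tau> F G' \<Longrightarrow> G = G'"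
  unfolding der_def fun_eq_iff by (meson DERIV_unique)

lemma der_add: "der \<tau> F G \<Longrightarrow> der \<tau> F' G' \<Longrightarrow> der \<tau> (F + F') (G + G')"
  unfolding der_def by (auto intro: DERIV_add)

lemma der_scale: "der \<tau> F G \<Longrightarrow> der \<tau> (cscale c F) (cscale c G)"
  unfolding der_def cscale_def by (auto intro: DERIV_cmult)

lemma der_zero: "der \<tau> 0 0"
  unfolding der_def by simp

lemma der_mult:
  assumes "\<tau> 0 = mat2 1 0 0 1" "der \<tau> F G" "der \<tau> F' G'"
  shows "der \<tau> (F * F') (G * F' + F * G')"
  unfolding der_def
proof
  fix p
  have "((\<lambda>s. F (SL2_act (\<tau> s) p) * F' (SL2_act (\<tau> s) p)) has_field_derivative
      G p * F' (SL2_act (\<tau> 0) p) + G' p * F (SL2_act (\<tau> 0) p)) (at 0)"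
    using assms unfolding der_def by (intro DERIV_mult) blast+
  then show "((\<lambda>s. (F * F') (SL2_act (\<tau> s) p)) has_field_derivative (G * F' + F * G') p) (at 0)"
    by (simp add: assms(1) SL2_act_one mult.commute)
qed

lemma has_derivative_monomial_at_0:
  "((\<lambda>s::complex. C * (- s) ^ n) has_field_derivative (if n = 1 then - C else 0)) (at 0)"
proof (cases n)
  case (Suc m)
  have "((\<lambda>s::complex. C * (- s) ^ Suc m) has_field_derivative C * (of_nat (Suc m) * (-1 * (- 0) ^ m))) (at 0)"
    by (rule derivative_eq_intros refl | simp)+
  then show ?thesis using Suc by (cases m) auto
qed simp

section \<open>Polynomial functions on the forms together with an auxiliary plane\<close>

locale binary_forms = fixes ds :: "nat list"
begin

definition J :: "(nat \<times> nat) set" where "J = indices (ds @ [1])"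
definition deg :: "nat \<times> nat \<Rightarrow> nat" where "deg \<alpha> = (ds @ [1]) ! fst \<alpha>"
definition wt :: "nat \<times> nat \<Rightarrow> int" where "wt \<alpha> = 2 * int (snd \<alpha>) - int (deg \<alpha>)"

text \<open>The auxiliary block \<open>k = length ds\<close> stands for the coordinates of the plane; the sign
  makes the two unipotent derivations act on it as on a block of degree one.\<close>

definition gen :: "nat \<times> nat \<Rightarrow> (nat \<times> (complex^2) \<Rightarrow> complex) \<times> (complex^2) \<Rightarrow> complex" where
  "gen \<alpha> = (\<lambda>(w, v). if fst \<alpha> < length ds then coord ds \<alpha> w
     else if snd \<alpha> = 0 then vec_nth v 1 else - vec_nth v 2)"

text \<open>The cut-off outside \<open>W ds\<close> follows the convention of
  \<open>homogeneous_polys\<close>. In particular \<open>mon {#}\<close> is the indicator of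
  \<open>W ds\<close> in the first component and not the constant 1.\<close>

definition mon :: "(nat \<times> nat) multiset \<Rightarrow> (nat \<times> (complex^2) \<Rightarrow> complex) \<times> (complex^2) \<Rightarrow> complex" where
  "mon \<mu> = (\<lambda>p. if fst p \<in> W ds then \<Prod>\<alpha>\<in>#\<mu>. gen \<alpha> p else 0)"

definition mdeg1 :: "(nat \<times> nat) multiset \<Rightarrow> nat" where "mdeg1 \<mu> = size (filter_mset (\<lambda>\<alpha>. fst \<alpha> < length ds) \<mu>)"
definition mdeg2 :: "(nat \<times> nat) multiset \<Rightarrow> nat" where "mdeg2 \<mu> = size (filter_mset (\<lambda>\<alpha>. \<not> fst \<alpha> < length ds) \<mu>)"
definition weight :: "(nat \<times> nat) multiset \<Rightarrow> int" where "weight \<mu> = (\<Sum>\<alpha>\<in>#\<mu>. wt \<alpha>)"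

definition bimons :: "nat \<Rightarrow> nat \<Rightarrow> (nat \<times> nat) multiset set" where
  "bimons n l = {\<mu>. set_mset \<mu> \<subseteq> J \<and> mdeg1 \<mu> = n \<and> mdeg2 \<mu> = l}"

definition mons :: "nat \<Rightarrow> nat \<Rightarrow> int \<Rightarrow> (nat \<times> nat) multiset set" where
  "mons n l c = {\<mu> \<in> bimons n l. weight \<mu> = c}"

definition allmons :: "(nat \<times> nat) multiset set" where "allmons = {\<mu>. set_mset \<mu> \<subseteq> J}"

definition U :: "nat \<Rightarrow> nat \<Rightarrow> int \<Rightarrow> ((nat \<times> (complex^2) \<Rightarrow> complex) \<times> (complex^2) \<Rightarrow> complex) set" where
  "U n l c = cfun.span (mon ` mons n l c)"

definition Pol :: "((nat \<times> (complex^2) \<Rightarrow> complex) \<times> (complex^2) \<Rightarrow> complex) set" where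
  "Pol = cfun.span (mon ` allmons)"

lemma J_iff: "(k, j) \<in> J \<longleftrightarrow> k \<le> length ds \<and> j \<le> deg (k, j)"
  by (auto simp: J_def indices_def deg_def)

lemma J_cases: "\<alpha> \<in> J \<longleftrightarrow> \<alpha> \<in> indices ds \<or> \<alpha> = (length ds, 0) \<or> \<alpha> = (length ds, 1)"
  by (cases \<alpha>) (auto simp: J_def indices_def nth_append le_Suc_eq split: if_splits)

lemma finite_J [simp]: "finite J" by (simp add: J_def)

lemma deg_pair: "k < length ds \<Longrightarrow> deg (k, j) = ds ! k" "deg (length ds, j) = 1"
  by (simp_all add: deg_def nth_append)

lemma deg_indep: "deg (k, i) = deg (k, j)" by (simp add: deg_def)

lemma mdeg_size: "mdeg1 \<mu> + mdeg2 \<mu> = size \<mu>"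
  unfolding mdeg1_def mdeg2_def by (metis multiset_partition size_union)

lemma mdeg_simps [simp]: "mdeg1 {#} = 0" "mdeg2 {#} = 0" "weight {#} = 0"
  "mdeg1 (\<mu> + \<nu>) = mdeg1 \<mu> + mdeg1 \<nu>" "mdeg2 (\<mu> + \<nu>) = mdeg2 \<mu> + mdeg2 \<nu>" "weight (\<mu> + \<nu>) = weight \<mu> + weight \<nu>"
  "weight {#\<alpha>#} = wt \<alpha>"
  "mdeg1 {#\<alpha>#} = (if fst \<alpha> < length ds then 1 else 0)" "mdeg2 {#\<alpha>#} = (if fst \<alpha> < length ds then 0 else 1)"
  by (simp_all add: mdeg1_def mdeg2_def weight_def)

lemma mdeg_add_mset: "mdeg1 (add_mset \<alpha> \<mu>) = (if fst \<alpha> < length ds then 1 else 0) + mdeg1 \<mu>"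
  "mdeg2 (add_mset \<alpha> \<mu>) = (if fst \<alpha> < length ds then 0 else 1) + mdeg2 \<mu>"
  "weight (add_mset \<alpha> \<mu>) = wt \<alpha> + weight \<mu>"
  by (simp_all add: mdeg1_def mdeg2_def weight_def)

lemma mon_union: "mon (\<mu> + \<nu>) = mon \<mu> * mon \<nu>"
  by (auto simp: mon_def fun_eq_iff)

lemma mon_add_mset: "mon (add_mset \<alpha> \<mu>) = mon {#\<alpha>#} * mon \<mu>"
  by (auto simp: mon_def fun_eq_iff)

lemma finite_bimons: "finite (bimons n l)"
  by (rule finite_subset[of _ "multisets_of_size J (n + l)"])
    (auto simp: bimons_def multisets_of_size_def mdeg_size[symmetric] simp del: finite_J intro: finite_multisets_of_size[OF finite_J, unfolded multisets_of_size_def mdeg_size[symmetric]])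

lemma finite_mons: "finite (mons n l c)"
  by (rule finite_subset[OF _ finite_bimons[of n l]]) (auto simp: mons_def)

lemma mons_allmons: "mons n l c \<subseteq> allmons" and bimons_allmons: "bimons n l \<subseteq> allmons"
  and mons_bimons: "mons n l c \<subseteq> bimons n l"
  by (auto simp: mons_def bimons_def allmons_def)

lemma U_Pol: "U n l c \<subseteq> Pol"
  unfolding U_def Pol_def by (intro cfun.span_mono image_mono mons_allmons)

lemma span_mult:
  assumes "F \<in> cfun.span (mon ` A)" "G \<in> cfun.span (mon ` B)" and AB: "\<And>\<mu> \<nu>. \<mu> \<in> A \<Longrightarrow> \<nu> \<in> B \<Longrightarrow> \<mu> + \<nu> \<in> C"
  shows "F * G \<in> cfun.span (mon ` C)"
proof -
  have 1: "mon \<mu> * G \<in> cfun.span (mon ` C)" if \<mu>: "\<mu> \<in> A" for \<mu>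
    using assms(2)
  proof (induction rule: cfun.span_induct_alt)
    case base
    show ?case by (simp only: mult_zero_right cfun.span_zero)
  next
    case (step c x y)
    have "mon \<mu> * (cscale c x + y) = cscale c (mon \<mu> * x) + mon \<mu> * y"
      by (simp add: fun_eq_iff cscale_def algebra_simps)
    moreover have "mon \<mu> * x \<in> mon ` C" using step AB[OF \<mu>] by (auto simp: mon_union[symmetric])
    ultimately show ?case using step
      by (simp only: cfun.span_add cfun.span_scale cfun.span_base)
  qed
  show ?thesis using assms(1)
  proof (induction rule: cfun.span_induct_alt)
    case base
    show ?case by (simp only: mult_zero_left cfun.span_zero)
  next
    case (step c x y)
    have "(cscale c x + y) * G = cscale c (x * G) + y * G"
      by (simp add: fun_eq_iff cscale_def algebra_simps)
    moreover have "x * G \<in> cfun.span (mon ` C)" using step 1 by auto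
    ultimately show ?case using step
      by (simp only: cfun.span_add cfun.span_scale)
  qed
qed

lemma Pol_mult: "F \<in> Pol \<Longrightarrow> G \<in> Pol \<Longrightarrow> F * G \<in> Pol"
  unfolding Pol_def by (erule span_mult) (auto simp: allmons_def)

lemma U_mult: "F \<in> U n l c \<Longrightarrow> G \<in> U n' l' c' \<Longrightarrow> F * G \<in> U (n + n') (l + l') (c + c')"
  unfolding U_def by (erule span_mult) (auto simp: mons_def bimons_def)

lemma mon_U: "\<mu> \<in> mons n l c \<Longrightarrow> mon \<mu> \<in> U n l c"
  unfolding U_def by (intro cfun.span_base imageI)

lemma mon_Pol: "\<mu> \<in> allmons \<Longrightarrow> mon \<mu> \<in> Pol"
  unfolding Pol_def by (intro cfun.span_base imageI)

text \<open>Points whose coordinates are m-th powers of distinct primes: by unique factorisation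
  different monomials have different values there. The minus sign in the plane component cancels the
  one in \<open>gen\<close>.\<close>

lemma prime_points:
  obtains \<pi> :: "nat \<times> nat \<Rightarrow> nat" and p :: "nat \<Rightarrow> (nat \<times> (complex^2) \<Rightarrow> complex) \<times> (complex^2)"
  where "inj \<pi>" "\<And>\<alpha>. prime (\<pi> \<alpha>)" "\<And>\<mu> m. \<mu> \<in> allmons \<Longrightarrow> mon \<mu> (p m) = of_nat (\<Prod>\<alpha>\<in>#\<mu>. \<pi> \<alpha>) ^ m"
proof -
  obtain q :: "nat \<Rightarrow> nat" where q: "inj q" "range q \<subseteq> {p. prime p}"
    using infinite_countable_subset[OF infinite_prime_nats] by blast
  define \<pi> :: "nat \<times> nat \<Rightarrow> nat" where "\<pi> = q \<circ> to_nat"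
  have pi: "inj \<pi>" "\<And>\<alpha>. prime (\<pi> \<alpha>)" using q by (auto simp: \<pi>_def intro: inj_compose)
  define p where "p m = ((\<Sum>\<alpha>\<in>indices ds. cscale (of_nat (\<pi> \<alpha>) ^ m) (form_basis ds \<alpha>)),
    (vector [of_nat (\<pi> (length ds, 0)) ^ m, - (of_nat (\<pi> (length ds, 1)) ^ m)] :: complex^2))" for m
  have gen: "gen \<alpha> (p m) = of_nat (\<pi> \<alpha>) ^ m" if "\<alpha> \<in> J" for \<alpha> m
    using that unfolding J_cases
  proof (elim disjE)
    assume a: "\<alpha> \<in> indices ds"
    then have "fst \<alpha> < length ds" by (auto simp: indices_def)
    then show ?thesis using a by (simp add: gen_def p_def coord_sum)
  qed (simp_all add: gen_def p_def)
  have "mon \<mu> (p m) = of_nat (\<Prod>\<alpha>\<in>#\<mu>. \<pi> \<alpha>) ^ m" if "\<mu> \<in> allmons" for \<mu> m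
  proof -
    have "fst (p m) \<in> W ds" by (auto simp: p_def W_iff)
    moreover have "(\<Prod>\<alpha>\<in>#\<mu>. gen \<alpha> (p m)) = of_nat (\<Prod>\<alpha>\<in>#\<mu>. \<pi> \<alpha>) ^ m"
      using that unfolding allmons_def
      by (induction \<mu>) (auto simp: gen power_mult_distrib)
    ultimately show ?thesis by (simp add: mon_def)
  qed
  then show thesis using pi that by blast
qed

text \<open>Evaluated at the prime points, a relation becomes a vanishing combination of m-th powers
  of distinct integers for every m.\<close>

lemma mon_coeffs:
  assumes A: "A \<subseteq> allmons" "finite A" and zero: "(\<Sum>\<mu>\<in>A. cscale (c \<mu>) (mon \<mu>)) = 0" and \<mu>: "\<mu> \<in> A"
  shows "c \<mu> = 0"
proof -
  obtain \<pi> p where pi: "inj \<pi>" "\<And>\<alpha>. prime (\<pi> \<alpha>)"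
    and p: "\<And>\<mu> m. \<mu> \<in> allmons \<Longrightarrow> mon \<mu> (p m) = of_nat (\<Prod>\<alpha>\<in>#\<mu>. \<pi> \<alpha>) ^ m"
    using prime_points by blast
  have inj: "inj_on (\<lambda>\<mu>. of_nat (\<Prod>\<alpha>\<in>#\<mu>. \<pi> \<alpha>) :: complex) A"
  proof (rule inj_onI)
    fix \<mu> \<nu> assume "(of_nat (\<Prod>\<alpha>\<in>#\<mu>. \<pi> \<alpha>) :: complex) = of_nat (\<Prod>\<alpha>\<in>#\<nu>. \<pi> \<alpha>)"
    then have "prod_mset (image_mset \<pi> \<mu>) = prod_mset (image_mset \<pi> \<nu>)" by (simp only: of_nat_eq_iff)
    moreover have "prime_factorization (prod_mset (image_mset \<pi> M)) = image_mset \<pi> M" for M :: "(nat \<times> nat) multiset"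
      by (rule prime_factorization_prod_mset_primes) (use pi(2) in auto)
    ultimately have "image_mset \<pi> \<mu> = image_mset \<pi> \<nu>" by metis
    then have "image_mset (inv_into UNIV \<pi>) (image_mset \<pi> \<mu>) = image_mset (inv_into UNIV \<pi>) (image_mset \<pi> \<nu>)" by simp
    then show "\<mu> = \<nu>" using pi(1) by (simp add: multiset.map_comp inv_o_cancel)
  qed
  show ?thesis
  proof (rule powers_independent[OF A(2) inj _ \<mu>])
    fix m
    have "(\<Sum>\<mu>\<in>A. cscale (c \<mu>) (mon \<mu>)) (p m) = 0" by (simp only: zero zero_fun_def)
    then show "(\<Sum>\<mu>\<in>A. c \<mu> * of_nat (\<Prod>\<alpha>\<in>#\<mu>. \<pi> \<alpha>) ^ m) = 0"
      using A(1) by (simp add: fun_sum_apply cscale_def p subset_iff)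
  qed
qed

lemma inj_mon: "inj_on mon allmons"
proof (rule inj_onI)
  fix \<mu> \<nu> assume a: "\<mu> \<in> allmons" "\<nu> \<in> allmons" "mon \<mu> = mon \<nu>"
  show "\<mu> = \<nu>"
  proof (rule ccontr)
    assume ne: "\<mu> \<noteq> \<nu>"
    define c where "c = (\<lambda>\<kappa>. if \<kappa> = \<mu> then 1 else (- 1 :: complex))"
    have "(\<Sum>\<kappa>\<in>{\<mu>, \<nu>}. cscale (c \<kappa>) (mon \<kappa>)) = 0"
      using ne a(3) by (simp add: c_def cscale_def fun_eq_iff)
    then have "c \<mu> = 0" by (rule mon_coeffs[rotated 2]) (use a in auto)
    then show False by (simp add: c_def)
  qed
qed

lemma independent_mon: "cfun.independent (mon ` allmons)"
  unfolding cfun.independent_explicit_finite_subsets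
proof (intro allI impI ballI)
  fix S u v assume S: "S \<subseteq> mon ` allmons" "finite S" "(\<Sum>v\<in>S. cscale (u v) v) = 0" "v \<in> S"
  obtain A where A: "A \<subseteq> allmons" "S = mon ` A" using S(1) by (auto simp: subset_image_iff)
  have inj: "inj_on mon A" using inj_mon A(1) by (rule inj_on_subset)
  have fin: "finite A" using S(2) A(2) inj by (simp add: finite_image_iff)
  have "(\<Sum>\<mu>\<in>A. cscale (u (mon \<mu>)) (mon \<mu>)) = 0" using S(3) by (simp only: A(2) sum.reindex[OF inj] o_def)
  then have "\<And>\<mu>. \<mu> \<in> A \<Longrightarrow> u (mon \<mu>) = 0" by (rule mon_coeffs[OF A(1) fin])
  then show "u v = 0" using S(4) A(2) by auto
qed

lemma dim_U: "cfun.dim (U n l c) = card (mons n l c)"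
proof -
  have "cfun.independent (mon ` mons n l c)"
    by (rule cfun.independent_mono[OF independent_mon]) (intro image_mono mons_allmons)
  then have "cfun.dim (U n l c) = card (mon ` mons n l c)" unfolding U_def by (rule cfun.dim_span_eq_card_independent)
  then show ?thesis using inj_on_subset[OF inj_mon mons_allmons] by (simp add: card_image)
qed

end

section \<open>The Lie algebra action and the dimension of the covariants\<close>

context binary_forms begin

text \<open>Monomials are cut off outside \<open>W ds\<close>, so differentiating them along an
  orbit requires the cut-off to be constant there. One direction is enough, because the inverse is a
  matrix of the same type.\<close>

lemma W_act_iff:
  assumes "g = upper s \<or> g = lower s \<or> (s \<noteq> 0 \<and> g = torus s)"
  shows "fst (SL2_act g p) \<in> W ds \<longleftrightarrow> fst p \<in> W ds"
proof -
  have *: "fst (SL2_act g p) \<in> W ds" if "fst p \<in> W ds" "g = upper s \<or> g = lower s \<or> (s \<noteq> 0 \<and> g = torus s)" for g s p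
    using that pullback_upper(1) pullback_lower(1) pullback_torus(1)
    by (cases p) (auto simp: SL2_act_def)
  have g: "g \<in> SL2" using assms by auto
  have "matrix_inv g ** g = mat2 1 0 0 1"
    using assms by (auto simp: upper_inv lower_inv torus_inv) (simp_all add: upper_def lower_def torus_def mat2_mult)
  then have "SL2_act (matrix_inv g) (SL2_act g p) = p"
    using SL2_act_mult[OF SL2_inv[OF g] g] by (simp add: SL2_act_one)
  moreover have "\<exists>t. matrix_inv g = upper t \<or> matrix_inv g = lower t \<or> (t \<noteq> 0 \<and> matrix_inv g = torus t)"
    using assms by (auto simp: upper_inv lower_inv torus_inv) (metis inverse_nonzero_iff_nonzero)+
  ultimately show ?thesis using * assms by metis
qed

lemma mon_single: "mon {#\<alpha>#} p = (if fst p \<in> W ds then gen \<alpha> p else 0)"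
  by (simp add: mon_def)

text \<open>Among the binomial terms of \<open>pullback_upper\<close> only the one with i = j + 1 is
  linear in \<open>s\<close>; its coefficient is -(j + 1). In \<open>lower_gen\<close> the term i =
  j - 1 gives -(d - j + 1).\<close>

definition raise_gen :: "nat \<times> nat \<Rightarrow> (nat \<times> (complex^2) \<Rightarrow> complex) \<times> (complex^2) \<Rightarrow> complex" where
  "raise_gen \<alpha> = (if snd \<alpha> < deg \<alpha> then cscale (- of_nat (Suc (snd \<alpha>))) (mon {#(fst \<alpha>, Suc (snd \<alpha>))#}) else 0)"

definition lower_gen :: "nat \<times> nat \<Rightarrow> (nat \<times> (complex^2) \<Rightarrow> complex) \<times> (complex^2) \<Rightarrow> complex" where
  "lower_gen \<alpha> = (if snd \<alpha> > 0 then cscale (- of_nat (Suc (deg \<alpha> - snd \<alpha>))) (mon {#(fst \<alpha>, snd \<alpha> - 1)#}) else 0)"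

lemma der_raise_gen:
  assumes "\<alpha> \<in> J" shows "der upper (mon {#\<alpha>#}) (raise_gen \<alpha>)"
  unfolding der_def
proof
  fix p :: "(nat \<times> (complex^2) \<Rightarrow> complex) \<times> (complex^2)"
  obtain w v where p: "p = (w, v)" by (cases p)
  have W: "fst (SL2_act (upper s) p) \<in> W ds \<longleftrightarrow> fst p \<in> W ds" for s by (rule W_act_iff) auto
  show "((\<lambda>s. mon {#\<alpha>#} (SL2_act (upper s) p)) has_field_derivative raise_gen \<alpha> p) (at 0)"
  proof (cases "fst p \<in> W ds")
    case False
    then show ?thesis by (simp add: mon_single W raise_gen_def cscale_def)
  next
    case True
    then have w: "w \<in> W ds" by (simp add: p)
    show ?thesis using assms unfolding J_cases
    proof (elim disjE)
      assume a: "\<alpha> \<in> indices ds"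
      then obtain k j where \<alpha>: "\<alpha> = (k, j)" "k < length ds" "j \<le> ds ! k" by (auto simp: indices_def)
      have 1: "((\<lambda>s::complex. coord ds (k, i) w * (if j \<le> i then of_nat (i choose j) * (- s) ^ (i - j) else 0))
         has_field_derivative (if i = Suc j then - of_nat (Suc j) * coord ds (k, i) w else 0)) (at 0)" for i
      proof (cases "j \<le> i")
        case True
        have "i - j = 1 \<longleftrightarrow> i = Suc j" by auto
        then have "(if i - j = 1 then - (coord ds (k, i) w * of_nat (i choose j)) else 0) = (if i = Suc j then - of_nat (Suc j) * coord ds (k, i) w else 0)"
          by (auto simp: algebra_simps)
        then show ?thesis
          using has_derivative_monomial_at_0[of "coord ds (k, i) w * of_nat (i choose j)" "i - j"] True by (simp add: mult.assoc)
      qed auto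
      have "((\<lambda>s. \<Sum>i\<le>ds ! k. coord ds (k, i) w * (if j \<le> i then of_nat (i choose j) * (- s) ^ (i - j) else 0))
         has_field_derivative (\<Sum>i\<le>ds ! k. if i = Suc j then - of_nat (Suc j) * coord ds (k, i) w else 0)) (at 0)"
        by (rule DERIV_sum) (rule 1)
      moreover have "(\<Sum>i\<le>ds ! k. if i = Suc j then - of_nat (Suc j) * coord ds (k, i) w else 0) = raise_gen \<alpha> p"
        using \<alpha> True by (auto simp: raise_gen_def deg_pair cscale_def mon_single gen_def p)
      moreover have "mon {#\<alpha>#} (SL2_act (upper s) p) = (\<Sum>i\<le>ds ! k. coord ds (k, i) w * (if j \<le> i then of_nat (i choose j) * (- s) ^ (i - j) else 0))" for s
        using pullback_upper[OF w] a \<alpha> True W by (simp add: mon_single gen_def p SL2_act_def)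
      ultimately show ?thesis by simp
    next
      \<comment> \<open>The point of the plane is moved by the matrix itself, not by its inverse;
        the opposite sign this produces is absorbed by the sign of the second plane
        generator.\<close>
      assume a: "\<alpha> = (length ds, 0)"
      have "mon {#\<alpha>#} (SL2_act (upper s) p) = vec_nth v 1 + s * vec_nth v 2" for s
        using a True W by (simp add: mon_single gen_def p SL2_act_def) (simp add: upper_def)
      moreover have "((\<lambda>s. vec_nth v 1 + s * vec_nth v 2) has_field_derivative vec_nth v 2) (at 0)"
        by (rule derivative_eq_intros refl | simp)+
      ultimately show ?thesis using a True
        by (simp add: raise_gen_def deg_pair cscale_def mon_single gen_def p)
    next
      assume a: "\<alpha> = (length ds, 1)"
      have "mon {#\<alpha>#} (SL2_act (upper s) p) = - vec_nth v 2" for s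
        using a True W by (simp add: mon_single gen_def p SL2_act_def) (simp add: upper_def)
      then show ?thesis using a by (simp add: raise_gen_def deg_pair)
    qed
  qed
qed

lemma der_lower_gen:
  assumes "\<alpha> \<in> J" shows "der lower (mon {#\<alpha>#}) (lower_gen \<alpha>)"
  unfolding der_def
proof
  fix p :: "(nat \<times> (complex^2) \<Rightarrow> complex) \<times> (complex^2)"
  obtain w v where p: "p = (w, v)" by (cases p)
  have W: "fst (SL2_act (lower s) p) \<in> W ds \<longleftrightarrow> fst p \<in> W ds" for s by (rule W_act_iff) auto
  show "((\<lambda>s. mon {#\<alpha>#} (SL2_act (lower s) p)) has_field_derivative lower_gen \<alpha> p) (at 0)"
  proof (cases "fst p \<in> W ds")
    case False
    then show ?thesis by (simp add: mon_single W lower_gen_def cscale_def)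
  next
    case True
    then have w: "w \<in> W ds" by (simp add: p)
    show ?thesis using assms unfolding J_cases
    proof (elim disjE)
      assume a: "\<alpha> \<in> indices ds"
      then obtain k j where \<alpha>: "\<alpha> = (k, j)" "k < length ds" "j \<le> ds ! k" by (auto simp: indices_def)
      have 1: "((\<lambda>s::complex. coord ds (k, i) w * (if i \<le> j then of_nat ((ds ! k - i) choose (j - i)) * (- s) ^ (j - i) else 0))
         has_field_derivative (if Suc i = j then - of_nat (ds ! k - i) * coord ds (k, i) w else 0)) (at 0)" for i
      proof (cases "i \<le> j")
        case True
        have "j - i = 1 \<longleftrightarrow> Suc i = j" by auto
        then have "(if j - i = 1 then - (coord ds (k, i) w * of_nat ((ds ! k - i) choose (j - i))) else 0) = (if Suc i = j then - of_nat (ds ! k - i) * coord ds (k, i) w else 0)"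
          by auto
        then show ?thesis
          using has_derivative_monomial_at_0[of "coord ds (k, i) w * of_nat ((ds ! k - i) choose (j - i))" "j - i"] True by (simp add: mult.assoc)
      qed auto
      have "((\<lambda>s. \<Sum>i\<le>ds ! k. coord ds (k, i) w * (if i \<le> j then of_nat ((ds ! k - i) choose (j - i)) * (- s) ^ (j - i) else 0))
         has_field_derivative (\<Sum>i\<le>ds ! k. if Suc i = j then - of_nat (ds ! k - i) * coord ds (k, i) w else 0)) (at 0)"
        by (rule DERIV_sum) (rule 1)
      moreover have "(\<Sum>i\<le>ds ! k. if Suc i = j then - of_nat (ds ! k - i) * coord ds (k, i) w else 0) = lower_gen \<alpha> p"
      proof (cases j)
        case 0
        then show ?thesis using \<alpha> by (simp add: lower_gen_def)
      next
        case (Suc m)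
        then show ?thesis using \<alpha> True by (simp add: lower_gen_def deg_pair cscale_def mon_single gen_def p Suc_diff_Suc)
      qed
      moreover have "mon {#\<alpha>#} (SL2_act (lower s) p) = (\<Sum>i\<le>ds ! k. coord ds (k, i) w * (if i \<le> j then of_nat ((ds ! k - i) choose (j - i)) * (- s) ^ (j - i) else 0))" for s
        using pullback_lower[OF w] a \<alpha> True W by (simp add: mon_single gen_def p SL2_act_def)
      ultimately show ?thesis by simp
    next
      assume a: "\<alpha> = (length ds, 0)"
      have "mon {#\<alpha>#} (SL2_act (lower s) p) = vec_nth v 1" for s
        using a True W by (simp add: mon_single gen_def p SL2_act_def) (simp add: lower_def)
      then show ?thesis using a by (simp add: lower_gen_def deg_pair)
    next
      assume a: "\<alpha> = (length ds, 1)"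
      have "mon {#\<alpha>#} (SL2_act (lower s) p) = - (s * vec_nth v 1 + vec_nth v 2)" for s
        using a True W by (simp add: mon_single gen_def p SL2_act_def) (simp add: lower_def)
      moreover have "((\<lambda>s. - (s * vec_nth v 1 + vec_nth v 2)) has_field_derivative - vec_nth v 1) (at 0)"
        by (rule derivative_eq_intros refl | simp)+
      ultimately show ?thesis using a True
        by (simp add: lower_gen_def deg_pair cscale_def mon_single gen_def p)
    qed
  qed
qed

lemma single_mons: "\<alpha> \<in> J \<Longrightarrow> {#\<alpha>#} \<in> mons (mdeg1 {#\<alpha>#}) (mdeg2 {#\<alpha>#}) (wt \<alpha>)"
  by (simp add: mons_def bimons_def)

lemma raise_gen_U:
  assumes "\<alpha> \<in> J" shows "raise_gen \<alpha> \<in> U (mdeg1 {#\<alpha>#}) (mdeg2 {#\<alpha>#}) (wt \<alpha> + 2)"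
proof (cases "snd \<alpha> < deg \<alpha>")
  case True
  obtain k j where \<alpha>: "\<alpha> = (k, j)" by (cases \<alpha>)
  have "{#(k, Suc j)#} \<in> mons (mdeg1 {#\<alpha>#}) (mdeg2 {#\<alpha>#}) (wt \<alpha> + 2)"
    using assms True deg_indep[of k "Suc j" j] by (auto simp: \<alpha> mons_def bimons_def wt_def J_iff)
  then show ?thesis using True unfolding raise_gen_def U_def \<alpha>
    by (simp only: if_True) (rule cfun.span_scale, rule cfun.span_base, simp only: fst_conv snd_conv imageI)
next
  case False
  then show ?thesis by (simp only: raise_gen_def if_False U_def cfun.span_zero)
qed

lemma lower_gen_U:
  assumes "\<alpha> \<in> J" shows "lower_gen \<alpha> \<in> U (mdeg1 {#\<alpha>#}) (mdeg2 {#\<alpha>#}) (wt \<alpha> + - 2)"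
proof (cases "snd \<alpha> > 0")
  case True
  obtain k j where \<alpha>: "\<alpha> = (k, j)" by (cases \<alpha>)
  have "{#(k, j - 1)#} \<in> mons (mdeg1 {#\<alpha>#}) (mdeg2 {#\<alpha>#}) (wt \<alpha> + - 2)"
    using assms True deg_indep[of k "j - 1" j] by (auto simp: \<alpha> mons_def bimons_def wt_def J_iff)
  then show ?thesis using True unfolding lower_gen_def U_def \<alpha>
    by (simp only: if_True) (rule cfun.span_scale, rule cfun.span_base, simp only: fst_conv snd_conv imageI)
next
  case False
  then show ?thesis by (simp only: lower_gen_def if_False U_def cfun.span_zero)
qed

text \<open>By the product rule each term of the derivative changes one factor only, so the bidegree
  is preserved and the weight moves once by the common shift \<open>\<delta>\<close>.\<close>

lemma der_mon_exists:
  assumes \<tau>: "\<tau> 0 = mat2 1 0 0 1" "der \<tau> (mon {#}) 0"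
    and step: "\<And>\<alpha>. \<alpha> \<in> J \<Longrightarrow> der \<tau> (mon {#\<alpha>#}) (G \<alpha>)"
      "\<And>\<alpha>. \<alpha> \<in> J \<Longrightarrow> G \<alpha> \<in> U (mdeg1 {#\<alpha>#}) (mdeg2 {#\<alpha>#}) (wt \<alpha> + \<delta>)"
    and \<mu>: "set_mset \<mu> \<subseteq> J"
  shows "\<exists>H \<in> U (mdeg1 \<mu>) (mdeg2 \<mu>) (weight \<mu> + \<delta>). der \<tau> (mon \<mu>) H"
  using \<mu>
proof (induction \<mu>)
  case empty
  have "0 \<in> U (mdeg1 {#}) (mdeg2 {#}) (weight {#} + \<delta>)" by (simp only: U_def cfun.span_zero)
  then show ?case using \<tau>(2) by blast
next
  case (add \<alpha> \<mu>)
  then obtain H where H: "H \<in> U (mdeg1 \<mu>) (mdeg2 \<mu>) (weight \<mu> + \<delta>)" "der \<tau> (mon \<mu>) H" by auto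
  have \<alpha>: "\<alpha> \<in> J" using add by simp
  have \<mu>: "mon \<mu> \<in> U (mdeg1 \<mu>) (mdeg2 \<mu>) (weight \<mu>)" using add by (intro mon_U) (auto simp: mons_def bimons_def)
  have 1: "G \<alpha> * mon \<mu> \<in> U (mdeg1 (add_mset \<alpha> \<mu>)) (mdeg2 (add_mset \<alpha> \<mu>)) (weight (add_mset \<alpha> \<mu>) + \<delta>)"
    using U_mult[OF step(2)[OF \<alpha>] \<mu>] by (simp only: mdeg_add_mset mdeg_simps add_ac add_0_left add_0_right)
  have 2: "mon {#\<alpha>#} * H \<in> U (mdeg1 (add_mset \<alpha> \<mu>)) (mdeg2 (add_mset \<alpha> \<mu>)) (weight (add_mset \<alpha> \<mu>) + \<delta>)"
    using U_mult[OF mon_U[OF single_mons[OF \<alpha>]] H(1)] by (simp only: mdeg_add_mset mdeg_simps add_ac add_0_left add_0_right)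
  show ?case
  proof
    show "der \<tau> (mon (add_mset \<alpha> \<mu>)) (G \<alpha> * mon \<mu> + mon {#\<alpha>#} * H)"
      unfolding mon_add_mset[of \<alpha> \<mu>] by (rule der_mult[OF \<tau>(1) step(1)[OF \<alpha>] H(2)])
    show "G \<alpha> * mon \<mu> + mon {#\<alpha>#} * H \<in> U (mdeg1 (add_mset \<alpha> \<mu>)) (mdeg2 (add_mset \<alpha> \<mu>)) (weight (add_mset \<alpha> \<mu>) + \<delta>)"
      using 1 2 unfolding U_def by (rule cfun.span_add)
  qed
qed

text \<open>\<open>mon {#}\<close> is the indicator of a set that both unipotent subgroups
  preserve.\<close>

lemma der_mon_empty:
  assumes "\<And>s. \<tau> s = upper s \<or> \<tau> s = lower s" shows "der \<tau> (mon {#}) 0"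
proof -
  have "mon {#} (SL2_act (\<tau> s) p) = mon {#} p" for s p
    using W_act_iff[of "\<tau> s" s p] assms[of s] by (auto simp: mon_def)
  then show ?thesis unfolding der_def by simp
qed

lemma der_upper_mon: "set_mset \<mu> \<subseteq> J \<Longrightarrow> \<exists>H \<in> U (mdeg1 \<mu>) (mdeg2 \<mu>) (weight \<mu> + 2). der upper (mon \<mu>) H"
  by (rule der_mon_exists[OF upper_0 der_mon_empty der_raise_gen raise_gen_U]) auto

lemma der_lower_mon: "set_mset \<mu> \<subseteq> J \<Longrightarrow> \<exists>H \<in> U (mdeg1 \<mu>) (mdeg2 \<mu>) (weight \<mu> + - 2). der lower (mon \<mu>) H"
  by (rule der_mon_exists[OF lower_0 der_mon_empty der_lower_gen lower_gen_U]) auto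

text \<open>The derivative is prescribed on the independent set of monomials and extended linearly
  to all functions, since \<open>sl2_weight_module\<close> asks for operators on the ambient space.
  On \<open>Pol\<close> it is the true derivative.\<close>

definition derivation :: "(complex \<Rightarrow> complex^2^2) \<Rightarrow>
    ((nat \<times> (complex^2) \<Rightarrow> complex) \<times> (complex^2) \<Rightarrow> complex) \<Rightarrow> (nat \<times> (complex^2) \<Rightarrow> complex) \<times> (complex^2) \<Rightarrow> complex" where
  "derivation \<tau> = (SOME D. Vector_Spaces.linear cscale cscale D \<and> (\<forall>\<mu>\<in>allmons. D (mon \<mu>) = (SOME G. der \<tau> (mon \<mu>) G)))"

lemma derivation: "Vector_Spaces.linear cscale cscale (derivation \<tau>)"
    "\<mu> \<in> allmons \<Longrightarrow> derivation \<tau> (mon \<mu>) = (SOME G. der \<tau> (mon \<mu>) G)"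
proof -
  have "\<exists>D. Vector_Spaces.linear cscale cscale D \<and> (\<forall>F\<in>mon ` allmons. D F = (SOME G. der \<tau> F G))"
    by (rule cfun_pair.linear_independent_extend[OF independent_mon])
  then have "\<exists>D. Vector_Spaces.linear cscale cscale D \<and> (\<forall>\<mu>\<in>allmons. D (mon \<mu>) = (SOME G. der \<tau> (mon \<mu>) G))"
    by auto
  from someI_ex[OF this, folded derivation_def]
  show "Vector_Spaces.linear cscale cscale (derivation \<tau>)"
    "\<mu> \<in> allmons \<Longrightarrow> derivation \<tau> (mon \<mu>) = (SOME G. der \<tau> (mon \<mu>) G)" by auto
qed

lemma derivation_add: "derivation \<tau> (F + G) = derivation \<tau> F + derivation \<tau> G"
  and derivation_scale: "derivation \<tau> (cscale c F) = cscale c (derivation \<tau> F)"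
  and derivation_zero: "derivation \<tau> 0 = 0"
proof -
  interpret D: Vector_Spaces.linear cscale cscale "derivation \<tau>" by (rule derivation)
  show "derivation \<tau> (F + G) = derivation \<tau> F + derivation \<tau> G"
    "derivation \<tau> (cscale c F) = cscale c (derivation \<tau> F)" "derivation \<tau> 0 = 0"
    by (rule D.add D.scale D.zero)+
qed

lemma der_derivation:
  assumes \<tau>: "\<tau> = upper \<or> \<tau> = lower" and F: "F \<in> Pol" shows "der \<tau> F (derivation \<tau> F)"
  using F unfolding Pol_def
proof (induction rule: cfun.span_induct_alt)
  case base
  then show ?case by (simp only: derivation_zero der_zero)
next
  case (step c x y)
  then obtain \<mu> where \<mu>: "\<mu> \<in> allmons" "x = mon \<mu>" by auto
  have "\<exists>G. der \<tau> (mon \<mu>) G" using \<tau> \<mu>(1) der_upper_mon[of \<mu>] der_lower_mon[of \<mu>] by (auto simp: allmons_def)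
  then have "der \<tau> x (derivation \<tau> x)" using \<mu> by (simp add: derivation(2) someI_ex)
  then show ?case using step by (simp only: derivation_add derivation_scale der_add der_scale)
qed

lemma derivation_eq: "\<tau> = upper \<or> \<tau> = lower \<Longrightarrow> F \<in> Pol \<Longrightarrow> der \<tau> F G \<Longrightarrow> derivation \<tau> F = G"
  using der_derivation der_unique by blast

lemma derivation_mult:
  assumes \<tau>: "\<tau> = upper \<or> \<tau> = lower" and F: "F \<in> Pol" "G \<in> Pol"
  shows "derivation \<tau> (F * G) = derivation \<tau> F * G + F * derivation \<tau> G"
proof (rule derivation_eq[OF \<tau> Pol_mult[OF F]])
  have "\<tau> 0 = mat2 1 0 0 1" using \<tau> upper_0 lower_0 by auto
  then show "der \<tau> (F * G) (derivation \<tau> F * G + F * derivation \<tau> G)"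
    by (rule der_mult) (use \<tau> F der_derivation in auto)
qed

lemma derivation_U:
  assumes \<tau>: "(\<tau> = upper \<and> \<delta> = 2) \<or> (\<tau> = lower \<and> \<delta> = - 2)" and F: "F \<in> U n l c"
  shows "derivation \<tau> F \<in> U n l (c + \<delta>)"
  using F unfolding U_def[of n l c]
proof (induction rule: cfun.span_induct_alt)
  case base
  then show ?case by (simp only: derivation_zero U_def cfun.span_zero)
next
  case (step a x y)
  then obtain \<mu> where \<mu>: "\<mu> \<in> mons n l c" "x = mon \<mu>" by auto
  then have 1: "set_mset \<mu> \<subseteq> J" "mdeg1 \<mu> = n" "mdeg2 \<mu> = l" "weight \<mu> = c" by (auto simp: mons_def bimons_def)
  obtain G where G: "G \<in> U n l (c + \<delta>)" "der \<tau> (mon \<mu>) G"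
    using \<tau> der_upper_mon[OF 1(1)] der_lower_mon[OF 1(1)] unfolding 1 by blast
  have "derivation \<tau> x = G" unfolding \<mu>(2)
    using \<tau> \<mu> mons_allmons G(2) by (intro derivation_eq mon_Pol) auto
  then show ?case using step G(1) unfolding U_def
    by (simp only: derivation_add derivation_scale cfun.span_add cfun.span_scale)
qed

lemma derivation_Pol:
  assumes \<tau>: "\<tau> = upper \<or> \<tau> = lower" and F: "F \<in> Pol" shows "derivation \<tau> F \<in> Pol"
  using F unfolding Pol_def
proof (induction rule: cfun.span_induct_alt)
  case base
  then show ?case by (simp only: derivation_zero cfun.span_zero)
next
  case (step a x y)
  then obtain \<mu> where \<mu>: "\<mu> \<in> allmons" "x = mon \<mu>" by auto
  then have "\<mu> \<in> mons (mdeg1 \<mu>) (mdeg2 \<mu>) (weight \<mu>)" by (auto simp: mons_def bimons_def allmons_def)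
  then have "x \<in> U (mdeg1 \<mu>) (mdeg2 \<mu>) (weight \<mu>)" unfolding \<mu>(2) by (rule mon_U)
  then have "\<exists>\<delta>. derivation \<tau> x \<in> U (mdeg1 \<mu>) (mdeg2 \<mu>) (weight \<mu> + \<delta>)" using \<tau> derivation_U[of \<tau>] by blast
  then have "derivation \<tau> x \<in> Pol" using U_Pol by blast
  then show ?case using step unfolding Pol_def
    by (simp only: derivation_add derivation_scale cfun.span_add cfun.span_scale)
qed

lemma derivation_gen:
  assumes "\<alpha> \<in> J"
  shows "derivation upper (mon {#\<alpha>#}) = raise_gen \<alpha>" "derivation lower (mon {#\<alpha>#}) = lower_gen \<alpha>"
proof -
  have "mon {#\<alpha>#} \<in> Pol" using assms by (intro mon_Pol) (simp add: allmons_def)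
  then show "derivation upper (mon {#\<alpha>#}) = raise_gen \<alpha>" "derivation lower (mon {#\<alpha>#}) = lower_gen \<alpha>"
    using derivation_eq der_raise_gen[OF assms] der_lower_gen[OF assms] by blast+
qed

abbreviation "bracket F \<equiv> derivation upper (derivation lower F) - derivation lower (derivation upper F)"

text \<open>On the coordinate of index j in a block of degree d this is the identity (d - j + 1) j -
  (j + 1)(d - j) = 2 j - d; at j = 0 and j = d one of the products is zero.\<close>

lemma bracket_gen:
  assumes "\<alpha> \<in> J" shows "bracket (mon {#\<alpha>#}) = cscale (of_int (wt \<alpha>)) (mon {#\<alpha>#})"
proof -
  obtain k j where \<alpha>: "\<alpha> = (k, j)" by (cases \<alpha>)
  define d where "d = deg (k, j)"
  have kj: "k \<le> length ds" "j \<le> d" using assms by (auto simp: \<alpha> J_iff d_def)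
  have J: "(k, i) \<in> J \<longleftrightarrow> i \<le> d" for i using kj deg_indep[of k i j] by (simp add: J_iff d_def)
  have d: "deg (k, i) = d" for i using deg_indep[of k i j] by (simp add: d_def)
  have 1: "derivation upper (derivation lower (mon {#\<alpha>#})) = cscale (of_nat (Suc d - j) * of_nat j) (mon {#\<alpha>#})"
  proof (cases j)
    case 0
    then have "lower_gen \<alpha> = 0" by (simp only: lower_gen_def \<alpha> snd_conv less_irrefl if_False)
    then show ?thesis
      using 0 by (simp only: derivation_gen[OF assms] derivation_zero of_nat_0 mult_zero_right cfun.scale_zero_left)
  next
    case (Suc i)
    have "derivation upper (derivation lower (mon {#\<alpha>#})) = cscale (- of_nat (Suc (d - j))) (raise_gen (k, i))"
      using assms Suc kj J[of i] by (simp add: derivation_gen lower_gen_def \<alpha> d derivation_scale)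
    also have "raise_gen (k, i) = cscale (- of_nat j) (mon {#\<alpha>#})"
      using Suc kj by (simp add: raise_gen_def d \<alpha>)
    finally show ?thesis using kj by (simp add: cscale_def fun_eq_iff Suc_diff_le algebra_simps)
  qed
  have 2: "derivation lower (derivation upper (mon {#\<alpha>#})) = cscale (of_nat (Suc j) * of_nat (d - j)) (mon {#\<alpha>#})"
  proof (cases "j < d")
    case False
    then have "raise_gen \<alpha> = 0" "d - j = 0" by (simp_all only: raise_gen_def \<alpha> d snd_conv if_False)
    then show ?thesis
      by (simp only: derivation_gen[OF assms] derivation_zero of_nat_0 mult_zero_right cfun.scale_zero_left)
  next
    case True
    have "derivation lower (derivation upper (mon {#\<alpha>#})) = cscale (- of_nat (Suc j)) (lower_gen (k, Suc j))"
      using assms True kj J[of "Suc j"] by (simp add: derivation_gen raise_gen_def \<alpha> d derivation_scale)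
    also have "lower_gen (k, Suc j) = cscale (- of_nat (d - j)) (mon {#\<alpha>#})"
      using True kj by (simp add: lower_gen_def d \<alpha> Suc_diff_Suc)
    finally show ?thesis by (simp add: cscale_def fun_eq_iff algebra_simps)
  qed
  have "(of_nat (Suc d - j) * of_nat j - of_nat (Suc j) * of_nat (d - j) :: complex) = of_int (wt \<alpha>)"
    using kj by (simp add: wt_def \<alpha> d of_nat_diff algebra_simps)
  then show ?thesis unfolding 1 2 by (simp add: cscale_def fun_eq_iff algebra_simps)
qed

text \<open>The commutator of two derivations is again a derivation, so its eigenvalues add up over
  the factors of a product.\<close>

lemma bracket_mon: "\<mu> \<in> allmons \<Longrightarrow> bracket (mon \<mu>) = cscale (of_int (weight \<mu>)) (mon \<mu>)"
proof (induction \<mu>)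
  case empty
  have "derivation upper (mon {#}) = 0" "derivation lower (mon {#}) = 0"
    by (rule derivation_eq mon_Pol der_mon_empty | simp add: allmons_def)+
  then show ?case by (simp only: derivation_zero mdeg_simps of_int_0 cfun.scale_zero_left diff_self)
next
  case (add \<alpha> \<mu>)
  have P: "mon {#\<alpha>#} \<in> Pol" "mon \<mu> \<in> Pol" using add by (auto intro!: mon_Pol simp: allmons_def)
  note P' = derivation_Pol[OF _ P(1), of upper] derivation_Pol[OF _ P(1), of lower]
    derivation_Pol[OF _ P(2), of upper] derivation_Pol[OF _ P(2), of lower]
  have "bracket (mon (add_mset \<alpha> \<mu>)) = bracket (mon {#\<alpha>#}) * mon \<mu> + mon {#\<alpha>#} * bracket (mon \<mu>)"
    unfolding mon_add_mset[of \<alpha> \<mu>]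
    by (simp add: derivation_mult derivation_add P P' Pol_mult algebra_simps)
  also have "\<dots> = cscale (of_int (weight (add_mset \<alpha> \<mu>))) (mon (add_mset \<alpha> \<mu>))"
    using add bracket_gen[of \<alpha>] by (simp add: allmons_def mon_add_mset[of \<alpha> \<mu>] mdeg_add_mset cscale_def fun_eq_iff algebra_simps)
  finally show ?case .
qed

lemma bracket_U:
  assumes F: "F \<in> U n l c"
  shows "bracket F = cscale (of_int c) F"
  using F unfolding U_def
proof (induction rule: cfun.span_induct_alt)
  case base
  then show ?case by (simp only: derivation_zero cfun.scale_zero_right diff_self)
next
  case (step a x y)
  then obtain \<mu> where \<mu>: "\<mu> \<in> mons n l c" "x = mon \<mu>" by auto
  then have "bracket x = cscale (of_int c) x" using bracket_mon[of \<mu>] by (auto simp: mons_def bimons_def allmons_def)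
  then have "cscale a (bracket x) + bracket y = cscale (of_int c) (cscale a x + y)"
    using step by (simp add: cscale_def fun_eq_iff algebra_simps)
  moreover have "bracket (cscale a x + y) = cscale a (bracket x) + bracket y"
    unfolding derivation_add derivation_scale by (simp add: cscale_def fun_eq_iff algebra_simps)
  ultimately show ?case by (simp only:)
qed

lemma weight_bound:
  assumes "\<mu> \<in> allmons" shows "\<bar>weight \<mu>\<bar> \<le> int (size \<mu>) * int (sum_list ds + 1)"
  using assms
proof (induction \<mu>)
  case (add \<alpha> \<mu>)
  obtain k j where \<alpha>: "\<alpha> = (k, j)" by (cases \<alpha>)
  have "k \<le> length ds" "j \<le> deg (k, j)" using add by (auto simp: allmons_def \<alpha> J_iff)
  then have "deg (k, j) \<in> set (ds @ [1])" unfolding deg_def by (intro nth_mem) simp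
  then have "deg (k, j) \<le> sum_list (ds @ [1])" by (intro member_le_sum_list) auto
  then have "\<bar>wt \<alpha>\<bar> \<le> int (sum_list ds + 1)" using \<open>j \<le> deg (k, j)\<close> by (simp add: wt_def \<alpha>)
  then show ?case using add by (simp add: mdeg_add_mset allmons_def algebra_simps)
qed simp

lemma sl2_module: "sl2_weight_module (derivation upper) (derivation lower) (U n l) (int (n + l) * int (sum_list ds + 1))"
proof (intro sl2_weight_module.intro)
  fix c x
  show "cfun.subspace (U n l c)" unfolding U_def by simp
  show "derivation upper x \<in> U n l (c + 2)" if "x \<in> U n l c"
    using that by (intro derivation_U) auto
  show "derivation lower x \<in> U n l (c - 2)" if "x \<in> U n l c"
    using that derivation_U[of lower "- 2" x n l c] by simp
  show "bracket x = cscale (of_int c) x" if "x \<in> U n l c" using that by (rule bracket_U)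
  show "U n l c = {0}" if c: "int (n + l) * int (sum_list ds + 1) < \<bar>c\<bar>"
  proof -
    have "mons n l c = {}"
    proof (rule equals0I)
      fix \<mu> assume "\<mu> \<in> mons n l c"
      then have \<mu>: "\<mu> \<in> allmons" "weight \<mu> = c" "size \<mu> = n + l"
        using mdeg_size[of \<mu>] by (auto simp: mons_def bimons_def allmons_def)
      show False using weight_bound[OF \<mu>(1)] c unfolding \<mu>(2,3) by simp
    qed
    then show ?thesis by (simp add: U_def)
  qed
qed (rule derivation)+

end

lemma cfun_span_linear_image:
  assumes lin: "\<And>c x y. E (cscale c x + y) = cscale c (E x) + E y" "E 0 = 0"
    and S: "\<And>x. x \<in> S \<Longrightarrow> E x \<in> T" and T: "cfun.subspace T" and x: "x \<in> cfun.span S"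
  shows "E x \<in> T"
  using x
proof (induction rule: cfun.span_induct_alt)
  case base
  then show ?case using T by (simp only: lin cfun.subspace_0)
next
  case (step c x y)
  then show ?case using T S by (simp only: lin cfun.subspace_add cfun.subspace_scale)
qed

lemma filter_replicate_mset: "filter_mset P (replicate_mset n x) = (if P x then replicate_mset n x else {#})"
  by (induction n) auto

context binary_forms begin

section \<open>Covariants as polynomials of weight zero killed by the raising derivation\<close>

lemma zero_bimons: "{#} \<in> bimons 0 0" by (simp add: bimons_def)

lemma bimons_add: "\<mu> \<in> bimons n l \<Longrightarrow> \<nu> \<in> bimons n' l' \<Longrightarrow> \<mu> + \<nu> \<in> bimons (n + n') (l + l')"
  by (auto simp: bimons_def)

text \<open>On \<open>W ds\<close> every functional is a combination of the coordinates, so the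
  product can be expanded one factor at a time.\<close>

lemma linear_product_span:
  assumes l: "\<And>i. i < n \<Longrightarrow> Vector_Spaces.linear cscale (*) (l i)"
  shows "(\<lambda>(w, v). if w \<in> W ds then (\<Prod>i<n. l i w) else 0) \<in> cfun.span (mon ` bimons n 0)"
  using l
proof (induction n)
  case 0
  have "(\<lambda>(w, v). if w \<in> W ds then (\<Prod>i<0. l i w) else 0) = mon {#}"
    by (auto simp: mon_def fun_eq_iff)
  then show ?case using zero_bimons by (simp only: cfun.span_base imageI)
next
  case (Suc n)
  define R where "R = (\<Sum>\<alpha>\<in>indices ds. cscale (l n (form_basis ds \<alpha>)) (mon {#\<alpha>#}))"
  have "{#\<alpha>#} \<in> bimons 1 0" if "\<alpha> \<in> indices ds" for \<alpha>
    using that by (auto simp: bimons_def J_cases) (auto simp: indices_def)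
  then have R: "R \<in> cfun.span (mon ` bimons 1 0)"
    unfolding R_def by (intro cfun.span_sum cfun.span_scale cfun.span_base imageI)
  have eq: "(\<lambda>(w, v). if w \<in> W ds then (\<Prod>i<Suc n. l i w) else 0) =
    (\<lambda>(w, v). if w \<in> W ds then (\<Prod>i<n. l i w) else 0) * R"
  proof (rule ext, clarify)
    fix w v
    show "(if w \<in> W ds then (\<Prod>i<Suc n. l i w) else 0) =
      ((\<lambda>(w, v). if w \<in> W ds then (\<Prod>i<n. l i w) else 0) * R) (w, v)"
    proof (cases "w \<in> W ds")
      case True
      have "l n w = R (w, v)"
        using functional_on_W[OF Suc.prems[of n, simplified] True] True
        by (auto simp: R_def fun_sum_apply cscale_def mon_single gen_def indices_def intro!: sum.cong)
      then show ?thesis using True by simp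
    qed simp
  qed
  have "(\<lambda>(w, v). if w \<in> W ds then (\<Prod>i<n. l i w) else 0) \<in> cfun.span (mon ` bimons n 0)"
    using Suc by auto
  then have "(\<lambda>(w, v). if w \<in> W ds then (\<Prod>i<n. l i w) else 0) * R \<in> cfun.span (mon ` bimons (Suc n) 0)"
    by (rule span_mult[OF _ R]) (use bimons_add[of _ n 0 _ 1 0] in simp)
  then show ?case by (simp only: eq)
qed

lemma homogeneous_polys_span:
  assumes "f \<in> homogeneous_polys (W ds) n"
  shows "(\<lambda>(w, v). f w) \<in> cfun.span (mon ` bimons n 0)"
  using assms unfolding homogeneous_polys_def
proof (rule cfun_span_linear_image[where E = "\<lambda>f (w, v). f w", rotated 4])
  fix x assume "x \<in> {\<lambda>u. if u \<in> W ds then \<Prod>i<n. l i u else 0 |l. \<forall>i<n. Vector_Spaces.linear cscale (*) (l i)}"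
  then obtain l where l: "\<forall>i<n. Vector_Spaces.linear cscale (*) (l i)" "x = (\<lambda>u. if u \<in> W ds then \<Prod>i<n. l i u else 0)" by auto
  show "(\<lambda>(w, v :: complex^2). x w) \<in> cfun.span (mon ` bimons n 0)"
    using linear_product_span[of n l] l by (simp add: l(2))
qed (auto simp: cscale_def fun_eq_iff)

lemma V_span:
  assumes "h \<in> V L"
  shows "(\<lambda>(w, v). if w \<in> W ds then h v else 0) \<in> cfun.span (mon ` bimons 0 L)"
proof -
  obtain c where c: "\<And>v. h v = (\<Sum>i\<le>L. c i * vec_nth v 1 ^ i * vec_nth v 2 ^ (L - i))" using assms by (auto simp: V_def)
  \<comment> \<open>The plane monomial with exponents \<open>i\<close> and \<open>L - i\<close>; the
    second generator is minus a coordinate, which accounts for the factor (-1)^(L - i).\<close>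
  define \<mu> where "\<mu> i = replicate_mset i (length ds, 0) + replicate_mset (L - i) (length ds, 1::nat)" for i
  have \<mu>: "\<mu> i \<in> bimons 0 L" if "i \<le> L" for i
    using that by (auto simp: bimons_def \<mu>_def J_cases mdeg1_def mdeg2_def filter_replicate_mset split: if_splits)
  have mon: "mon (\<mu> i) (w, v) = (if w \<in> W ds then (-1) ^ (L - i) * (vec_nth v 1 ^ i * vec_nth v 2 ^ (L - i)) else 0)" for i w v
    by (simp add: mon_def \<mu>_def gen_def power_minus[of "vec_nth v 2"])
  have s: "c i * a * b = c i * (-1) ^ k * ((-1) ^ k * (a * b))" for i k and a b :: complex
    by (simp add: mult.assoc[symmetric] power_mult_distrib[symmetric])
  have "(\<lambda>(w, v). if w \<in> W ds then h v else 0) = (\<Sum>i\<le>L. cscale (c i * (-1) ^ (L - i)) (mon (\<mu> i)))"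
  proof (rule ext, clarify)
    fix w v
    show "(if w \<in> W ds then h v else 0) = (\<Sum>i\<le>L. cscale (c i * (-1) ^ (L - i)) (mon (\<mu> i))) (w, v)"
      unfolding c by (auto simp: fun_sum_apply cscale_def mon intro!: sum.cong s)
  qed
  also have "\<dots> \<in> cfun.span (mon ` bimons 0 L)"
    by (intro cfun.span_sum cfun.span_scale cfun.span_base imageI \<mu>) simp
  finally show ?thesis .
qed

text \<open>The two parts of a monomial, over the blocks of \<open>ds\<close> and over the auxiliary
  block, are the two tensor factors. The first is listed as \<open>xs\<close> because
  \<open>homogeneous_polys\<close> uses products indexed by numbers below \<open>n\<close>.\<close>

lemma mon_tensor:
  assumes \<mu>: "\<mu> \<in> bimons n L"
  shows "\<exists>f h. f \<in> homogeneous_polys (W ds) n \<and> h \<in> V L \<and> mon \<mu> = (\<lambda>(x, y). f x * h y)"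
proof -
  define \<mu>1 where "\<mu>1 = filter_mset (\<lambda>\<alpha>. fst \<alpha> < length ds) \<mu>"
  define \<mu>2 where "\<mu>2 = filter_mset (\<lambda>\<alpha>. \<not> fst \<alpha> < length ds) \<mu>"
  have \<mu>12: "\<mu> = \<mu>1 + \<mu>2" by (simp add: \<mu>1_def \<mu>2_def)
  have sz: "size \<mu>1 = n" "size \<mu>2 = L" using \<mu> by (auto simp: bimons_def mdeg1_def mdeg2_def \<mu>1_def \<mu>2_def)
  obtain xs where xs: "mset xs = \<mu>1" using ex_mset by blast
  define f where "f = (\<lambda>u. if u \<in> W ds then \<Prod>i<n. coord ds (xs ! i) u else 0)"
  have f: "f \<in> homogeneous_polys (W ds) n"
    unfolding homogeneous_polys_def f_def by (intro cfun.span_base CollectI exI conjI refl) (auto intro: coord)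
  have len: "length xs = n" using sz xs by auto
  have fprod: "(\<Prod>\<alpha>\<in>#\<mu>1. gen \<alpha> (w, v)) = (\<Prod>i<n. coord ds (xs ! i) w)" for w v
  proof -
    have "(\<Prod>\<alpha>\<in>#\<mu>1. gen \<alpha> (w, v)) = (\<Prod>\<alpha>\<in>#\<mu>1. coord ds \<alpha> w)"
      by (rule arg_cong[where f = prod_mset], rule image_mset_cong) (auto simp: \<mu>1_def gen_def)
    also have "\<dots> = prod_list (map (\<lambda>\<alpha>. coord ds \<alpha> w) xs)"
      by (simp add: xs[symmetric] prod_mset_prod_list[symmetric])
    also have "\<dots> = (\<Prod>i<n. coord ds (xs ! i) w)"
      by (simp add: prod.list_conv_set_nth len atLeast0LessThan)
    finally show ?thesis .
  qed
  have "\<exists>a b. a + b = size \<nu> \<and> (\<forall>w v. (\<Prod>\<alpha>\<in>#\<nu>. gen \<alpha> (w, v)) = (-1) ^ b * vec_nth v 1 ^ a * vec_nth v 2 ^ b)"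
    if "\<forall>\<alpha>\<in>#\<nu>. \<not> fst \<alpha> < length ds" for \<nu>
    using that
  proof (induction \<nu>)
    case empty
    show ?case by (intro exI[of _ 0]) simp
  next
    case (add \<alpha> \<nu>)
    then obtain a b where ab: "a + b = size \<nu>" "\<And>w v. (\<Prod>\<alpha>\<in>#\<nu>. gen \<alpha> (w, v)) = (-1) ^ b * vec_nth v 1 ^ a * vec_nth v 2 ^ b"
      by auto
    show ?case
    proof (cases "snd \<alpha> = 0")
      case True
      show ?thesis by (rule exI[of _ "Suc a"], rule exI[of _ b]) (use True add.prems ab in \<open>simp add: gen_def\<close>)
    next
      case False
      show ?thesis by (rule exI[of _ a], rule exI[of _ "Suc b"]) (use False add.prems ab in \<open>simp add: gen_def\<close>)
    qed
  qed
  from this[of \<mu>2] obtain a b where ab: "a + b = L" "\<And>w v. (\<Prod>\<alpha>\<in>#\<mu>2. gen \<alpha> (w, v)) = (-1) ^ b * vec_nth v 1 ^ a * vec_nth v 2 ^ b"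
    by (auto simp: \<mu>2_def sz(2)[unfolded \<mu>2_def])
  define h where "h = (\<lambda>v :: complex^2. (-1) ^ b * vec_nth v 1 ^ a * vec_nth v 2 ^ b)"
  have "h v = (\<Sum>i\<le>L. (if i = a then (-1) ^ b else 0) * vec_nth v 1 ^ i * vec_nth v 2 ^ (L - i))" for v
  proof -
    have "(\<Sum>i\<le>L. (if i = a then (-1) ^ b else 0) * vec_nth v 1 ^ i * vec_nth v 2 ^ (L - i)) =
      (\<Sum>i\<le>L. if i = a then (-1) ^ b * vec_nth v 1 ^ a * vec_nth v 2 ^ (L - a) else 0)"
      by (rule sum.cong) auto
    also have "\<dots> = h v" using ab(1) by (simp add: h_def) auto
    finally show ?thesis by simp
  qed
  then have h: "h \<in> V L" unfolding V_def by (intro CollectI exI allI)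
  have "mon \<mu> = (\<lambda>(x, y). f x * h y)"
    unfolding \<mu>12 by (auto simp: mon_def f_def h_def fun_eq_iff fprod ab(2))
  then show ?thesis using f h by blast
qed

text \<open>At this point \<open>V L\<close> turns into the degree \<open>L\<close> part of a
  polynomial ring, and the tensor product into a single bihomogeneous component.\<close>

lemma tensor_eq: "tensor (homogeneous_polys (W ds) n) (V L) = cfun.span (mon ` bimons n L)"
proof
  show "tensor (homogeneous_polys (W ds) n) (V L) \<subseteq> cfun.span (mon ` bimons n L)"
    unfolding tensor_def
  proof (rule cfun.span_minimal)
    show "{\<lambda>(x, y). f x * h y |f h. f \<in> homogeneous_polys (W ds) n \<and> h \<in> V L} \<subseteq> cfun.span (mon ` bimons n L)"
    proof clarify
      fix f h assume f: "f \<in> homogeneous_polys (W ds) n" and h: "h \<in> V L"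
      \<comment> \<open>The first factor already vanishes outside \<open>W ds\<close>, so attaching
        the cut-off to \<open>h\<close> does not change the product.\<close>
      have zero: "f w = 0" if "w \<notin> W ds" for w
      proof -
        have "f \<in> {f. f w = 0}" using f unfolding homogeneous_polys_def
          by (rule cfun.span_minimal[THEN subsetD, rotated 2]) (use that in \<open>auto simp: cfun.subspace_def cscale_def\<close>)
        then show ?thesis by simp
      qed
      have "(\<lambda>(x, y). f x * h y) = (\<lambda>(w, v). f w) * (\<lambda>(w, v). if w \<in> W ds then h v else 0)"
        using zero by (auto simp: fun_eq_iff)
      also have "\<dots> \<in> cfun.span (mon ` bimons n L)"
        by (rule span_mult[OF homogeneous_polys_span[OF f] V_span[OF h]])
          (use bimons_add[of _ n 0 _ 0 L] in simp)
      finally show "(\<lambda>(x, y). f x * h y) \<in> cfun.span (mon ` bimons n L)" .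
    qed
  qed simp
  show "cfun.span (mon ` bimons n L) \<subseteq> tensor (homogeneous_polys (W ds) n) (V L)"
    unfolding tensor_def
  proof (rule cfun.span_mono, clarify)
    fix \<mu> assume "\<mu> \<in> bimons n L"
    from mon_tensor[OF this] show "\<exists>f h. mon \<mu> = (\<lambda>(x, y). f x * h y) \<and> f \<in> homogeneous_polys (W ds) n \<and> h \<in> V L"
      by blast
  qed
qed

lemma covariants_iff: "F \<in> covariants ds L n \<longleftrightarrow>
    F \<in> cfun.span (mon ` bimons n L) \<and> (\<forall>g\<in>SL2. \<forall>p. F (SL2_act g p) = F p)"
proof -
  have "(\<forall>g\<in>SL2. pullback SL2_act g F = F) \<longleftrightarrow> (\<forall>g\<in>SL2. \<forall>p. F (SL2_act g p) = F p)"
  proof (intro iffI ballI allI)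
    fix g p assume inv: "\<forall>g\<in>SL2. pullback SL2_act g F = F" and g: "g \<in> SL2"
    have "pullback SL2_act (matrix_inv g) F p = F p" using inv SL2_inv[OF g] by simp
    then show "F (SL2_act g p) = F p" by (simp add: pullback_def SL2_inv_inv[OF g])
  qed (use SL2_inv in \<open>auto simp: pullback_def\<close>)
  moreover have "covariants ds L n = invariants SL2_act (tensor (homogeneous_polys (W ds) n) (V L))"
    unfolding covariants_def SL2_act_def ..
  ultimately show ?thesis by (simp add: invariants_def tensor_eq)
qed

lemma gen_torus:
  assumes "\<alpha> \<in> J" "z \<noteq> 0" "fst p \<in> W ds"
  shows "gen \<alpha> (SL2_act (torus z) p) = z powi (- wt \<alpha>) * gen \<alpha> p"
proof -
  obtain w v where p: "p = (w, v)" by (cases p)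
  then have w: "w \<in> W ds" using assms by simp
  show ?thesis using assms(1) unfolding J_cases
  proof (elim disjE)
    assume a: "\<alpha> \<in> indices ds"
    then obtain k j where \<alpha>: "\<alpha> = (k, j)" "k < length ds" "j \<le> ds ! k" by (auto simp: indices_def)
    show ?thesis using a w assms(2) by (simp add: \<alpha> p SL2_act_def gen_def pullback_torus wt_def deg_pair)
  qed (use assms(2) in \<open>simp_all add: p SL2_act_def gen_def wt_def deg_pair torus_def power_int_minus\<close>)
qed

lemma mon_torus:
  assumes "\<mu> \<in> allmons" "z \<noteq> 0"
  shows "mon \<mu> (SL2_act (torus z) p) = z powi (- weight \<mu>) * mon \<mu> p"
proof (cases "fst p \<in> W ds")
  case True
  have "(\<Prod>\<alpha>\<in>#\<mu>. gen \<alpha> (SL2_act (torus z) p)) = z powi (- weight \<mu>) * (\<Prod>\<alpha>\<in>#\<mu>. gen \<alpha> p)"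
    using assms(1)
  proof (induction \<mu>)
    case (add \<alpha> \<mu>)
    then have "\<alpha> \<in> J" "\<mu> \<in> allmons" by (auto simp: allmons_def)
    moreover have "z powi (- weight (add_mset \<alpha> \<mu>)) = z powi (- wt \<alpha>) * z powi (- weight \<mu>)"
      using assms(2) by (simp add: mdeg_add_mset power_int_add[symmetric])
    ultimately show ?case using add.IH assms(2) True by (simp add: gen_torus mult_ac)
  qed simp
  then show ?thesis using True W_act_iff[of "torus z" z p] assms(2) by (simp add: mon_def)
next
  case False
  then show ?thesis using W_act_iff[of "torus z" z p] assms(2) by (simp add: mon_def)
qed

text \<open>A single torus element suffices: \<open>torus 2\<close> multiplies a monomial of weight
  c by 2^(-c), which differs from 1 for nonzero c, and independence of the monomials then removes
  all nonzero weights.\<close>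

lemma torus_invariant_U:
  assumes F: "F \<in> cfun.span (mon ` bimons n L)" and inv: "\<And>p. F (SL2_act (torus 2) p) = F p"
  shows "F \<in> U n L 0"
proof -
  obtain c where c: "F = (\<Sum>\<mu>\<in>bimons n L. cscale (c \<mu>) (mon \<mu>))"
    using cfun_span_image_finite[OF finite_bimons inj_on_subset[OF inj_mon bimons_allmons] F] by blast
  have "(\<Sum>\<mu>\<in>bimons n L. cscale (c \<mu> * (2 powi (- weight \<mu>) - 1)) (mon \<mu>)) p = 0" for p
  proof -
    have "F (SL2_act (torus 2) p) = (\<Sum>\<mu>\<in>bimons n L. c \<mu> * (2 powi (- weight \<mu>) * mon \<mu> p))"
      unfolding c fun_sum_apply cscale_def
      by (intro sum.cong refl) (use bimons_allmons in \<open>simp add: mon_torus subset_iff\<close>)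
    moreover have "F p = (\<Sum>\<mu>\<in>bimons n L. c \<mu> * mon \<mu> p)"
      unfolding c fun_sum_apply cscale_def ..
    ultimately have "(\<Sum>\<mu>\<in>bimons n L. c \<mu> * (2 powi (- weight \<mu>) * mon \<mu> p)) - (\<Sum>\<mu>\<in>bimons n L. c \<mu> * mon \<mu> p) = 0"
      using inv[of p] by simp
    then show ?thesis
      by (simp add: fun_sum_apply cscale_def sum_subtractf[symmetric] algebra_simps)
  qed
  then have zero: "(\<Sum>\<mu>\<in>bimons n L. cscale (c \<mu> * (2 powi (- weight \<mu>) - 1)) (mon \<mu>)) = 0"
    by (simp add: fun_eq_iff)
  have c0: "c \<mu> = 0" if "\<mu> \<in> bimons n L" "weight \<mu> \<noteq> 0" for \<mu>
  proof -
    have "c \<mu> * (2 powi (- weight \<mu>) - 1) = 0"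
      by (rule mon_coeffs[OF bimons_allmons finite_bimons zero that(1)])
    moreover have "(2 :: complex) powi (- weight \<mu>) \<noteq> 1"
    proof
      assume "(2 :: complex) powi (- weight \<mu>) = 1"
      then have "norm ((2 :: complex) powi (- weight \<mu>)) = 1" by simp
      then have "(2 :: real) powi (- weight \<mu>) = 2 powi 0" by (simp add: norm_power_int)
      then show False using that(2) power_int_strict_increasing[of "- weight \<mu>" 0 "2::real"]
        power_int_strict_increasing[of 0 "- weight \<mu>" "2::real"] by (cases "weight \<mu> > 0") auto
    qed
    ultimately show ?thesis by simp
  qed
  have "F = (\<Sum>\<mu>\<in>mons n L 0. cscale (c \<mu>) (mon \<mu>))"
    unfolding c
  proof (rule sum.mono_neutral_right)
    show "\<forall>\<mu>\<in>bimons n L - mons n L 0. cscale (c \<mu>) (mon \<mu>) = 0"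
    proof
      fix \<mu> assume "\<mu> \<in> bimons n L - mons n L 0"
      then have "c \<mu> = 0" using c0 by (auto simp: mons_def)
      then show "cscale (c \<mu>) (mon \<mu>) = 0" by (simp only: cfun.scale_zero_left)
    qed
  qed (auto simp: finite_bimons mons_def)
  then show ?thesis unfolding U_def by (simp only:) (intro cfun.span_sum cfun.span_scale cfun.span_base imageI)
qed

text \<open>By the law of one-parameter groups the derivative of the orbit function at
  \<open>s\<close> is its derivative at zero based at the moved point. It vanishes everywhere, so
  the function is constant.\<close>

lemma derivation_zero_invariant:
  assumes \<tau>: "\<tau> = upper \<or> \<tau> = lower" and F: "F \<in> Pol" and zero: "derivation \<tau> F = 0"
  shows "F (SL2_act (\<tau> s) p) = F p"
proof -
  have d: "((\<lambda>s. F (SL2_act (\<tau> s) p)) has_field_derivative 0) (at s)" for s p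
  proof -
    have "((\<lambda>t. F (SL2_act (\<tau> t) (SL2_act (\<tau> s) p))) has_field_derivative 0) (at 0)" for s p
      using der_derivation[OF \<tau> F] unfolding zero der_def zero_fun_def by blast
    moreover have "SL2_act (\<tau> t) (SL2_act (\<tau> s) p) = SL2_act (\<tau> (s + t)) p" for t s p
      using \<tau> by (auto simp: add.commute[of s] upper_add lower_add SL2_act_mult)
    ultimately have "((\<lambda>t. F (SL2_act (\<tau> (s + t)) p)) has_field_derivative 0) (at 0)" by simp
    then have "((\<lambda>t. F (SL2_act (\<tau> (t + s)) p)) has_field_derivative 0) (at (0 :: complex))" by (simp add: add.commute)
    then show ?thesis using DERIV_shift[of "\<lambda>s. F (SL2_act (\<tau> s) p)" 0 0 s] by simp
  qed
  have "\<exists>c. \<forall>s\<in>UNIV. F (SL2_act (\<tau> s) p) = c"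
    by (rule has_field_derivative_zero_constant) (use d in auto)
  then have "F (SL2_act (\<tau> s) p) = F (SL2_act (\<tau> 0) p)" by auto
  then show ?thesis using \<tau> upper_0 lower_0 by (auto simp: SL2_act_one)
qed

text \<open>An invariant has weight zero by the torus and derivative zero along
  \<open>upper\<close>. Conversely, a polynomial of weight zero killed by raising is killed by
  lowering as well, hence fixed by both unipotent subgroups, whose products exhaust the
  group.\<close>

lemma covariants_eq: "covariants ds L n = U n L 0 \<inter> {F. derivation upper F = 0}"
proof (intro equalityI subsetI)
  fix F assume "F \<in> covariants ds L n"
  then have F: "F \<in> cfun.span (mon ` bimons n L)" and inv: "\<And>g p. g \<in> SL2 \<Longrightarrow> F (SL2_act g p) = F p"
    by (auto simp: covariants_iff)
  have U: "F \<in> U n L 0" by (rule torus_invariant_U[OF F]) (rule inv, simp)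
  have "der upper F 0" unfolding der_def by (simp add: inv)
  then have "derivation upper F = 0" using U U_Pol by (intro derivation_eq) auto
  then show "F \<in> U n L 0 \<inter> {F. derivation upper F = 0}" using U by blast
next
  fix F assume "F \<in> U n L 0 \<inter> {F. derivation upper F = 0}"
  then have U: "F \<in> U n L 0" and e: "derivation upper F = 0" by auto
  have f: "derivation lower F = 0" by (rule sl2_weight_module.f_eq_0[OF sl2_module U e])
  have P: "F \<in> Pol" using U U_Pol by blast
  have up: "F (SL2_act (upper s) p) = F p" and lo: "F (SL2_act (lower s) p) = F p" for s p
    using derivation_zero_invariant[of upper F s p] derivation_zero_invariant[of lower F s p] P e f by auto
  have "F (SL2_act g p) = F p" if g: "g \<in> SL2" for g p
  proof -
    obtain x y z w where "g = upper x ** lower y ** upper z ** lower w" using SL2_unipotent[OF g] .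
    then show ?thesis by (simp add: SL2_act_mult SL2_mult up lo)
  qed
  moreover have "F \<in> cfun.span (mon ` bimons n L)"
    using U cfun.span_mono[OF image_mono[OF mons_bimons]] unfolding U_def by blast
  ultimately show "F \<in> covariants ds L n" by (simp add: covariants_iff)
qed

lemma dim_covariants_mons: "cfun.dim (covariants ds L n) + card (mons n L 2) = card (mons n L 0)"
proof -
  have "U n L c \<subseteq> cfun.span (mon ` mons n L c)" "finite (mon ` mons n L c)" for c
    by (simp_all add: U_def finite_mons)
  from sl2_weight_module.dim_highest_weight[OF sl2_module this(2,1) this(2,1)]
  show ?thesis by (simp add: covariants_eq dim_U)
qed

text \<open>The auxiliary part of a monomial is given by the number \<open>j\<close> of its factors
  of weight -1; the other \<open>L - j\<close> have weight 1. It contributes L - 2 j to the total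
  weight.\<close>

lemma card_mons: "card (mons n L c) = (\<Sum>j\<le>L. wcount wt (indices ds) n (c - int L + 2 * int j))"
proof -
  define A where "A j = {\<mu>. set_mset \<mu> \<subseteq> indices ds \<and> size \<mu> = n \<and> (\<Sum>\<alpha>\<in>#\<mu>. wt \<alpha>) = c - int L + 2 * int j}" for j
  let ?r = "length ds"
  have fin: "finite (A j)" for j
    by (rule finite_subset[OF _ finite_multisets_of_size[OF finite_indices[of ds], of n]])
      (auto simp: A_def multisets_of_size_def)
  have wt: "wt (?r, 0) = - 1" "wt (?r, Suc 0) = 1" by (simp_all add: wt_def deg_pair)
  have ind: "filter_mset (\<lambda>\<alpha>. fst \<alpha> < ?r) \<mu> = \<mu>" "filter_mset (\<lambda>\<alpha>. \<not> fst \<alpha> < ?r) \<mu> = {#}" "count \<mu> (?r, i) = 0"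
    if "set_mset \<mu> \<subseteq> indices ds" for \<mu> i
    using that by (auto simp: filter_mset_eq_conv filter_mset_eq_mempty_iff indices_def count_eq_zero_iff)
  have "card (mons n L c) = card (Sigma {..L} A)"
  proof (rule bij_betw_same_card[symmetric], rule bij_betw_byWitness)
    let ?f = "\<lambda>(j, \<mu>). \<mu> + (replicate_mset j (?r, 0) + replicate_mset (L - j) (?r, Suc 0))"
    let ?g = "\<lambda>\<mu>. (count \<mu> (?r, 0), filter_mset (\<lambda>\<alpha>. fst \<alpha> < ?r) \<mu>)"
    show "\<forall>a\<in>Sigma {..L} A. ?g (?f a) = a"
      by (auto simp: A_def ind filter_replicate_mset)
    have *: "filter_mset (\<lambda>\<alpha>. \<not> fst \<alpha> < ?r) \<mu> = replicate_mset (count \<mu> (?r, 0)) (?r, 0) + replicate_mset (L - count \<mu> (?r, 0)) (?r, Suc 0)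
       \<and> count \<mu> (?r, 0) \<le> L"
      if "\<mu> \<in> mons n L c" for \<mu>
    proof -
      let ?\<nu> = "filter_mset (\<lambda>\<alpha>. \<not> fst \<alpha> < ?r) \<mu>"
      have sub: "set_mset ?\<nu> \<subseteq> {(?r, 0), (?r, Suc 0)}" using that by (auto simp: mons_def bimons_def J_cases indices_def dest!: subsetD)
      define x y where xy: "x = count ?\<nu> (?r, 0)" "y = count ?\<nu> (?r, Suc 0)"
      have x: "x = count \<mu> (?r, 0)" by (simp add: xy)
      have e: "?\<nu> = replicate_mset x (?r, 0) + replicate_mset y (?r, Suc 0)"
      proof (rule multiset_eqI)
        fix z show "count ?\<nu> z = count (replicate_mset x (?r, 0) + replicate_mset y (?r, Suc 0)) z"
          unfolding xy using sub by (cases "z \<in> {(?r, 0), (?r, Suc 0)}") (auto simp: count_eq_zero_iff simp del: count_filter_mset)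
      qed
      have "size ?\<nu> = L" using that by (simp add: mons_def bimons_def mdeg2_def)
      then have "x + y = L" by (simp only: e size_union size_replicate_mset)
      then have "y = L - x" "x \<le> L" by auto
      then show ?thesis using e by (simp only: x)
    qed
    show "\<forall>\<mu>\<in>mons n L c. ?f (?g \<mu>) = \<mu>"
    proof
      fix \<mu> assume "\<mu> \<in> mons n L c"
      then have "?f (?g \<mu>) = filter_mset (\<lambda>\<alpha>. fst \<alpha> < ?r) \<mu> + filter_mset (\<lambda>\<alpha>. \<not> fst \<alpha> < ?r) \<mu>"
        using * by (simp only: prod.case)
      also have "\<dots> = \<mu>" by (rule multiset_partition[symmetric])
      finally show "?f (?g \<mu>) = \<mu>" .
    qed
    show "?f ` Sigma {..L} A \<subseteq> mons n L c"
    proof (rule image_subsetI)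
      fix x assume "x \<in> Sigma {..L} A"
      then obtain j \<mu> where x: "x = (j, \<mu>)" and j: "j \<in> {..L}" and \<mu>: "\<mu> \<in> A j" by blast
      then have \<mu>': "set_mset \<mu> \<subseteq> indices ds" "size \<mu> = n" "(\<Sum>\<alpha>\<in>#\<mu>. wt \<alpha>) = c - int L + 2 * int j" by (auto simp: A_def)
      show "?f x \<in> mons n L c"
        unfolding x prod.case using j \<mu>' ind[OF \<mu>'(1)]
        by (auto simp: mons_def bimons_def mdeg1_def mdeg2_def weight_def wt J_cases of_nat_diff
          filter_replicate_mset split: if_splits)
    qed
    show "?g ` mons n L c \<subseteq> Sigma {..L} A"
    proof (rule image_subsetI)
      fix \<mu> assume \<mu>: "\<mu> \<in> mons n L c"
      let ?\<mu>1 = "filter_mset (\<lambda>\<alpha>. fst \<alpha> < ?r) \<mu>"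
      have "weight \<mu> = weight ?\<mu>1 + weight (filter_mset (\<lambda>\<alpha>. \<not> fst \<alpha> < ?r) \<mu>)"
        by (simp only: mdeg_simps(6)[symmetric] multiset_partition[symmetric])
      also have "weight (filter_mset (\<lambda>\<alpha>. \<not> fst \<alpha> < ?r) \<mu>) = int L - 2 * int (count \<mu> (?r, 0))"
        using *[OF \<mu>] by (simp add: weight_def wt of_nat_diff)
      finally have "weight ?\<mu>1 = c - int L + 2 * int (count \<mu> (?r, 0))" using \<mu> by (simp add: mons_def)
      moreover have "set_mset ?\<mu>1 \<subseteq> indices ds" using \<mu> by (auto simp: mons_def bimons_def J_cases dest!: subsetD)
      ultimately have "count \<mu> (?r, 0) \<in> {..L}" "?\<mu>1 \<in> A (count \<mu> (?r, 0))"
        using *[OF \<mu>] \<mu> by (auto simp: A_def weight_def mons_def bimons_def mdeg1_def)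
      then show "?g \<mu> \<in> Sigma {..L} A" by (rule SigmaI)
    qed
  qed
  also have "\<dots> = (\<Sum>j\<le>L. card (A j))" using fin by (simp add: card_SigmaI)
  finally show ?thesis by (simp add: A_def wcount_def)
qed

text \<open>The sums for total weight 0 and 2 run over the same steps shifted by one place. They
  telescope, and only the two extreme weights survive.\<close>

theorem dim_covariants:
  "int (cfun.dim (covariants ds L n)) =
     int (wcount wt (indices ds) n (- int L)) - int (wcount wt (indices ds) n (int L + 2))"
proof -
  define G where "G j = int (wcount wt (indices ds) n (- int L + 2 * int j))" for j
  have "int (card (mons n L 0)) = (\<Sum>j<Suc L. G j)"
    by (simp add: card_mons G_def lessThan_Suc_atMost)
  moreover have "int (card (mons n L 2)) = (\<Sum>j<Suc L. G (Suc j))"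
    by (simp add: card_mons G_def lessThan_Suc_atMost algebra_simps)
  ultimately have "int (cfun.dim (covariants ds L n)) = (\<Sum>j<Suc L. G j) - (\<Sum>j<Suc L. G (Suc j))"
    using dim_covariants_mons[of L n] by linarith
  also have "\<dots> = - (\<Sum>j<Suc L. G (Suc j) - G j)" by (simp add: sum_subtractf)
  also have "\<dots> = G 0 - G (Suc L)" by (subst sum_lessThan_telescope) simp
  finally show ?thesis by (simp add: G_def algebra_simps)
qed

end

section \<open>Counting multisets of given weight\<close>

lemma finite_wcount: "finite I \<Longrightarrow> finite {\<mu>. set_mset \<mu> \<subseteq> I \<and> size \<mu> = n \<and> (\<Sum>\<alpha>\<in>#\<mu>. wt \<alpha>) = (c::int)}"
  by (rule finite_subset[OF _ finite_multisets_of_size[of I n]]) (auto simp: multisets_of_size_def)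

lemma wcount_empty: "wcount wt {} n c = (if n = 0 \<and> c = 0 then 1 else 0)"
proof -
  have "{\<mu>. set_mset \<mu> \<subseteq> {} \<and> size \<mu> = n \<and> (\<Sum>\<alpha>\<in>#\<mu>. wt \<alpha>) = c} = (if n = 0 \<and> c = 0 then {{#}} else {})"
    by auto
  then show ?thesis by (simp add: wcount_def)
qed

text \<open>A monomial either avoids \<open>a\<close> or has one factor \<open>a\<close> that can be
  split off; in terms of generating functions this is the geometric series belonging to
  \<open>a\<close>.\<close>

lemma wcount_remove:
  assumes "finite I" "a \<in> I"
  shows "wcount wt I n c = wcount wt (I - {a}) n c + (if n = 0 then 0 else wcount wt I (n - 1) (c - wt a))"
proof -
  define S where "S I n c = {\<mu>. set_mset \<mu> \<subseteq> I \<and> size \<mu> = n \<and> (\<Sum>\<alpha>\<in>#\<mu>. wt \<alpha>) = c}" for I n c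
  have fin: "finite I \<Longrightarrow> finite (S I n c)" for I n c unfolding S_def by (rule finite_wcount)
  have SU: "S I n c = S (I - {a}) n c \<union> (if n = 0 then {} else add_mset a ` S I (n - 1) (c - wt a))" (is "?A = ?B")
  proof (intro equalityI subsetI)
    fix \<mu> assume \<mu>: "\<mu> \<in> ?A"
    show "\<mu> \<in> ?B"
    proof (cases "a \<in># \<mu>")
      case True
      then obtain \<nu> where "\<mu> = add_mset a \<nu>" by (metis insert_DiffM)
      then show ?thesis using \<mu> by (auto simp: S_def)
    qed (use \<mu> in \<open>auto simp: S_def\<close>)
  next
    fix \<mu> assume "\<mu> \<in> ?B"
    then have "\<mu> \<in> S (I - {a}) n c \<or> (n \<noteq> 0 \<and> \<mu> \<in> add_mset a ` S I (n - 1) (c - wt a))"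
      by (cases "n = 0") auto
    then show "\<mu> \<in> ?A"
      using assms(2) unfolding S_def by (elim disjE conjE imageE) auto
  qed
  have "card (S I n c) = card (S (I - {a}) n c) + card (if n = 0 then {} else add_mset a ` S I (n - 1) (c - wt a))"
  proof (subst SU, rule card_Un_disjoint)
    have "add_mset a \<mu> \<notin> S (I - {a}) n c" for \<mu> unfolding S_def by auto
    then show "S (I - {a}) n c \<inter> (if n = 0 then {} else add_mset a ` S I (n - 1) (c - wt a)) = {}"
      by (cases "n = 0") auto
    show "finite (S (I - {a}) n c)" using assms(1) by (intro fin) simp
    have "finite (add_mset a ` S I (n - 1) (c - wt a))" using assms(1) by (intro finite_imageI fin)
    then show "finite (if n = 0 then {} else add_mset a ` S I (n - 1) (c - wt a))" by simp
  qed
  also have "card (if n = 0 then {} else add_mset a ` S I (n - 1) (c - wt a)) = (if n = 0 then 0 else card (S I (n - 1) (c - wt a)))"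
    by (auto intro!: card_image simp: inj_on_def)
  finally show ?thesis by (simp add: wcount_def S_def)
qed

section \<open>Rationality of the counting series\<close>

definition rational_fps :: "complex fps \<Rightarrow> bool" where
  "rational_fps F \<longleftrightarrow> (\<exists>P Q. Q \<noteq> 0 \<and> fps_of_poly Q * F = fps_of_poly P)"

lemma rational_fps_poly: "rational_fps (fps_of_poly P)"
  unfolding rational_fps_def by (intro exI[of _ P] exI[of _ 1]) simp

lemma rational_fps_add: "rational_fps F \<Longrightarrow> rational_fps G \<Longrightarrow> rational_fps (F + G)"
  unfolding rational_fps_def
proof (elim exE conjE)
  fix P Q P' Q' assume "Q \<noteq> 0" "fps_of_poly Q * F = fps_of_poly P" "Q' \<noteq> 0" "fps_of_poly Q' * G = fps_of_poly P'"
  moreover from this have "fps_of_poly (Q * Q') * (F + G) = fps_of_poly (Q' * P + Q * P')"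
    by (simp add: fps_of_poly_mult fps_of_poly_add algebra_simps flip: mult.assoc)
  ultimately show "\<exists>P Q. Q \<noteq> 0 \<and> fps_of_poly Q * (F + G) = fps_of_poly P" by (metis no_zero_divisors)
qed

lemma rational_fps_mult: "rational_fps F \<Longrightarrow> rational_fps (fps_of_poly R * F)"
  unfolding rational_fps_def
  by (metis fps_of_poly_mult mult.left_commute)

lemma rational_fps_divide: "rational_fps (fps_of_poly R * F) \<Longrightarrow> R \<noteq> 0 \<Longrightarrow> rational_fps F"
  unfolding rational_fps_def
  by (metis fps_of_poly_mult mult.assoc no_zero_divisors)

lemma rational_fps_sum: "(\<And>i. i \<in> A \<Longrightarrow> rational_fps (F i)) \<Longrightarrow> rational_fps (sum F A)"
  using rational_fps_poly[of 0]
  by (induction A rule: infinite_finite_induct) (auto intro: rational_fps_add)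

lemma fps_eventually_zero_poly:
  assumes "\<And>n. n > N \<Longrightarrow> fps_nth F n = 0"
  shows "\<exists>P. F = fps_of_poly P"
proof
  show "F = fps_of_poly (Poly (map (fps_nth F) [0..<Suc N]))"
    using assms by (auto simp: fps_eq_iff nth_default_def simp del: upt_Suc)
qed

definition wseries :: "('i \<Rightarrow> int) \<Rightarrow> 'i set \<Rightarrow> int \<Rightarrow> complex fps" where
  "wseries wt I c = Abs_fps (\<lambda>n. of_nat (wcount wt I n c))"

lemma wseries_remove:
  assumes "finite I" "a \<in> I"
  shows "wseries wt I c = wseries wt (I - {a}) c + fps_X * wseries wt I (c - wt a)"
  by (rule fps_ext) (simp add: wseries_def wcount_remove[OF assms, of wt _ c])

text \<open>The index \<open>i\<close> is the exact multiplicity of \<open>a\<close> in a monomial;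
  the last term collects the multiplicities of at least \<open>p\<close>.\<close>

lemma wseries_iterate:
  assumes "finite I" "a \<in> I"
  shows "wseries wt I c = (\<Sum>i<p. fps_X ^ i * wseries wt (I - {a}) (c - int i * wt a)) + fps_X ^ p * wseries wt I (c - int p * wt a)"
proof (induction p)
  case (Suc p)
  have "wseries wt I (c - int p * wt a) = wseries wt (I - {a}) (c - int p * wt a) + fps_X * wseries wt I (c - int (Suc p) * wt a)"
    by (subst wseries_remove[OF assms]) (simp add: algebra_simps)
  then show ?case by (subst Suc) (simp add: algebra_simps)
qed simp

lemma weight_ge_size:
  fixes f :: "'i \<Rightarrow> int"
  assumes "\<And>\<alpha>. \<alpha> \<in># \<mu> \<Longrightarrow> f \<alpha> \<ge> 1"
  shows "(\<Sum>\<alpha>\<in>#\<mu>. f \<alpha>) \<ge> int (size \<mu>)"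
  using assms
proof (induction \<mu>)
  case (add x \<mu>)
  then have "f x \<ge> 1" "(\<Sum>\<alpha>\<in>#\<mu>. f \<alpha>) \<ge> int (size \<mu>)" by auto
  then show ?case by simp
qed simp

text \<open>If all weights have the same strict sign the series is a polynomial. Otherwise some
  \<open>a\<close>, \<open>b\<close> have weights of opposite sign, a product of powers of the two has weight zero, and this
  allows one of them to be eliminated.\<close>

lemma rational_wseries: "finite I \<Longrightarrow> rational_fps (wseries wt I c)"
proof (induction "card I" arbitrary: I c rule: less_induct)
  case less
  have IH: "rational_fps (wseries wt (I - {a}) c)" if "a \<in> I" for a c
    using less(2) that by (intro less(1)[OF card_Diff1_less]) auto
  have X: "(fps_X :: complex fps) ^ i = fps_of_poly (monom 1 i)" for i :: nat by (simp add: fps_of_poly_monom)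
  have sum: "rational_fps (\<Sum>i<p. fps_X ^ i * wseries wt (I - {a}) (g i))" if "a \<in> I" for a p g
    unfolding X by (intro rational_fps_sum rational_fps_mult IH that)
  show ?case
  proof (cases "\<exists>a\<in>I. wt a = 0")
    case True
    then obtain a where a: "a \<in> I" "wt a = 0" by blast
    have e: "fps_of_poly [:1, -1:] = (1 - fps_X :: complex fps)"
      by (rule fps_ext) (auto simp: coeff_pCons split: nat.splits)
    have "(1 - fps_X) * wseries wt I c = wseries wt (I - {a}) c"
      using wseries_remove[OF less(2) a(1), of wt c] a(2) by (simp add: algebra_simps)
    then have "fps_of_poly [:1, -1:] * wseries wt I c = wseries wt (I - {a}) c" by (simp only: e)
    then have "rational_fps (fps_of_poly [:1, -1:] * wseries wt I c)" using IH[OF a(1)] by simp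
    then show ?thesis by (rule rational_fps_divide) simp
  next
    case nz: False
    show ?thesis
    proof (cases "\<exists>a\<in>I. \<exists>b\<in>I. wt a > 0 \<and> wt b < 0")
      case True
      then obtain a b where ab: "a \<in> I" "b \<in> I" "wt a > 0" "wt b < 0" by blast
      \<comment> \<open>With these exponents, p steps along \<open>a\<close> followed by q steps
        along \<open>b\<close> lead back to the weight \<open>c\<close>, so the series reappears on
        the right with the factor X^(p + q).\<close>
      define p q where "p = nat (- wt b)" "q = nat (wt a)"
      have pq: "c - int p * wt a - int q * wt b = c" "p > 0" using ab by (simp_all add: p_q_def)
      let ?R = "(\<Sum>i<p. fps_X ^ i * wseries wt (I - {a}) (c - int i * wt a)) +
         fps_X ^ p * (\<Sum>j<q. fps_X ^ j * wseries wt (I - {b}) (c - int p * wt a - int j * wt b))"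
      have "wseries wt I c = (\<Sum>i<p. fps_X ^ i * wseries wt (I - {a}) (c - int i * wt a)) + fps_X ^ p *
        ((\<Sum>j<q. fps_X ^ j * wseries wt (I - {b}) (c - int p * wt a - int j * wt b)) + fps_X ^ q * wseries wt I c)"
        using wseries_iterate[OF less(2) ab(1), of wt c p] wseries_iterate[OF less(2) ab(2), of wt "c - int p * wt a" q]
        unfolding pq by simp
      then have "fps_of_poly (1 - monom 1 (p + q)) * wseries wt I c = ?R"
        by (simp add: fps_of_poly_diff fps_of_poly_monom power_add algebra_simps)
      moreover have "rational_fps ?R"
        by (intro rational_fps_add sum ab) (unfold X, intro rational_fps_mult, fold X, intro sum ab)
      ultimately have "rational_fps (fps_of_poly (1 - monom 1 (p + q)) * wseries wt I c)" by simp
      moreover have "(1 - monom 1 (p + q) :: complex poly) \<noteq> 0"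
      proof
        assume "(1 - monom 1 (p + q) :: complex poly) = 0"
        then have "coeff (1 - monom 1 (p + q) :: complex poly) 0 = 0" by simp
        then show False using pq(2) by simp
      qed
      ultimately show ?thesis by (rule rational_fps_divide)
    next
      case False
      \<comment> \<open>All weights have the same strict sign here, so each factor moves the weight
        by at least one in the same direction.\<close>
      have "wcount wt I n c = 0" if "n > nat \<bar>c\<bar>" for n
      proof -
        have "{\<mu>. set_mset \<mu> \<subseteq> I \<and> size \<mu> = n \<and> (\<Sum>\<alpha>\<in>#\<mu>. wt \<alpha>) = c} = {}"
        proof (rule equals0I, clarify)
          fix \<mu> assume \<mu>: "set_mset \<mu> \<subseteq> I" "n = size \<mu>" "c = (\<Sum>\<alpha>\<in>#\<mu>. wt \<alpha>)"
          show False
          proof (cases "\<exists>a\<in>I. wt a > 0")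
            case True
            then have "\<And>\<alpha>. \<alpha> \<in># \<mu> \<Longrightarrow> wt \<alpha> \<ge> 1" using False nz \<mu>(1)
              by (smt (verit) subsetD)
            then show False using weight_ge_size[of \<mu> wt] that \<mu> by simp
          next
            case f: False
            then have "\<And>\<alpha>. \<alpha> \<in># \<mu> \<Longrightarrow> - wt \<alpha> \<ge> 1" using nz \<mu>(1) by (smt (verit) subsetD)
            then have "(\<Sum>\<alpha>\<in>#\<mu>. - wt \<alpha>) \<ge> int (size \<mu>)" by (rule weight_ge_size)
            moreover have "(\<Sum>\<alpha>\<in>#\<mu>. - wt \<alpha>) = - (\<Sum>\<alpha>\<in>#\<mu>. wt \<alpha>)" by (induction \<mu>) auto
            ultimately show False using that \<mu> by simp
          qed
        qed
        then show ?thesis unfolding wcount_def by (simp only: card.empty)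
      qed
      then have "\<exists>P. wseries wt I c = fps_of_poly P"
        by (intro fps_eventually_zero_poly[of "nat \<bar>c\<bar>"]) (simp add: wseries_def)
      then show ?thesis using rational_fps_poly by auto
    qed
  qed
qed

section \<open>Weight multiplicities as Fourier coefficients\<close>

definition geo :: "complex \<Rightarrow> complex fps" where "geo z = Abs_fps (\<lambda>n. z ^ n)"

text \<open>The graded character at angle \<theta>: the coefficient of X^n is the sum of
  \<open>cis\<close> (weight times \<theta>) over all monomials of degree n.\<close>

definition chr :: "('i \<Rightarrow> int) \<Rightarrow> 'i set \<Rightarrow> real \<Rightarrow> complex fps" where
  "chr wt I \<theta> = (\<Prod>\<alpha>\<in>I. geo (cis (of_int (wt \<alpha>) * \<theta>)))"

lemma chr_insert:
  assumes "finite I" "a \<notin> I"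
  shows "fps_nth (chr wt (insert a I) \<theta>) n = fps_nth (chr wt I \<theta>) n +
    (if n = 0 then 0 else cis (of_int (wt a) * \<theta>) * fps_nth (chr wt (insert a I) \<theta>) (n - 1))"
proof -
  let ?z = "cis (of_int (wt a) * \<theta>)"
  have "geo ?z = 1 + fps_const ?z * (fps_X * geo ?z)"
    by (rule fps_ext) (auto simp: geo_def power_eq_if)
  moreover have "chr wt (insert a I) \<theta> = geo ?z * chr wt I \<theta>"
    using assms by (simp add: chr_def)
  ultimately have "chr wt (insert a I) \<theta> = (1 + fps_const ?z * (fps_X * geo ?z)) * chr wt I \<theta>" by (simp only:)
  also have "\<dots> = chr wt I \<theta> + fps_const ?z * (fps_X * (geo ?z * chr wt I \<theta>))"
    by (simp only: distrib_right mult_1 mult.assoc)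
  also have "geo ?z * chr wt I \<theta> = chr wt (insert a I) \<theta>" using assms by (simp add: chr_def)
  finally have "fps_nth (chr wt (insert a I) \<theta>) n = fps_nth (chr wt I \<theta> + fps_const ?z * (fps_X * chr wt (insert a I) \<theta>)) n"
    by (rule arg_cong)
  then show ?thesis by (simp only: fps_add_nth fps_mult_left_const_nth fps_X_mult_nth) simp
qed

lemma continuous_chr: "continuous_on A (\<lambda>\<theta>. fps_nth (chr wt I \<theta>) n)"
proof (cases "finite I")
  case True
  then show ?thesis
  proof (induction I arbitrary: n)
    case (insert a I)
    have "fps_nth (chr wt (insert a I) \<theta>) n = (\<Sum>i\<le>n. cis (of_int (wt a) * \<theta>) ^ i * fps_nth (chr wt I \<theta>) (n - i))" for \<theta>
      using insert by (simp add: chr_def fps_mult_nth geo_def atLeast0AtMost)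
    then show ?case using insert by (auto intro!: continuous_intros simp: cis_conv_exp)
  qed (simp add: chr_def)
qed (simp add: chr_def)

lemma has_integral_cis:
  "((\<lambda>\<theta>. cis (of_int k * \<theta>)) has_integral (if k = 0 then complex_of_real (2 * pi) else 0)) {-pi..pi}"
proof (cases "k = 0")
  case True
  then show ?thesis using has_integral_const_real[of "1 :: complex" "-pi" pi] by (simp add: scaleR_conv_of_real)
next
  case False
  have "((\<lambda>\<theta>. cis (of_int k * \<theta>)) has_integral
      (cis (of_int k * pi) / (\<i> * of_int k) - cis (of_int k * (- pi)) / (\<i> * of_int k))) {-pi..pi}"
  proof (rule fundamental_theorem_of_calculus)
    fix x assume "x \<in> {-pi..pi}"
    define c where "c = \<i> * of_int k"
    have "((\<lambda>z. exp (c * z) / c) has_field_derivative exp (c * of_real x)) (at (of_real x))"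
      using False by (auto intro!: derivative_eq_intros simp: c_def)
    from has_vector_derivative_real_field[OF this] show "((\<lambda>\<theta>. cis (of_int k * \<theta>) / (\<i> * of_int k)) has_vector_derivative cis (of_int k * x)) (at x within {-pi..pi})"
      by (simp add: cis_conv_exp c_def mult.assoc)
  qed simp
  moreover have "cis (of_int k * pi) = cis (of_int k * (- pi))"
    by (auto simp: complex_eq_iff sin_zero_iff_int2)
  ultimately show ?thesis using False by simp
qed

text \<open>The recurrences \<open>chr_insert\<close> and \<open>wcount_remove\<close> have the same
  shape, so a double induction over \<open>I\<close> and \<open>n\<close> compares the two sides
  without expanding the character into monomials.\<close>

lemma wcount_fourier:
  "finite I \<Longrightarrow> ((\<lambda>\<theta>. cis (- of_int c * \<theta>) * fps_nth (chr wt I \<theta>) n) has_integral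
      complex_of_real (2 * pi) * of_nat (wcount wt I n c)) {-pi..pi}"
proof (induction I arbitrary: c n rule: finite_induct)
  case empty
  show ?case using has_integral_cis[of "- c"] by (cases "n = 0") (auto simp: chr_def wcount_empty)
next
  case (insert a I)
  note a = insert
  show ?case
  proof (induction n arbitrary: c)
    case 0
    show ?case using a wcount_remove[of "insert a I" a wt 0 c] by (simp add: chr_insert)
  next
    case (Suc n)
    have "((\<lambda>\<theta>. cis (- of_int c * \<theta>) * fps_nth (chr wt I \<theta>) (Suc n) + cis (- of_int (c - wt a) * \<theta>) * fps_nth (chr wt (insert a I) \<theta>) n)
       has_integral complex_of_real (2 * pi) * of_nat (wcount wt I (Suc n) c) + complex_of_real (2 * pi) * of_nat (wcount wt (insert a I) n (c - wt a))) {-pi..pi}"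
      by (intro has_integral_add a(3) Suc)
    moreover have "complex_of_real (2 * pi) * of_nat (wcount wt I (Suc n) c) + complex_of_real (2 * pi) * of_nat (wcount wt (insert a I) n (c - wt a))
       = complex_of_real (2 * pi) * of_nat (wcount wt (insert a I) (Suc n) c)"
      using a wcount_remove[of "insert a I" a wt "Suc n" c] by (simp add: algebra_simps)
    moreover have "cis (- of_int c * \<theta>) * fps_nth (chr wt I \<theta>) (Suc n) + cis (- of_int (c - wt a) * \<theta>) * fps_nth (chr wt (insert a I) \<theta>) n
       = cis (- of_int c * \<theta>) * fps_nth (chr wt (insert a I) \<theta>) (Suc n)" for \<theta>
    proof -
      have "cis (- of_int (c - wt a) * \<theta>) = cis (- of_int c * \<theta>) * cis (of_int (wt a) * \<theta>)"
        by (simp add: cis_mult algebra_simps)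
      then show ?thesis using a by (subst chr_insert) (simp_all add: algebra_simps)
    qed
    ultimately show ?case by simp
  qed
qed

text \<open>Coefficient of X^n in (1 - X)^(-m), that is, the number of monomials of degree n in m
  variables; a majorant of the character coefficients at every angle.\<close>

definition bigQ :: "nat \<Rightarrow> nat \<Rightarrow> real" where "bigQ m n = fps_nth ((Abs_fps (\<lambda>_. 1)) ^ m) n"

lemma bigQ_Suc: "bigQ (Suc m) n = (\<Sum>i\<le>n. bigQ m (n - i))"
  by (simp add: bigQ_def fps_mult_nth atLeast0AtMost)

lemma bigQ_nonneg: "bigQ m n \<ge> 0"
proof (induction m arbitrary: n)
  case (Suc m) then show ?case by (simp add: bigQ_Suc sum_nonneg)
qed (simp add: bigQ_def)

lemma bigQ_summable: "0 < t \<Longrightarrow> t < 1 \<Longrightarrow> summable (\<lambda>n. bigQ m n * t ^ n)"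
proof (induction m)
  case 0
  have "(\<lambda>n. bigQ 0 n * t ^ n) = (\<lambda>n. if n = 0 then 1 else 0)" by (auto simp: bigQ_def)
  then show ?case by simp
next
  case (Suc m)
  have "(\<lambda>k. \<Sum>i\<le>k. t ^ i * (bigQ m (k - i) * t ^ (k - i))) sums ((\<Sum>k. t ^ k) * (\<Sum>k. bigQ m k * t ^ k))"
    by (rule Cauchy_product_sums) (use Suc bigQ_nonneg in \<open>simp_all add: abs_mult\<close>)
  moreover have "(\<Sum>i\<le>k. t ^ i * (bigQ m (k - i) * t ^ (k - i))) = bigQ (Suc m) k * t ^ k" for k
    unfolding bigQ_Suc sum_distrib_right by (intro sum.cong refl) (simp add: power_add[symmetric] mult_ac)
  ultimately show ?case by (simp add: sums_iff)
qed

lemma chr_bound: "finite I \<Longrightarrow> norm (fps_nth (chr wt I \<theta>) n) \<le> bigQ (card I) n"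
proof (induction I arbitrary: n rule: finite_induct)
  case empty
  show ?case by (auto simp: chr_def bigQ_def)
next
  case (insert a I)
  have "fps_nth (chr wt (insert a I) \<theta>) n = (\<Sum>i\<le>n. cis (of_int (wt a) * \<theta>) ^ i * fps_nth (chr wt I \<theta>) (n - i))"
    using insert by (simp add: chr_def fps_mult_nth geo_def atLeast0AtMost)
  also have "norm \<dots> \<le> (\<Sum>i\<le>n. bigQ (card I) (n - i))"
    by (rule sum_norm_le) (use insert in \<open>simp add: norm_mult norm_power\<close>)
  finally show ?case using insert by (simp add: bigQ_Suc)
qed

lemma chr_sums:
  assumes t: "0 < t" "t < 1"
  shows "finite I \<Longrightarrow> (\<lambda>n. fps_nth (chr wt I \<theta>) n * of_real t ^ n) sums (\<Prod>\<alpha>\<in>I. inverse (1 - of_real t * cis (of_int (wt \<alpha>) * \<theta>)))"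
proof (induction I rule: finite_induct)
  case empty
  have "(\<lambda>n. fps_nth (chr wt {} \<theta>) n * complex_of_real t ^ n) = (\<lambda>n. if n = 0 then 1 else 0)"
    by (auto simp: chr_def)
  then show ?case using sums_single[of 0 "\<lambda>_. 1 :: complex"] by simp
next
  case (insert a I)
  let ?z = "cis (of_int (wt a) * \<theta>)"
  have nz: "norm (of_real t * ?z) < 1" using t by (simp add: norm_mult)
  have s1: "(\<lambda>n. (of_real t * ?z) ^ n) sums inverse (1 - of_real t * ?z)"
    using geometric_sums[OF nz] by (simp add: inverse_eq_divide)
  have "summable (\<lambda>n. norm (fps_nth (chr wt I \<theta>) n * complex_of_real t ^ n))"
    by (rule summable_comparison_test'[OF bigQ_summable[OF t, of "card I"], of 0])
      (use t chr_bound[OF insert(1)] in \<open>simp add: norm_mult norm_power mult_right_mono\<close>)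
  then have "(\<lambda>k. \<Sum>i\<le>k. (of_real t * ?z) ^ i * (fps_nth (chr wt I \<theta>) (k - i) * of_real t ^ (k - i))) sums
     ((\<Sum>k. (of_real t * ?z) ^ k) * (\<Sum>k. fps_nth (chr wt I \<theta>) k * of_real t ^ k))"
    using t by (intro Cauchy_product_sums) (simp_all add: norm_mult norm_power)
  moreover have "(\<Sum>i\<le>k. (of_real t * ?z) ^ i * (fps_nth (chr wt I \<theta>) (k - i) * of_real t ^ (k - i))) = fps_nth (chr wt (insert a I) \<theta>) k * of_real t ^ k" for k
  proof -
    have "fps_nth (chr wt (insert a I) \<theta>) k = (\<Sum>i\<le>k. ?z ^ i * fps_nth (chr wt I \<theta>) (k - i))"
      using insert by (simp add: chr_def fps_mult_nth geo_def atLeast0AtMost)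
    then have "fps_nth (chr wt (insert a I) \<theta>) k * of_real t ^ k = (\<Sum>i\<le>k. ?z ^ i * fps_nth (chr wt I \<theta>) (k - i) * of_real t ^ k)"
      by (simp only: sum_distrib_right)
    also have "\<dots> = (\<Sum>i\<le>k. (of_real t * ?z) ^ i * (fps_nth (chr wt I \<theta>) (k - i) * of_real t ^ (k - i)))"
    proof (rule sum.cong)
      fix i assume "i \<in> {..k}"
      then have "complex_of_real t ^ k = of_real t ^ i * of_real t ^ (k - i)" by (simp add: power_add[symmetric])
      then show "?z ^ i * fps_nth (chr wt I \<theta>) (k - i) * of_real t ^ k =
          (of_real t * ?z) ^ i * (fps_nth (chr wt I \<theta>) (k - i) * of_real t ^ (k - i))"
        by (simp only: power_mult_distrib mult_ac)
    qed simp
    finally show ?thesis by (rule sym)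
  qed
  ultimately show ?case using insert s1 by (simp add: sums_iff)
qed

text \<open>The majorant \<open>bigQ\<close> makes the series converge uniformly in the angle, so it
  may be integrated term by term.\<close>

lemma wcount_sums:
  assumes t: "0 < t" "t < 1" and I: "finite I"
  shows "\<exists>S. ((\<lambda>\<theta>. cis (- of_int c * \<theta>) * (\<Prod>\<alpha>\<in>I. inverse (1 - of_real t * cis (of_int (wt \<alpha>) * \<theta>)))) has_integral S) {-pi..pi}
     \<and> (\<lambda>n. of_nat (wcount wt I n c) * of_real t ^ n) sums (S / complex_of_real (2 * pi))"
proof -
  define f where "f n \<theta> = cis (- of_int c * \<theta>) * fps_nth (chr wt I \<theta>) n * of_real t ^ n" for n \<theta>
  define g where "g \<theta> = cis (- of_int c * \<theta>) * (\<Prod>\<alpha>\<in>I. inverse (1 - of_real t * cis (of_int (wt \<alpha>) * \<theta>)))" for \<theta>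
  have f_sums: "(\<lambda>n. f n \<theta>) sums g \<theta>" for \<theta>
    unfolding f_def g_def mult.assoc by (intro sums_mult chr_sums t I)
  have unif: "uniform_limit {-pi..pi} (\<lambda>N \<theta>. \<Sum>n<N. f n \<theta>) g sequentially"
  proof -
    have "uniform_limit {-pi..pi} (\<lambda>N \<theta>. \<Sum>n<N. f n \<theta>) (\<lambda>\<theta>. suminf (\<lambda>n. f n \<theta>)) sequentially"
      by (rule Weierstrass_m_test[OF _ bigQ_summable[OF t, of "card I"]])
        (use t chr_bound[OF I] in \<open>simp add: f_def norm_mult norm_power mult_right_mono\<close>)
    moreover have "(\<lambda>\<theta>. suminf (\<lambda>n. f n \<theta>)) = g" using f_sums by (auto simp: sums_iff)
    ultimately show ?thesis by simp
  qed
  have f_int: "(f n has_integral complex_of_real (2 * pi) * of_nat (wcount wt I n c) * of_real t ^ n) {-pi..pi}" for n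
    unfolding f_def by (intro has_integral_mult_left wcount_fourier I)
  have int: "((\<lambda>\<theta>. \<Sum>n<N. f n \<theta>) has_integral (\<Sum>n<N. complex_of_real (2 * pi) * of_nat (wcount wt I n c) * of_real t ^ n)) {-pi..pi}" for N
    by (intro has_integral_sum f_int) auto
  have cont: "continuous_on {-pi..pi} (\<lambda>\<theta>. \<Sum>n<N. f n \<theta>)" for N
    unfolding f_def by (intro continuous_intros continuous_chr)
  obtain J S where JS: "\<And>N. ((\<lambda>\<theta>. \<Sum>n<N. f n \<theta>) has_integral J N) {-pi..pi}" "(g has_integral S) {-pi..pi}" "J \<longlonglongrightarrow> S"
  proof (rule uniform_limit_integral[OF unif cont])
    fix I J
    assume "\<And>N. ((\<lambda>\<theta>. \<Sum>n<N. f n \<theta>) has_integral I N) {-pi..pi}" "(g has_integral J) {-pi..pi}" "I \<longlonglongrightarrow> J"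
    then show thesis by (rule that)
  qed simp
  have J: "J = (\<lambda>N. \<Sum>n<N. complex_of_real (2 * pi) * of_nat (wcount wt I n c) * of_real t ^ n)"
    by (rule ext) (rule has_integral_unique[OF JS(1) int])
  have "(\<lambda>n. complex_of_real (2 * pi) * of_nat (wcount wt I n c) * of_real t ^ n) sums S"
    using JS(3) unfolding sums_def J .
  then have "(\<lambda>n. complex_of_real (2 * pi) * of_nat (wcount wt I n c) * of_real t ^ n / complex_of_real (2 * pi)) sums (S / complex_of_real (2 * pi))"
    by (rule sums_divide)
  then show ?thesis using JS(2) unfolding g_def by (intro exI[of _ S]) simp
qed

section \<open>Asymptotics of the torus integral\<close>

lemma has_bochner_integral_1_div_plus_square:
  "has_bochner_integral lborel (\<lambda>x::real. 1 / (1 + x\<^sup>2)) pi"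
proof -
  have "has_bochner_integral lborel (\<lambda>x. indicator {0..} x *\<^sub>R (1 / (1 + x\<^sup>2))) (pi / 2)"
  proof (rule has_bochner_integral_nn_integral)
    have "(\<integral>\<^sup>+x. ennreal (1 / (1 + x\<^sup>2)) * indicator {0..} x \<partial>lborel) = ennreal (pi / 2 - arctan 0)"
    proof (rule nn_integral_FTC_atLeast)
      fix x :: real
      show "(arctan has_real_derivative 1 / (1 + x\<^sup>2)) (at x)"
        using DERIV_arctan[of x] by (simp add: inverse_eq_divide)
      show "(arctan \<longlongrightarrow> pi / 2) at_top" by (rule tendsto_arctan_at_top)
    qed auto
    also have "(\<integral>\<^sup>+x. ennreal (1 / (1 + x\<^sup>2)) * indicator {0..} x \<partial>lborel) = (\<integral>\<^sup>+x. ennreal (indicator {0..} x *\<^sub>R (1 / (1 + x\<^sup>2))) \<partial>lborel)"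
      by (intro nn_integral_cong) (auto simp: indicator_def)
    finally show "(\<integral>\<^sup>+x. ennreal (indicator {0..} x *\<^sub>R (1 / (1 + x\<^sup>2))) \<partial>lborel) = ennreal (pi / 2)" by simp
  qed auto
  from has_bochner_integral_even_function[OF this] show ?thesis by simp
qed

text \<open>The mass is of order 1/\<sigma> wherever the centre lies. Both the error terms, through
  \<open>cdom\<close>, and the exact value of \<open>Jint\<close>, through partial fractions, are
  reduced to this integral.\<close>

lemma has_bochner_integral_inverse_square:
  assumes "\<sigma> > 0"
  shows "has_bochner_integral lborel (\<lambda>x::real. 1 / (\<sigma>\<^sup>2 + (x - y)\<^sup>2)) (pi / \<sigma>)"
proof -
  have "has_bochner_integral lborel (\<lambda>x. 1 / (1 + (- y / \<sigma> + (1 / \<sigma>) * x)\<^sup>2)) (pi /\<^sub>R \<bar>1 / \<sigma>\<bar>)"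
    by (rule lborel_has_bochner_integral_real_affine_iff[THEN iffD1]) (use assms has_bochner_integral_1_div_plus_square in auto)
  then have "has_bochner_integral lborel (\<lambda>x. (1 / \<sigma>\<^sup>2) * (1 / (1 + (- y / \<sigma> + (1 / \<sigma>) * x)\<^sup>2))) ((1 / \<sigma>\<^sup>2) * (pi /\<^sub>R \<bar>1 / \<sigma>\<bar>))"
    by (rule has_bochner_integral_mult_right[rotated])
  moreover have "(1 / \<sigma>\<^sup>2) * (pi /\<^sub>R \<bar>1 / \<sigma>\<bar>) = pi / \<sigma>" using assms by (simp add: field_simps power2_eq_square)
  moreover have "(1 / \<sigma>\<^sup>2) * (1 / (1 + (- y / \<sigma> + (1 / \<sigma>) * x)\<^sup>2)) = 1 / (\<sigma>\<^sup>2 + (x - y)\<^sup>2)" for x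
  proof -
    have "\<sigma>\<^sup>2 * (1 + z\<^sup>2) = \<sigma>\<^sup>2 + (\<sigma> * z)\<^sup>2" for z
      by (simp only: distrib_left mult_1_right power_mult_distrib)
    then have "\<sigma>\<^sup>2 * (1 + (- y / \<sigma> + (1 / \<sigma>) * x)\<^sup>2) = \<sigma>\<^sup>2 + (\<sigma> * (- y / \<sigma> + (1 / \<sigma>) * x))\<^sup>2" .
    also have "\<sigma> * (- y / \<sigma> + (1 / \<sigma>) * x) = x - y" using assms by (simp add: field_simps)
    finally show ?thesis by (metis divide_divide_eq_left mult_1 times_divide_times_eq)
  qed
  ultimately show ?thesis by simp
qed

lemma abs_sin_minus_self_le: "\<bar>sin x - x\<bar> \<le> \<bar>x\<bar> ^ 3 / (6 :: real)"
  using Maclaurin_sin_bound[of x 3] by (simp add: numeral_3_eq_3 sin_coeff_def)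

lemma abs_sin_mult_le: "\<bar>sin (real n * x)\<bar> \<le> real n * \<bar>sin x\<bar>"
proof (induction n)
  case (Suc n)
  have "sin (real (Suc n) * x) = sin (real n * x) * cos x + cos (real n * x) * sin x"
    using sin_add[of "real n * x" x] by (simp add: algebra_simps)
  then have "\<bar>sin (real (Suc n) * x)\<bar> \<le> \<bar>sin (real n * x)\<bar> * \<bar>cos x\<bar> + \<bar>cos (real n * x)\<bar> * \<bar>sin x\<bar>"
    by (metis abs_mult abs_triangle_ineq)
  also have "\<dots> \<le> \<bar>sin (real n * x)\<bar> * 1 + 1 * \<bar>sin x\<bar>"
    by (intro add_mono mult_mono) auto
  finally show ?case using Suc by (simp add: algebra_simps)
qed simp

lemma four_sin_half_square:
  "\<bar>4 * (sin (x / 2))\<^sup>2 - x\<^sup>2\<bar> \<le> x ^ 4 / (12 :: real)"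
proof -
  let ?s = "sin (x / 2)" and ?h = "x / 2"
  have "\<bar>?s\<^sup>2 - ?h\<^sup>2\<bar> = \<bar>?s - ?h\<bar> * \<bar>?s + ?h\<bar>"
    by (simp add: abs_mult[symmetric] power2_eq_square algebra_simps)
  also have "\<dots> \<le> (\<bar>?h\<bar> ^ 3 / 6) * (2 * \<bar>?h\<bar>)"
    using abs_sin_x_le_abs_x[of ?h] by (intro mult_mono abs_sin_minus_self_le) auto
  also have "\<dots> = x ^ 4 / 48" by (simp add: power_even_abs_numeral eval_nat_numeral abs_mult_self)
  finally show ?thesis by (simp add: power2_eq_square field_simps abs_if split: if_splits)
qed

lemma abs_sin_ge_half: "\<bar>x\<bar> \<le> pi / 2 \<Longrightarrow> \<bar>sin x\<bar> \<ge> \<bar>x\<bar> / (2 :: real)"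
proof -
  assume x: "\<bar>x\<bar> \<le> pi / 2"
  \<comment> \<open>The number 1.6 is larger than \<pi>/2 and its square is below 3, which is what
    turns the error |x|^3 / 6 into at most |x| / 2.\<close>
  have "x\<^sup>2 \<le> (16 / 10)\<^sup>2" using x pi_approx by (intro power2_le_iff_abs_le[THEN iffD2]) auto
  then have "\<bar>x\<bar> * x\<^sup>2 \<le> \<bar>x\<bar> * 3" by (intro mult_left_mono) (auto simp: power2_eq_square)
  then have "\<bar>x\<bar> ^ 3 / 6 \<le> \<bar>x\<bar> / 2" by (simp add: eval_nat_numeral algebra_simps abs_mult_self)
  then show "\<bar>sin x\<bar> \<ge> \<bar>x\<bar> / 2" using abs_sin_minus_self_le[of x] by linarith
qed

text \<open>Around the zeros \<open>2 \<pi> m / b\<close> of the denominator the kernel looks like a rescaled Cauchy density.\<close>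

lemma inverse_sin_square_le:
  assumes \<sigma>: "\<sigma> > 0" and b: "b \<ge> 1" and \<theta>: "\<bar>\<theta>\<bar> \<le> pi"
  shows "1 / (\<sigma>\<^sup>2 + 4 * (sin (real b * \<theta> / 2))\<^sup>2) \<le> (\<Sum>m\<in>{- int b..int b}. 4 / (\<sigma>\<^sup>2 + (\<theta> - 2 * pi * of_int m / real b)\<^sup>2))"
proof -
  \<comment> \<open>2 \<pi> m / b is the zero of the sine closest to \<theta>, and \<open>y\<close>
    is the signed distance from it.\<close>
  define m where "m = round (real b * \<theta> / (2 * pi))"
  define y where "y = \<theta> - 2 * pi * of_int m / real b"
  have r: "\<bar>of_int m - real b * \<theta> / (2 * pi)\<bar> \<le> 1 / 2" unfolding m_def by (rule of_int_round_abs_le)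
  have "\<bar>real b * \<theta> / (2 * pi)\<bar> \<le> real b / 2" using \<theta> b by (simp add: abs_mult field_simps)
  then have "\<bar>of_int m\<bar> \<le> real b / 2 + 1 / 2" using r by linarith
  then have "\<bar>of_int m\<bar> \<le> real b" using b by linarith
  then have m: "m \<in> {- int b..int b}" by auto
  have yb: "real b * y / 2 = real b * \<theta> / 2 - of_int m * pi" using b by (simp add: y_def field_simps)
  have "\<bar>real b * y / 2\<bar> = pi * \<bar>of_int m - real b * \<theta> / (2 * pi)\<bar>"
    unfolding yb abs_mult[of pi, simplified, symmetric] by (simp add: algebra_simps abs_minus_commute)
  also have "\<dots> \<le> pi * (1 / 2)" using r by (intro mult_left_mono) auto
  finally have "\<bar>real b * y / 2\<bar> / 2 \<le> \<bar>sin (real b * y / 2)\<bar>" by (intro abs_sin_ge_half) simp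
  also have "\<bar>sin (real b * y / 2)\<bar> = \<bar>sin (real b * \<theta> / 2)\<bar>"
  proof -
    have s: "sin (of_int m * pi) = 0" unfolding sin_zero_iff_int2 by blast
    have "(cos (of_int m * pi))\<^sup>2 = 1" using sin_cos_squared_add[of "of_int m * pi"] unfolding s by simp
    then have "\<bar>cos (of_int m * pi)\<bar> = 1" by (auto simp: power2_eq_1_iff)
    then show ?thesis unfolding yb by (simp add: sin_diff s abs_mult)
  qed
  finally have "\<bar>real b * y / 2\<bar> / 2 \<le> \<bar>sin (real b * \<theta> / 2)\<bar>" .
  moreover have "\<bar>y\<bar> \<le> \<bar>real b * y\<bar>" using b mult_right_mono[of 1 "real b" "\<bar>y\<bar>"] by (simp add: abs_mult)
  \<comment> \<open>One factor 2 comes from the half angle and one from the lower bound of the sine.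
    Four times the square of y/4 is y^2 / 4, the origin of the constant 4 in the majorant.\<close>
  ultimately have "\<bar>y / 4\<bar> \<le> \<bar>sin (real b * \<theta> / 2)\<bar>" by simp
  then have "(y / 4)\<^sup>2 \<le> (sin (real b * \<theta> / 2))\<^sup>2" by (rule abs_le_square_iff[THEN iffD1])
  then have "(\<sigma>\<^sup>2 + y\<^sup>2) / 4 \<le> \<sigma>\<^sup>2 + 4 * (sin (real b * \<theta> / 2))\<^sup>2"
  proof -
    have "y\<^sup>2 / 16 \<le> (sin (real b * \<theta> / 2))\<^sup>2"
      using \<open>(y / 4)\<^sup>2 \<le> (sin (real b * \<theta> / 2))\<^sup>2\<close> by (simp add: power_divide)
    moreover have "Y / 16 \<le> S \<Longrightarrow> 0 \<le> A \<Longrightarrow> (A + Y) / 4 \<le> A + 4 * S" for A Y S :: real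
      by (simp add: field_simps)
    ultimately show ?thesis using zero_le_power2[of \<sigma>] by blast
  qed
  then have "1 / (\<sigma>\<^sup>2 + 4 * (sin (real b * \<theta> / 2))\<^sup>2) \<le> 1 / ((\<sigma>\<^sup>2 + y\<^sup>2) / 4)"
    using \<sigma> by (intro divide_left_mono) (auto intro!: mult_pos_pos add_pos_nonneg)
  also have "\<dots> = 4 / (\<sigma>\<^sup>2 + (\<theta> - 2 * pi * of_int m / real b)\<^sup>2)" by (simp add: y_def)
  also have "\<dots> \<le> (\<Sum>m\<in>{- int b..int b}. 4 / (\<sigma>\<^sup>2 + (\<theta> - 2 * pi * of_int m / real b)\<^sup>2))"
    using m by (intro member_le_sum) auto
  finally show ?thesis .
qed

lemma abs_prod_minus_one_le:
  fixes r :: "'a \<Rightarrow> real" and \<epsilon> :: real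
  assumes "finite S" "\<And>i. i \<in> S \<Longrightarrow> 0 \<le> r i \<and> r i \<le> 2 \<and> \<bar>r i - 1\<bar> \<le> \<epsilon>"
  shows "\<bar>prod r S - 1\<bar> \<le> card S * 2 ^ card S * \<epsilon> \<and> 0 \<le> prod r S \<and> prod r S \<le> 2 ^ card S"
  using assms
proof (induction S rule: finite_induct)
  case (insert a S)
  then have IH: "\<bar>prod r S - 1\<bar> \<le> card S * 2 ^ card S * \<epsilon>" "0 \<le> prod r S" "prod r S \<le> 2 ^ card S"
    and a: "0 \<le> r a" "r a \<le> 2" "\<bar>r a - 1\<bar> \<le> \<epsilon>" by auto
  have "r a * prod r S - 1 = r a * (prod r S - 1) + (r a - 1)" by (simp add: algebra_simps)
  then have "\<bar>r a * prod r S - 1\<bar> \<le> r a * \<bar>prod r S - 1\<bar> + \<bar>r a - 1\<bar>"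
    using a by (metis abs_mult abs_of_nonneg abs_triangle_ineq)
  also have "\<dots> \<le> 2 * (card S * 2 ^ card S * \<epsilon>) + 1 * \<epsilon>"
    using a IH by (intro add_mono mult_mono) auto
  also have "\<dots> \<le> 2 * (card S * 2 ^ card S * \<epsilon>) + 2 ^ Suc (card S) * \<epsilon>"
    using a(3) by (intro add_left_mono mult_right_mono) (auto intro: order.trans[OF abs_ge_zero] one_le_power simp del: power_Suc)
  also have "\<dots> = card (insert a S) * 2 ^ card (insert a S) * \<epsilon>"
    using insert by (simp add: algebra_simps)
  finally show ?case using insert a IH by (auto intro: mult_mono)
qed simp

text \<open>Equal to cos (L \<theta>) - cos ((L + 2) \<theta>), the difference of the two
  frequencies in \<open>dim_covariants\<close>.\<close>

definition numer :: "nat \<Rightarrow> real \<Rightarrow> real" where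
  "numer L \<theta> = 2 * sin (real (L + 1) * \<theta>) * sin \<theta>"

text \<open>Stated with sin \<theta> instead of \<theta>: the numerator vanishes doubly at \<pi>
  too, and the estimate far from zero relies on that.\<close>

lemma abs_numer_le: "\<bar>numer L \<theta>\<bar> \<le> 2 * real (L + 1) * (sin \<theta>)\<^sup>2"
proof -
  have "\<bar>numer L \<theta>\<bar> \<le> 2 * (real (L + 1) * \<bar>sin \<theta>\<bar>) * \<bar>sin \<theta>\<bar>"
    unfolding numer_def abs_mult by (intro mult_mono abs_sin_mult_le) (auto intro: abs_sin_mult_le)
  then show ?thesis by (simp add: power2_eq_square mult_ac abs_mult_self)
qed

text \<open>One sine is replaced by its argument at a time; the Taylor error of the fast one
  dominates because n \<le> n^3.\<close>

lemma numer_approx: "\<bar>numer L \<theta> - 2 * real (L + 1) * \<theta>\<^sup>2\<bar> \<le> real (L + 1) ^ 3 * \<theta> ^ 4"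
proof -
  define n where "n = real (L + 1)"
  have n: "n \<ge> 1" by (simp add: n_def)
  have "numer L \<theta> - 2 * n * \<theta>\<^sup>2 = 2 * ((sin (n * \<theta>) - n * \<theta>) * sin \<theta> + n * \<theta> * (sin \<theta> - \<theta>))"
    unfolding numer_def n_def[symmetric] by (simp add: algebra_simps power2_eq_square)
  also have "\<bar>\<dots>\<bar> \<le> 2 * (\<bar>sin (n * \<theta>) - n * \<theta>\<bar> * \<bar>sin \<theta>\<bar> + \<bar>n * \<theta>\<bar> * \<bar>sin \<theta> - \<theta>\<bar>)"
    unfolding abs_mult[symmetric] using abs_triangle_ineq[of "(sin (n * \<theta>) - n * \<theta>) * sin \<theta>" "n * \<theta> * (sin \<theta> - \<theta>)"]
    by (simp only: abs_mult[of 2] abs_numeral mult_left_mono zero_le_numeral)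
  also have "\<dots> \<le> 2 * ((\<bar>n * \<theta>\<bar> ^ 3 / 6) * \<bar>\<theta>\<bar> + \<bar>n * \<theta>\<bar> * (\<bar>\<theta>\<bar> ^ 3 / 6))"
    by (intro mult_left_mono add_mono mult_mono abs_sin_minus_self_le abs_sin_x_le_abs_x) auto
  also have "\<dots> = (n ^ 3 + n) / 3 * \<bar>\<theta>\<bar> ^ 4"
    using n by (simp add: abs_mult power_mult_distrib eval_nat_numeral field_simps)
  also have "\<dots> \<le> n ^ 3 * \<bar>\<theta>\<bar> ^ 4"
  proof (rule mult_right_mono)
    have "n * 1 \<le> n * (n * n)" using n by (intro mult_left_mono) (auto intro: mult_ge1_I)
    then show "(n ^ 3 + n) / 3 \<le> n ^ 3" using n by (simp add: eval_nat_numeral)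
  qed simp
  finally show ?thesis by (simp add: n_def power_even_abs_numeral)
qed

text \<open>Every factor but \<open>p k\<close> is charged 1/s; that one is kept in order to be
  integrated.\<close>

lemma prod_le_single:
  fixes p :: "'a \<Rightarrow> real"
  assumes "finite S" "k \<in> S" "s > 0" "\<And>i. i \<in> S \<Longrightarrow> 0 \<le> p i \<and> p i * s \<le> 1"
  shows "prod p S * s ^ (card S - 1) \<le> p k"
proof -
  have "prod p S * s ^ (card S - 1) = p k * (\<Prod>i\<in>S - {k}. p i * s)"
    using assms(1,2) by (simp add: prod.remove prod.distrib)
  also have "\<dots> \<le> p k * 1"
    using assms by (intro mult_left_mono prod_le_1) auto
  finally show ?thesis by simp
qed

section \<open>Comparison of the kernel with its rescaled limit\<close>

definition cauchy_prod :: "(nat \<Rightarrow> real) \<Rightarrow> nat \<Rightarrow> real \<Rightarrow> real" where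
  "cauchy_prod a C x = x\<^sup>2 * (\<Prod>i<C. 1 / (1 + (a i)\<^sup>2 * x\<^sup>2))"

definition Jint :: "(nat \<Rightarrow> real) \<Rightarrow> nat \<Rightarrow> real" where
  "Jint a C = integral\<^sup>L lborel (cauchy_prod a C)"

text \<open>Two of the factors already compensate x^2 and leave an integrable function. The majorant
  does not involve \<open>a\<close>, so it also serves for dominated convergence when the weights
  vary.\<close>

lemma cauchy_prod_bounds:
  assumes "C \<ge> 2" "\<And>i. i < C \<Longrightarrow> a i \<ge> 1"
  shows "0 \<le> cauchy_prod a C x" "cauchy_prod a C x \<le> 1 / (1 + x\<^sup>2)"
proof -
  show "0 \<le> cauchy_prod a C x" by (auto simp: cauchy_prod_def intro!: mult_nonneg_nonneg prod_nonneg divide_nonneg_nonneg add_nonneg_nonneg)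
  have le: "1 / (1 + (a i)\<^sup>2 * x\<^sup>2) \<le> 1 / (1 + x\<^sup>2)" if "i < C" for i
  proof -
    have "1 * x\<^sup>2 \<le> (a i)\<^sup>2 * x\<^sup>2" using assms(2)[OF that] by (intro mult_right_mono) auto
    then show ?thesis by (intro divide_left_mono) (auto intro!: mult_pos_pos add_pos_nonneg)
  qed
  have "(\<Prod>i<C. 1 / (1 + (a i)\<^sup>2 * x\<^sup>2)) \<le> (\<Prod>i<C. 1 / (1 + x\<^sup>2))"
    using le by (intro prod_mono) (auto intro!: divide_nonneg_nonneg add_nonneg_nonneg)
  also have "\<dots> = (1 / (1 + x\<^sup>2)) ^ C" by simp
  also have "\<dots> \<le> (1 / (1 + x\<^sup>2)) ^ 2"
    using assms(1) zero_le_power2[of x] by (intro power_decreasing) (auto simp: divide_le_eq_1_pos add_pos_nonneg)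
  finally have "cauchy_prod a C x \<le> x\<^sup>2 * (1 / (1 + x\<^sup>2)) ^ 2"
    unfolding cauchy_prod_def by (intro mult_left_mono) auto
  also have "\<dots> = (x\<^sup>2 / (1 + x\<^sup>2)) * (1 / (1 + x\<^sup>2))" by (simp add: power2_eq_square)
  also have "\<dots> \<le> 1 * (1 / (1 + x\<^sup>2))" by (intro mult_right_mono) (auto simp: divide_le_eq_1 add_pos_nonneg)
  finally show "cauchy_prod a C x \<le> 1 / (1 + x\<^sup>2)" by simp
qed

lemma measurable_cauchy_prod [measurable]: "cauchy_prod a C \<in> borel_measurable borel"
  unfolding cauchy_prod_def by measurable

lemma integrable_cauchy_prod:
  assumes "C \<ge> 2" "\<And>i. i < C \<Longrightarrow> a i \<ge> 1"
  shows "integrable lborel (cauchy_prod a C)"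
  by (rule Bochner_Integration.integrable_bound[OF integrable.intros[OF has_bochner_integral_1_div_plus_square]])
    (use cauchy_prod_bounds[OF assms] in auto)

definition dnm :: "nat \<Rightarrow> real \<Rightarrow> real \<Rightarrow> real" where
  "dnm b \<sigma> \<theta> = \<sigma>\<^sup>2 + 4 * (sin (real b * \<theta> / 2))\<^sup>2"

definition kern :: "(nat \<Rightarrow> nat) \<Rightarrow> nat \<Rightarrow> nat \<Rightarrow> real \<Rightarrow> real \<Rightarrow> real" where
  "kern b C L \<sigma> \<theta> = numer L \<theta> * (\<Prod>i<C. 1 / dnm (b i) \<sigma> \<theta>)"

lemma dnm_pos: "\<sigma> > 0 \<Longrightarrow> dnm b \<sigma> \<theta> > 0" "\<sigma> > 0 \<Longrightarrow> dnm b \<sigma> \<theta> \<ge> \<sigma>\<^sup>2"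
  by (auto simp: dnm_def intro: add_pos_nonneg)

lemma continuous_kern: "\<sigma> > 0 \<Longrightarrow> continuous_on S (kern b C L \<sigma>)"
proof -
  assume \<sigma>: "\<sigma> > 0"
  have nz: "dnm n \<sigma> \<theta> \<noteq> 0" for n \<theta> using dnm_pos(1)[OF \<sigma>, of n \<theta>] by simp
  have "continuous_on S (dnm n \<sigma>)" for n
    unfolding dnm_def by (intro continuous_intros) auto
  then show ?thesis unfolding kern_def numer_def by (intro continuous_intros) (auto simp: nz)
qed

text \<open>Zero exactly where fewer than two of the sines are nonzero. A sum over pairs is
  continuous in the angle, as the compactness argument needs.\<close>

definition paircover :: "(nat \<Rightarrow> nat) \<Rightarrow> nat \<Rightarrow> real \<Rightarrow> real" where
  "paircover b C \<theta> = (\<Sum>i<C. \<Sum>j\<in>{..<C} - {i}. (sin (real (b i) * \<theta> / 2))\<^sup>2 * (sin (real (b j) * \<theta> / 2))\<^sup>2)"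

text \<open>Cauchy kernels centred at 0 and at the zeros of all denominators: one function that
  majorises every \<open>1 / dnm\<close> on the circle and still has mass of order
  1/\<sigma>.\<close>

definition cdom :: "(nat \<Rightarrow> nat) \<Rightarrow> nat \<Rightarrow> real \<Rightarrow> real \<Rightarrow> real" where
  "cdom b C \<sigma> \<theta> = 1 / (\<sigma>\<^sup>2 + (\<theta> - 0)\<^sup>2) +
     (\<Sum>k<C. \<Sum>m\<in>{- int (b k)..int (b k)}. 4 * (1 / (\<sigma>\<^sup>2 + (\<theta> - 2 * pi * of_int m / real (b k))\<^sup>2)))"

lemma has_bochner_integral_cdom:
  assumes "\<sigma> > 0"
  shows "has_bochner_integral lborel (cdom b C \<sigma>) ((1 + (\<Sum>k<C. \<Sum>m\<in>{- int (b k)..int (b k)}. 4)) * pi / \<sigma>)"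
proof -
  have "has_bochner_integral lborel (cdom b C \<sigma>) (pi / \<sigma> + (\<Sum>k<C. \<Sum>m\<in>{- int (b k)..int (b k)}. 4 * (pi / \<sigma>)))"
    unfolding cdom_def
    by (intro has_bochner_integral_add has_bochner_integral_sum has_bochner_integral_mult_right has_bochner_integral_inverse_square assms)
  moreover have "pi / \<sigma> + (\<Sum>k<C. \<Sum>m\<in>{- int (b k)..int (b k)}. 4 * (pi / \<sigma>)) = (1 + (\<Sum>k<C. \<Sum>m\<in>{- int (b k)..int (b k)}. 4)) * pi / \<sigma>"
  proof -
    define c :: real where "c = (\<Sum>k<C. \<Sum>m\<in>{- int (b k)..int (b k)}. 4)"
    have "(\<Sum>k<C. \<Sum>m\<in>{- int (b k)..int (b k)}. 4 * (pi / \<sigma>)) = c * (pi / \<sigma>)"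
      by (simp only: c_def sum_distrib_right)
    moreover have "pi / \<sigma> + c * (pi / \<sigma>) = (1 + c) * pi / \<sigma>" by (simp add: distrib_right add_divide_distrib)
    ultimately show ?thesis by (simp only: c_def)
  qed
  ultimately show ?thesis by simp
qed

lemma cdom_ge: "\<sigma> > 0 \<Longrightarrow> 1 / (\<sigma>\<^sup>2 + \<theta>\<^sup>2) \<le> cdom b C \<sigma> \<theta>"
  unfolding cdom_def by (auto intro!: sum_nonneg divide_nonneg_nonneg add_nonneg_nonneg)

lemma dnm_le_cdom:
  assumes "\<sigma> > 0" "k < C" "b k \<ge> 1" "\<bar>\<theta>\<bar> \<le> pi"
  shows "1 / dnm (b k) \<sigma> \<theta> \<le> cdom b C \<sigma> \<theta>"
proof -
  have "1 / dnm (b k) \<sigma> \<theta> \<le> (\<Sum>m\<in>{- int (b k)..int (b k)}. 4 * (1 / (\<sigma>\<^sup>2 + (\<theta> - 2 * pi * of_int m / real (b k))\<^sup>2)))"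
    using inverse_sin_square_le[of \<sigma> "b k" \<theta>] assms by (simp add: dnm_def)
  also have "\<dots> \<le> (\<Sum>k<C. \<Sum>m\<in>{- int (b k)..int (b k)}. 4 * (1 / (\<sigma>\<^sup>2 + (\<theta> - 2 * pi * of_int m / real (b k))\<^sup>2)))"
    using assms(2) by (intro member_le_sum[of k "{..<C}" "\<lambda>k. \<Sum>m\<in>{- int (b k)..int (b k)}. 4 * (1 / (\<sigma>\<^sup>2 + (\<theta> - 2 * pi * of_int m / real (b k))\<^sup>2))"])
       (auto intro!: sum_nonneg divide_nonneg_nonneg add_nonneg_nonneg)
  also have "\<dots> \<le> cdom b C \<sigma> \<theta>" unfolding cdom_def by (auto intro!: divide_nonneg_nonneg add_nonneg_nonneg)
  finally show ?thesis .
qed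

text \<open>The kernel with every sine replaced by its argument. It is homogeneous in \<sigma> and
  \<theta>, so its integral over the whole line is an exact power of \<sigma> times a
  constant.\<close>

definition model :: "(nat \<Rightarrow> nat) \<Rightarrow> nat \<Rightarrow> nat \<Rightarrow> real \<Rightarrow> real \<Rightarrow> real" where
  "model b C L \<sigma> \<theta> = 2 * real (L + 1) * \<theta>\<^sup>2 * (\<Prod>i<C. 1 / (\<sigma>\<^sup>2 + (real (b i) * \<theta>)\<^sup>2))"

text \<open>Each factor is at most w = 1 / (\<sigma>^2 + \<theta>^2). Of the \<open>C\<close> copies
  of w, two absorb \<theta>^4, \<open>C - 3\<close> absorb the powers of \<sigma>, and one is
  left.\<close>

lemma model_prod_le:
  assumes \<sigma>: "\<sigma> > 0" and C: "C \<ge> 3" and b: "\<And>i. i < C \<Longrightarrow> b i \<ge> 1"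
  shows "\<theta> ^ 4 * (\<Prod>i<C. 1 / (\<sigma>\<^sup>2 + (real (b i) * \<theta>)\<^sup>2)) * (\<sigma>\<^sup>2) ^ (C - 3) \<le> 1 / (\<sigma>\<^sup>2 + \<theta>\<^sup>2)"
proof -
  define w where "w = 1 / (\<sigma>\<^sup>2 + \<theta>\<^sup>2)"
  have pos: "\<sigma>\<^sup>2 + \<theta>\<^sup>2 > 0" using \<sigma> by (intro add_pos_nonneg) auto
  have w: "w \<ge> 0" "w * \<theta>\<^sup>2 \<le> 1" "w * \<sigma>\<^sup>2 \<le> 1" using pos by (auto simp: w_def divide_le_eq_1)
  have "1 / (\<sigma>\<^sup>2 + (real (b i) * \<theta>)\<^sup>2) \<le> w" if "i < C" for i
  proof -
    have "1 * \<theta>\<^sup>2 \<le> (real (b i))\<^sup>2 * \<theta>\<^sup>2" using b[OF that] by (intro mult_right_mono) (auto intro!: one_le_power)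
    then show ?thesis unfolding w_def using pos \<sigma> by (intro divide_left_mono) (auto simp: power_mult_distrib intro!: mult_pos_pos add_pos_nonneg)
  qed
  then have "(\<Prod>i<C. 1 / (\<sigma>\<^sup>2 + (real (b i) * \<theta>)\<^sup>2)) \<le> (\<Prod>i<C. w)"
    by (intro prod_mono) (auto intro!: divide_nonneg_nonneg add_nonneg_nonneg)
  then have "\<theta> ^ 4 * (\<Prod>i<C. 1 / (\<sigma>\<^sup>2 + (real (b i) * \<theta>)\<^sup>2)) * (\<sigma>\<^sup>2) ^ (C - 3) \<le> \<theta> ^ 4 * w ^ C * (\<sigma>\<^sup>2) ^ (C - 3)"
    by (intro mult_right_mono mult_left_mono) auto
  also have "\<dots> = w * (w * \<theta>\<^sup>2)\<^sup>2 * (w * \<sigma>\<^sup>2) ^ (C - 3)"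
  proof -
    obtain n where n: "C = 3 + n" using C le_Suc_ex by blast
    have "w ^ C = w ^ 3 * w ^ (C - 3)" by (simp add: n power_add)
    then show ?thesis by (simp add: power_mult_distrib power2_eq_square power3_eq_cube eval_nat_numeral mult_ac)
  qed
  also have "\<dots> \<le> w * 1 * 1"
    using w by (intro mult_mono power_le_one mult_nonneg_nonneg) auto
  finally show ?thesis by (simp add: w_def)
qed

text \<open>Where every b \<theta> is at most 1, numerator and denominators differ from those of the
  model by a relative error of order \<theta>^2. The gained factor turns \<theta>^2 into \<theta>^4,
  the case of \<open>model_prod_le\<close>.\<close>

lemma kern_near:
  assumes \<sigma>: "\<sigma> > 0" and C: "C \<ge> 3" and b: "\<And>i. i < C \<Longrightarrow> b i \<ge> 1 \<and> real (b i) \<le> B"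
    and \<theta>: "\<bar>\<theta>\<bar> * B \<le> 1"
  shows "\<bar>kern b C L \<sigma> \<theta> - model b C L \<sigma> \<theta>\<bar> * (\<sigma>\<^sup>2) ^ (C - 3)
    \<le> (real (L + 1) ^ 3 * 2 ^ C + 2 * real (L + 1) * (C * 2 ^ C * B\<^sup>2)) * cdom b C \<sigma> \<theta>"
proof -
  define n where "n = real (L + 1)"
  define P where "P = (\<Prod>i<C. 1 / (\<sigma>\<^sup>2 + (real (b i) * \<theta>)\<^sup>2))"
  \<comment> \<open>Quotient of the true factor by the model factor, so that the product of the
    \<open>r i\<close> measures the deviation.\<close>
  define r where "r i = (\<sigma>\<^sup>2 + (real (b i) * \<theta>)\<^sup>2) / dnm (b i) \<sigma> \<theta>" for i
  have r: "0 \<le> r i \<and> r i \<le> 2 \<and> \<bar>r i - 1\<bar> \<le> B\<^sup>2 * \<theta>\<^sup>2" if "i \<in> {..<C}" for i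
  proof -
    define x where "x = real (b i) * \<theta>"
    define q where "q = 4 * (sin (x / 2))\<^sup>2"
    have bi: "b i \<ge> 1" "real (b i) \<le> B" using b that by auto
    have "\<bar>x\<bar> = \<bar>\<theta>\<bar> * real (b i)" by (simp add: x_def abs_mult)
    then have "\<bar>x\<bar> \<le> \<bar>\<theta>\<bar> * B" using bi by (simp add: mult_left_mono)
    then have x1: "\<bar>x\<bar> \<le> 1" using \<theta> by linarith
    have q: "\<bar>q - x\<^sup>2\<bar> \<le> x ^ 4 / 12" unfolding q_def by (rule four_sin_half_square)
    have x4: "x ^ 4 = x\<^sup>2 * x\<^sup>2" by (simp add: power2_eq_square eval_nat_numeral)
    have "x\<^sup>2 \<le> 1" using x1 by (simp add: abs_square_le_1)
    then have "x ^ 4 \<le> x\<^sup>2 * 1" unfolding x4 by (intro mult_left_mono) auto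
    \<comment> \<open>For |x| \<le> 1 the error x^4 / 12 is at most x^2 / 12.\<close>
    then have q2: "11 / 12 * x\<^sup>2 \<le> q" using q by linarith
    have A: "dnm (b i) \<sigma> \<theta> = \<sigma>\<^sup>2 + q" by (simp add: dnm_def q_def x_def)
    have pos: "\<sigma>\<^sup>2 + q > 0" using dnm_pos(1)[OF \<sigma>, of "b i" \<theta>] A by simp
    have s2: "\<sigma>\<^sup>2 \<ge> 0" "x\<^sup>2 \<ge> 0" by auto
    have 1: "0 \<le> r i" unfolding r_def A using pos by (intro divide_nonneg_pos) auto
    have "\<sigma>\<^sup>2 + x\<^sup>2 \<le> 2 * (\<sigma>\<^sup>2 + q)" using q2 s2 by argo
    then have 2: "r i \<le> 2" unfolding r_def A x_def[symmetric] using pos by (simp add: divide_le_eq)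
    have "x ^ 4 / 12 = x\<^sup>2 * (1 / 12 * x\<^sup>2)" unfolding x4 by simp
    also have "\<dots> \<le> x\<^sup>2 * (11 / 12 * x\<^sup>2)" by (intro mult_left_mono) auto
    also have "\<dots> \<le> x\<^sup>2 * (\<sigma>\<^sup>2 + q)" using q2 s2 by (intro mult_left_mono) linarith+
    finally have "\<bar>x\<^sup>2 - q\<bar> \<le> x\<^sup>2 * (\<sigma>\<^sup>2 + q)" using q by linarith
    moreover have "r i - 1 = (x\<^sup>2 - q) / (\<sigma>\<^sup>2 + q)" unfolding r_def A x_def[symmetric] using pos by (simp add: field_simps)
    ultimately have "\<bar>r i - 1\<bar> \<le> x\<^sup>2" using pos by (simp add: abs_divide divide_le_eq)
    also have "x\<^sup>2 \<le> B\<^sup>2 * \<theta>\<^sup>2" unfolding x_def power_mult_distrib using bi by (intro mult_right_mono power_mono) auto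
    finally show ?thesis using 1 2 by blast
  qed
  have pr: "\<bar>prod r {..<C} - 1\<bar> \<le> real C * 2 ^ C * (B\<^sup>2 * \<theta>\<^sup>2)" "0 \<le> prod r {..<C}" "prod r {..<C} \<le> 2 ^ C"
    using abs_prod_minus_one_le[of "{..<C}" r "B\<^sup>2 * \<theta>\<^sup>2"] r by auto
  have P0: "P \<ge> 0" unfolding P_def by (intro prod_nonneg) (auto intro!: divide_nonneg_nonneg add_nonneg_nonneg)
  have eq: "(\<Prod>i<C. 1 / dnm (b i) \<sigma> \<theta>) = P * prod r {..<C}"
    unfolding P_def r_def prod.distrib[symmetric]
  proof (rule prod.cong)
    fix i
    define A where "A = \<sigma>\<^sup>2 + (real (b i) * \<theta>)\<^sup>2"
    have "A > 0" unfolding A_def using \<sigma> by (intro add_pos_nonneg) auto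
    then show "1 / dnm (b i) \<sigma> \<theta> = 1 / (\<sigma>\<^sup>2 + (real (b i) * \<theta>)\<^sup>2) * ((\<sigma>\<^sup>2 + (real (b i) * \<theta>)\<^sup>2) / dnm (b i) \<sigma> \<theta>)"
      unfolding A_def[symmetric] by simp
  qed simp
  have "kern b C L \<sigma> \<theta> - model b C L \<sigma> \<theta> = P * ((numer L \<theta> - 2 * n * \<theta>\<^sup>2) * prod r {..<C} + 2 * n * \<theta>\<^sup>2 * (prod r {..<C} - 1))"
    unfolding kern_def model_def eq P_def[symmetric] n_def[symmetric] by (simp add: algebra_simps)
  then have "\<bar>kern b C L \<sigma> \<theta> - model b C L \<sigma> \<theta>\<bar> = P * \<bar>(numer L \<theta> - 2 * n * \<theta>\<^sup>2) * prod r {..<C} + 2 * n * \<theta>\<^sup>2 * (prod r {..<C} - 1)\<bar>"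
    using P0 by (simp add: abs_mult)
  also have "\<dots> \<le> P * (\<bar>numer L \<theta> - 2 * n * \<theta>\<^sup>2\<bar> * prod r {..<C} + 2 * n * \<theta>\<^sup>2 * \<bar>prod r {..<C} - 1\<bar>)"
    using P0 pr by (intro mult_left_mono order.trans[OF abs_triangle_ineq]) (auto simp: abs_mult n_def)
  also have "\<dots> \<le> P * ((n ^ 3 * \<theta> ^ 4) * 2 ^ C + 2 * n * \<theta>\<^sup>2 * (C * 2 ^ C * (B\<^sup>2 * \<theta>\<^sup>2)))"
    using P0 pr numer_approx[of L \<theta>] by (intro mult_left_mono add_mono mult_mono) (auto simp: n_def)
  also have "\<dots> = (n ^ 3 * 2 ^ C + 2 * n * (C * 2 ^ C * B\<^sup>2)) * (\<theta> ^ 4 * P)"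
    by (simp add: algebra_simps power2_eq_square eval_nat_numeral)
  finally have le: "\<bar>kern b C L \<sigma> \<theta> - model b C L \<sigma> \<theta>\<bar> \<le> (n ^ 3 * 2 ^ C + 2 * n * (C * 2 ^ C * B\<^sup>2)) * (\<theta> ^ 4 * P)" .
  have "\<bar>kern b C L \<sigma> \<theta> - model b C L \<sigma> \<theta>\<bar> * (\<sigma>\<^sup>2) ^ (C - 3) \<le> (n ^ 3 * 2 ^ C + 2 * n * (C * 2 ^ C * B\<^sup>2)) * (\<theta> ^ 4 * P) * (\<sigma>\<^sup>2) ^ (C - 3)"
    using le by (rule mult_right_mono) simp
  also have "\<dots> = (n ^ 3 * 2 ^ C + 2 * n * (C * 2 ^ C * B\<^sup>2)) * (\<theta> ^ 4 * P * (\<sigma>\<^sup>2) ^ (C - 3))" by (simp only: mult.assoc)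
  also have "\<dots> \<le> (n ^ 3 * 2 ^ C + 2 * n * (C * 2 ^ C * B\<^sup>2)) * cdom b C \<sigma> \<theta>"
    using order.trans[OF model_prod_le[OF \<sigma> C] cdom_ge[OF \<sigma>]] b unfolding P_def
    by (intro mult_left_mono) (auto simp: n_def)
  finally show ?thesis by (simp add: n_def)
qed

text \<open>Away from zero \<theta>^2 is at most \<theta>^4 / \<delta>^2, so the extra factor
  \<theta>^2 that Taylor expansion supplies near zero comes for free.\<close>

lemma model_far:
  assumes \<sigma>: "\<sigma> > 0" and C: "C \<ge> 3" and b: "\<And>i. i < C \<Longrightarrow> b i \<ge> 1" and \<delta>: "\<delta> > 0" "\<bar>\<theta>\<bar> \<ge> \<delta>"
  shows "\<bar>model b C L \<sigma> \<theta>\<bar> * (\<sigma>\<^sup>2) ^ (C - 3) \<le> 2 * real (L + 1) / \<delta>\<^sup>2 * cdom b C \<sigma> \<theta>"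
proof -
  define P where "P = (\<Prod>i<C. 1 / (\<sigma>\<^sup>2 + (real (b i) * \<theta>)\<^sup>2))"
  have P0: "P \<ge> 0" unfolding P_def by (intro prod_nonneg) (auto intro!: divide_nonneg_nonneg add_nonneg_nonneg)
  have "\<delta>\<^sup>2 \<le> \<theta>\<^sup>2" using \<delta> by (intro abs_le_square_iff[THEN iffD1]) auto
  then have "\<theta>\<^sup>2 * \<delta>\<^sup>2 \<le> \<theta>\<^sup>2 * \<theta>\<^sup>2" by (intro mult_left_mono) auto
  then have t: "\<theta>\<^sup>2 \<le> \<theta> ^ 4 / \<delta>\<^sup>2" using \<delta> by (simp add: pos_le_divide_eq power2_eq_square eval_nat_numeral)
  have "\<bar>model b C L \<sigma> \<theta>\<bar> * (\<sigma>\<^sup>2) ^ (C - 3) = 2 * real (L + 1) * \<theta>\<^sup>2 * (P * (\<sigma>\<^sup>2) ^ (C - 3))"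
    unfolding model_def P_def[symmetric] using P0 by (simp add: abs_mult)
  also have "\<dots> \<le> 2 * real (L + 1) * (\<theta> ^ 4 / \<delta>\<^sup>2) * (P * (\<sigma>\<^sup>2) ^ (C - 3))"
    using t P0 by (intro mult_right_mono mult_left_mono) auto
  also have "\<dots> = 2 * real (L + 1) / \<delta>\<^sup>2 * (\<theta> ^ 4 * P * (\<sigma>\<^sup>2) ^ (C - 3))" by simp
  also have "\<dots> \<le> 2 * real (L + 1) / \<delta>\<^sup>2 * cdom b C \<sigma> \<theta>"
    using order.trans[OF model_prod_le[OF \<sigma> C b] cdom_ge[OF \<sigma>]] unfolding P_def
    by (intro mult_left_mono) auto
  finally show ?thesis .
qed

text \<open>The hypothesis on \<open>K\<close> trades sin^2 \<theta> for products of two squared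
  sines, and these cancel two denominators. Of the remaining \<open>C - 2\<close> one is kept and
  the others cost \<sigma>^(-2) each.\<close>

lemma kern_far:
  assumes \<sigma>: "\<sigma> > 0" and C: "C \<ge> 3" and b: "\<And>i. i < C \<Longrightarrow> b i \<ge> 1" and \<theta>: "\<bar>\<theta>\<bar> \<le> pi"
    and K: "(sin \<theta>)\<^sup>2 \<le> K * paircover b C \<theta>" "K \<ge> 0"
  shows "\<bar>kern b C L \<sigma> \<theta>\<bar> * (\<sigma>\<^sup>2) ^ (C - 3) \<le> 2 * real (L + 1) * K * (real C * real C) * cdom b C \<sigma> \<theta>"
proof -
  define p where "p i = 1 / dnm (b i) \<sigma> \<theta>" for i
  define S where "S i = (sin (real (b i) * \<theta> / 2))\<^sup>2" for i
  have p: "0 \<le> p i" "p i * \<sigma>\<^sup>2 \<le> 1" "S i * p i \<le> 1" "0 \<le> S i" for i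
    using dnm_pos[OF \<sigma>, of "b i" \<theta>] \<sigma> by (auto simp: p_def S_def dnm_def divide_le_eq_1)
  have cd: "cdom b C \<sigma> \<theta> \<ge> 0" using cdom_ge[OF \<sigma>] by (rule order.trans[rotated]) (auto intro!: divide_nonneg_nonneg)
  have pair: "S i * S j * prod p {..<C} * (\<sigma>\<^sup>2) ^ (C - 3) \<le> cdom b C \<sigma> \<theta>" if ij: "i < C" "j \<in> {..<C} - {i}" for i j
  proof -
    define T where "T = {..<C} - {i} - {j}"
    have card: "card T = C - 2" using ij by (simp add: T_def)
    \<comment> \<open>Here \<open>C \<ge> 3\<close> leaves at least one factor to be
      integrated.\<close>
    then have "card T - 1 = C - 3" "T \<noteq> {}" using C by auto
    then obtain k where k: "k \<in> T" by auto
    have "prod p {..<C} = p i * (p j * prod p T)"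
      using ij unfolding T_def by (subst prod.remove[of _ i], simp, simp, subst prod.remove[of _ j]) auto
    then have "S i * S j * prod p {..<C} * (\<sigma>\<^sup>2) ^ (C - 3) = (S i * p i) * (S j * p j) * (prod p T * (\<sigma>\<^sup>2) ^ (card T - 1))"
      using \<open>card T - 1 = C - 3\<close> by (simp add: mult_ac)
    also have "\<dots> \<le> 1 * 1 * p k"
    proof (intro mult_mono)
      show "prod p T * (\<sigma>\<^sup>2) ^ (card T - 1) \<le> p k"
        by (rule prod_le_single) (use k \<sigma> p in \<open>auto simp: T_def\<close>)
    qed (use p in \<open>auto intro!: mult_nonneg_nonneg prod_nonneg\<close>)
    also have "p k \<le> cdom b C \<sigma> \<theta>"
      unfolding p_def using k b by (intro dnm_le_cdom \<sigma> \<theta>) (auto simp: T_def)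
    finally show ?thesis by simp
  qed
  have P0: "prod p {..<C} \<ge> 0" by (intro prod_nonneg) (auto simp: p)
  have "\<bar>kern b C L \<sigma> \<theta>\<bar> = \<bar>numer L \<theta>\<bar> * prod p {..<C}"
    unfolding kern_def p_def[symmetric] using P0 by (simp add: abs_mult)
  also have "\<dots> \<le> 2 * real (L + 1) * (K * paircover b C \<theta>) * prod p {..<C}"
    using K P0 by (intro mult_right_mono order.trans[OF abs_numer_le] mult_left_mono) auto
  finally have "\<bar>kern b C L \<sigma> \<theta>\<bar> * (\<sigma>\<^sup>2) ^ (C - 3) \<le> 2 * real (L + 1) * (K * paircover b C \<theta>) * prod p {..<C} * (\<sigma>\<^sup>2) ^ (C - 3)"
    by (rule mult_right_mono) simp
  also have "\<dots> = 2 * real (L + 1) * K * (paircover b C \<theta> * prod p {..<C} * (\<sigma>\<^sup>2) ^ (C - 3))" by (simp only: mult_ac)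
  also have "paircover b C \<theta> * prod p {..<C} * (\<sigma>\<^sup>2) ^ (C - 3) = (\<Sum>i<C. \<Sum>j\<in>{..<C} - {i}. S i * S j * prod p {..<C} * (\<sigma>\<^sup>2) ^ (C - 3))"
    by (simp add: paircover_def S_def sum_distrib_right)
  also have "2 * real (L + 1) * K * \<dots> \<le> 2 * real (L + 1) * K * (\<Sum>i<C. \<Sum>j\<in>{..<C} - {i}. cdom b C \<sigma> \<theta>)"
    using K by (intro mult_left_mono sum_mono pair) auto
  also have "\<dots> \<le> 2 * real (L + 1) * K * (\<Sum>i<C. \<Sum>j\<in>{..<C}. cdom b C \<sigma> \<theta>)"
    using K cd by (intro mult_left_mono sum_mono sum_mono2) auto
  also have "\<dots> = 2 * real (L + 1) * K * (real C * real C) * cdom b C \<sigma> \<theta>" by simp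
  finally show ?thesis .
qed

text \<open>Substitute \<theta> = \<sigma> x: the differential and \<theta>^2 give \<sigma>^3, the
  denominators \<sigma>^(-2 C).\<close>

lemma has_integral_model:
  assumes \<sigma>: "\<sigma> > 0" and C: "C \<ge> 3" and b: "\<And>i. i < C \<Longrightarrow> b i \<ge> 1"
  shows "integrable lborel (model b C L \<sigma>)"
    and "\<sigma> ^ (2 * C - 3) * integral\<^sup>L lborel (model b C L \<sigma>) = 2 * real (L + 1) * Jint (\<lambda>i. real (b i)) C"
proof -
  let ?a = "\<lambda>i. real (b i)"
  have scale: "model b C L \<sigma> (0 + \<sigma> * x) * \<sigma> ^ (2 * C) = 2 * real (L + 1) * \<sigma>\<^sup>2 * cauchy_prod ?a C x" for x
  proof -
    have "\<sigma>\<^sup>2 + (?a i * (\<sigma> * x))\<^sup>2 = \<sigma>\<^sup>2 * (1 + (?a i)\<^sup>2 * x\<^sup>2)" for i by (simp add: power_mult_distrib algebra_simps)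
    then have "(\<Prod>i<C. 1 / (\<sigma>\<^sup>2 + (?a i * (\<sigma> * x))\<^sup>2)) = (\<Prod>i<C. (1 / \<sigma>\<^sup>2) * (1 / (1 + (?a i)\<^sup>2 * x\<^sup>2)))" by simp
    also have "\<dots> = (1 / \<sigma>\<^sup>2) ^ C * (\<Prod>i<C. 1 / (1 + (?a i)\<^sup>2 * x\<^sup>2))" by (subst prod.distrib) simp
    also have "(1 / \<sigma>\<^sup>2) ^ C = 1 / \<sigma> ^ (2 * C)" by (simp add: power_divide power_mult)
    finally show ?thesis using \<sigma> by (simp add: model_def cauchy_prod_def power_mult_distrib)
  qed
  have scale': "model b C L \<sigma> (0 + \<sigma> * x) = (2 * real (L + 1) * \<sigma>\<^sup>2 / \<sigma> ^ (2 * C)) * cauchy_prod ?a C x" for x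
    using scale[of x] \<sigma> by (simp add: field_simps)
  have int: "integrable lborel (cauchy_prod ?a C)" using C b by (intro integrable_cauchy_prod) auto
  have "integrable lborel (\<lambda>x. model b C L \<sigma> (0 + \<sigma> * x))" unfolding scale' by (intro integrable_mult_right int)
  then show "integrable lborel (model b C L \<sigma>)" using \<sigma> by (subst (asm) lborel_integrable_real_affine_iff) auto
  have "integral\<^sup>L lborel (model b C L \<sigma>) = \<bar>\<sigma>\<bar> *\<^sub>R (\<integral>x. model b C L \<sigma> (0 + \<sigma> * x) \<partial>lborel)"
    using \<sigma> by (intro lborel_integral_real_affine) simp
  also have "\<dots> = \<sigma> * ((2 * real (L + 1) * \<sigma>\<^sup>2 / \<sigma> ^ (2 * C)) * Jint ?a C)"
    unfolding scale' Jint_def using \<sigma> by simp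
  finally have I: "integral\<^sup>L lborel (model b C L \<sigma>) = \<sigma> * ((2 * real (L + 1) * \<sigma>\<^sup>2 / \<sigma> ^ (2 * C)) * Jint ?a C)" .
  have "\<sigma> ^ (2 * C) = \<sigma> ^ (2 * C - 3) * \<sigma> ^ 3" using C by (simp add: power_add[symmetric])
  then show "\<sigma> ^ (2 * C - 3) * integral\<^sup>L lborel (model b C L \<sigma>) = 2 * real (L + 1) * Jint ?a C"
    unfolding I using \<sigma> by (simp add: field_simps eval_nat_numeral)
qed

text \<open>The kernel, cut off at \<open>R\<close>, is compared with the model on the whole line,
  and every discrepancy is charged to \<open>cdom\<close>. The radius is left open because \<pi> is
  a second peak when all frequencies are even; then half of the circle is treated.\<close>

lemma kern_asymp:
  assumes C: "C \<ge> 3" and b: "\<And>i. i < C \<Longrightarrow> b i \<ge> 1" and R: "0 < R" "R \<le> pi"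
    and far: "\<And>\<delta>. \<delta> > 0 \<Longrightarrow> \<exists>K\<ge>0. \<forall>\<theta>. \<delta> \<le> \<bar>\<theta>\<bar> \<and> \<bar>\<theta>\<bar> \<le> R \<longrightarrow> (sin \<theta>)\<^sup>2 \<le> K * paircover b C \<theta>"
  shows "\<exists>M. \<forall>\<sigma>>0. \<bar>\<sigma> ^ (2 * C - 3) * integral {-R..R} (kern b C L \<sigma>) - 2 * real (L + 1) * Jint (\<lambda>i. real (b i)) C\<bar> \<le> M * \<sigma>\<^sup>2"
proof -
  define B where "B = (\<Sum>i<C. real (b i)) + 1"
  have B: "B > 0" by (simp add: B_def sum_nonneg add_nonneg_pos)
  have bB: "b i \<ge> 1 \<and> real (b i) \<le> B" if "i < C" for i
  proof -
    have "real (b i) \<le> (\<Sum>i<C. real (b i))" using that by (intro member_le_sum) auto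
    then show ?thesis using b[OF that] by (simp add: B_def)
  qed
  \<comment> \<open>Below 1 / B all products b \<theta> are at most 1, as \<open>kern_near\<close>
    requires.\<close>
  define \<delta> where "\<delta> = min (1 / B) R"
  have \<delta>: "\<delta> > 0" using B R by (simp add: \<delta>_def)
  obtain K where K: "K \<ge> 0" "\<And>\<theta>. \<delta> \<le> \<bar>\<theta>\<bar> \<Longrightarrow> \<bar>\<theta>\<bar> \<le> R \<Longrightarrow> (sin \<theta>)\<^sup>2 \<le> K * paircover b C \<theta>"
    using far[OF \<delta>] by blast
  define K1 where "K1 = real (L + 1) ^ 3 * 2 ^ C + 2 * real (L + 1) * (C * 2 ^ C * B\<^sup>2)"
  define K2 where "K2 = 2 * real (L + 1) / \<delta>\<^sup>2"
  define K3 where "K3 = 2 * real (L + 1) * K * (real C * real C)"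
  define M0 where "M0 = K1 + K2 + K3"
  have K0: "K1 \<ge> 0" "K2 \<ge> 0" "K3 \<ge> 0" using K(1) by (auto simp: K1_def K2_def K3_def)
  define Z where "Z = (1 + (\<Sum>k<C. \<Sum>m\<in>{- int (b k)..int (b k)}. 4)) * pi"
  show ?thesis
  proof (intro exI[of _ "M0 * Z"] allI impI)
    fix \<sigma> :: real assume \<sigma>: "\<sigma> > 0"
    define G where "G \<theta> = indicator {-R..R} \<theta> *\<^sub>R kern b C L \<sigma> \<theta>" for \<theta>
    define s where "s = (\<sigma>\<^sup>2) ^ (C - 3)"
    have s: "s > 0" using \<sigma> by (simp add: s_def)
    have cd: "cdom b C \<sigma> \<theta> \<ge> 0" for \<theta> using cdom_ge[OF \<sigma>] by (rule order.trans[rotated]) (auto intro!: divide_nonneg_nonneg)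
    have pt: "norm (G \<theta> - model b C L \<sigma> \<theta>) \<le> M0 / s * cdom b C \<sigma> \<theta>" for \<theta>
    proof -
      have "\<bar>G \<theta> - model b C L \<sigma> \<theta>\<bar> * s \<le> M0 * cdom b C \<sigma> \<theta>"
      proof (cases "\<bar>\<theta>\<bar> < \<delta>")
        case True
        then have "\<bar>\<theta>\<bar> \<le> R" by (simp add: \<delta>_def)
        then have "G \<theta> = kern b C L \<sigma> \<theta>" by (simp add: G_def indicator_def abs_le_iff)
        moreover have "\<bar>\<theta>\<bar> * B \<le> 1" using True B by (simp add: \<delta>_def less_divide_eq)
        ultimately have "\<bar>G \<theta> - model b C L \<sigma> \<theta>\<bar> * s \<le> K1 * cdom b C \<sigma> \<theta>"
          unfolding s_def K1_def using kern_near[OF \<sigma> C bB] by simp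
        also have "\<dots> \<le> M0 * cdom b C \<sigma> \<theta>" using K0 cd by (intro mult_right_mono) (auto simp: M0_def)
        finally show ?thesis .
      next
        case False
        then have \<theta>: "\<delta> \<le> \<bar>\<theta>\<bar>" by simp
        have "\<bar>model b C L \<sigma> \<theta>\<bar> * s \<le> K2 * cdom b C \<sigma> \<theta>"
          unfolding s_def K2_def by (rule model_far[OF \<sigma> C b \<delta> \<theta>])
        moreover have "\<bar>G \<theta>\<bar> * s \<le> K3 * cdom b C \<sigma> \<theta>"
        proof (cases "\<bar>\<theta>\<bar> \<le> R")
          case True
          then have "G \<theta> = kern b C L \<sigma> \<theta>" by (simp add: G_def indicator_def abs_le_iff)
          then show ?thesis unfolding s_def K3_def
            using kern_far[OF \<sigma> C b _ K(2)[OF \<theta> True] K(1)] True R by simp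
        next
          case False
          then have "G \<theta> = 0" by (auto simp: G_def indicator_def abs_le_iff)
          then show ?thesis using K0 cd by simp
        qed
        ultimately have "(\<bar>G \<theta>\<bar> + \<bar>model b C L \<sigma> \<theta>\<bar>) * s \<le> (K2 + K3) * cdom b C \<sigma> \<theta>"
          by (simp add: algebra_simps)
        moreover have "\<bar>G \<theta> - model b C L \<sigma> \<theta>\<bar> * s \<le> (\<bar>G \<theta>\<bar> + \<bar>model b C L \<sigma> \<theta>\<bar>) * s"
          using s by (intro mult_right_mono) auto
        moreover have "(K2 + K3) * cdom b C \<sigma> \<theta> \<le> M0 * cdom b C \<sigma> \<theta>"
          using K0 cd by (intro mult_right_mono) (auto simp: M0_def)
        ultimately show ?thesis by linarith
      qed
      then show ?thesis using s by (simp add: field_simps)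
    qed
    have intG: "integrable lborel G"
      unfolding G_def by (intro borel_integrable_compact continuous_kern \<sigma>) auto
    have "integral\<^sup>L lborel G = integral {-R..R} (kern b C L \<sigma>)"
      using set_borel_integral_eq_integral(2)[of "{-R..R}" "kern b C L \<sigma>"] intG
      by (simp add: G_def[abs_def] set_integrable_def set_lebesgue_integral_def)
    moreover have "\<sigma> ^ (2 * C - 3) * integral\<^sup>L lborel (model b C L \<sigma>) = 2 * real (L + 1) * Jint (\<lambda>i. real (b i)) C"
      by (rule has_integral_model[OF \<sigma> C b])
    ultimately have "\<bar>\<sigma> ^ (2 * C - 3) * integral {-R..R} (kern b C L \<sigma>) - 2 * real (L + 1) * Jint (\<lambda>i. real (b i)) C\<bar>
       = \<bar>\<sigma> ^ (2 * C - 3) * (integral\<^sup>L lborel G - integral\<^sup>L lborel (model b C L \<sigma>))\<bar>"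
      by (simp add: right_diff_distrib)
    also have "\<dots> = \<sigma> ^ (2 * C - 3) * \<bar>\<integral>\<theta>. G \<theta> - model b C L \<sigma> \<theta> \<partial>lborel\<bar>"
      using \<sigma> intG has_integral_model(1)[OF \<sigma> C b] by (simp add: abs_mult)
    also have "\<dots> \<le> \<sigma> ^ (2 * C - 3) * (\<integral>\<theta>. M0 / s * cdom b C \<sigma> \<theta> \<partial>lborel)"
    proof (rule mult_left_mono)
      show "\<bar>\<integral>\<theta>. G \<theta> - model b C L \<sigma> \<theta> \<partial>lborel\<bar> \<le> (\<integral>\<theta>. M0 / s * cdom b C \<sigma> \<theta> \<partial>lborel)"
        using intG has_integral_model(1)[OF \<sigma> C b] integrable.intros[OF has_bochner_integral_cdom[OF \<sigma>]] pt
        by (intro integral_abs_bound_integral integrable_mult_right Bochner_Integration.integrable_diff) (auto simp: has_bochner_integral_iff)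
    qed (use \<sigma> in simp)
    also have "(\<integral>\<theta>. M0 / s * cdom b C \<sigma> \<theta> \<partial>lborel) = M0 / s * (Z / \<sigma>)"
      using has_bochner_integral_integral_eq[OF has_bochner_integral_cdom[OF \<sigma>, of b C]] by (simp add: Z_def)
    also have "\<sigma> ^ (2 * C - 3) * (M0 / s * (Z / \<sigma>)) = M0 * Z * \<sigma>\<^sup>2"
    proof -
      have "2 * C - 3 = 2 * (C - 3) + 3" using C by simp
      then have "\<sigma> ^ (2 * C - 3) = s * \<sigma> ^ 3" by (simp only: power_add power_mult s_def)
      then show ?thesis using s \<sigma> by (simp add: field_simps eval_nat_numeral)
    qed
    finally show "\<bar>\<sigma> ^ (2 * C - 3) * integral {-R..R} (kern b C L \<sigma>) - 2 * real (L + 1) * Jint (\<lambda>i. real (b i)) C\<bar> \<le> M0 * Z * \<sigma>\<^sup>2" .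
  qed
qed

text \<open>On a compact set the positive continuous function \<open>paircover\<close> has a
  positive minimum, whose reciprocal is the constant, since sin^2 is at most 1.\<close>

lemma far_compact:
  fixes T :: "real set"
  assumes T: "compact T"
    and two: "\<And>\<theta>. \<theta> \<in> T \<Longrightarrow> \<exists>i<C. \<exists>j<C. i \<noteq> j \<and> sin (real (b i) * \<theta> / 2) \<noteq> 0 \<and> sin (real (b j) * \<theta> / 2) \<noteq> 0"
  shows "\<exists>K\<ge>0. \<forall>\<theta>\<in>T. (sin \<theta>)\<^sup>2 \<le> K * paircover b C \<theta>"
proof (cases "T = {}")
  case False
  have cont: "continuous_on T (paircover b C)"
    unfolding paircover_def by (intro continuous_intros) auto
  obtain x where x: "x \<in> T" "\<And>y. y \<in> T \<Longrightarrow> paircover b C x \<le> paircover b C y"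
    using continuous_attains_inf[OF T False cont] by blast
  obtain i j where ij: "i < C" "j < C" "i \<noteq> j" "sin (real (b i) * x / 2) \<noteq> 0" "sin (real (b j) * x / 2) \<noteq> 0"
    using two[OF x(1)] by blast
  have "0 < (sin (real (b i) * x / 2))\<^sup>2 * (sin (real (b j) * x / 2))\<^sup>2" using ij by simp
  also have "\<dots> \<le> (\<Sum>j\<in>{..<C} - {i}. (sin (real (b i) * x / 2))\<^sup>2 * (sin (real (b j) * x / 2))\<^sup>2)"
    using ij by (intro member_le_sum[of j _ "\<lambda>j. (sin (real (b i) * x / 2))\<^sup>2 * (sin (real (b j) * x / 2))\<^sup>2"]) auto
  also have "\<dots> \<le> paircover b C x" unfolding paircover_def
    using ij by (intro member_le_sum[of i _ "\<lambda>i. \<Sum>j\<in>{..<C} - {i}. (sin (real (b i) * x / 2))\<^sup>2 * (sin (real (b j) * x / 2))\<^sup>2"]) (auto intro!: sum_nonneg)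
  finally have pos: "paircover b C x > 0" .
  have "(sin \<theta>)\<^sup>2 \<le> 1 / paircover b C x * paircover b C \<theta>" if "\<theta> \<in> T" for \<theta>
  proof -
    have "1 \<le> 1 / paircover b C x * paircover b C \<theta>" using x(2)[OF that] pos by (simp add: le_divide_eq)
    then show ?thesis using abs_square_le_1[of "sin \<theta>"] by (meson abs_sin_le_one order.trans)
  qed
  then show ?thesis using pos by (intro exI[of _ "1 / paircover b C x"]) auto
qed (auto intro: exI[of _ 0])

lemma paircover_ge:
  assumes "i < C" "j < C" "i \<noteq> j"
  shows "(sin (real (b i) * x / 2))\<^sup>2 * (sin (real (b j) * x / 2))\<^sup>2 \<le> paircover b C x"
proof -
  have "(sin (real (b i) * x / 2))\<^sup>2 * (sin (real (b j) * x / 2))\<^sup>2 \<le> (\<Sum>j\<in>{..<C} - {i}. (sin (real (b i) * x / 2))\<^sup>2 * (sin (real (b j) * x / 2))\<^sup>2)"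
    using assms by (intro member_le_sum[of j _ "\<lambda>j. (sin (real (b i) * x / 2))\<^sup>2 * (sin (real (b j) * x / 2))\<^sup>2"]) auto
  also have "\<dots> \<le> paircover b C x" unfolding paircover_def
    using assms by (intro member_le_sum[of i _ "\<lambda>i. \<Sum>j\<in>{..<C} - {i}. (sin (real (b i) * x / 2))\<^sup>2 * (sin (real (b j) * x / 2))\<^sup>2"]) (auto intro!: sum_nonneg)
  finally show ?thesis .
qed

text \<open>The angle \<pi> is left out because there the sine of every even frequency vanishes; it
  is handled by \<open>far_outer\<close> or by periodicity.\<close>

definition separated :: "(nat \<Rightarrow> nat) \<Rightarrow> nat \<Rightarrow> bool" where
  "separated b C \<longleftrightarrow> (\<forall>\<theta>. 0 < \<theta> \<and> \<theta> < pi \<longrightarrow>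
     (\<exists>i<C. \<exists>j<C. i \<noteq> j \<and> sin (real (b i) * \<theta> / 2) \<noteq> 0 \<and> sin (real (b j) * \<theta> / 2) \<noteq> 0))"

lemma separatedD:
  assumes "separated b C" "\<theta> \<noteq> 0" "\<bar>\<theta>\<bar> < pi"
  shows "\<exists>i<C. \<exists>j<C. i \<noteq> j \<and> sin (real (b i) * \<theta> / 2) \<noteq> 0 \<and> sin (real (b j) * \<theta> / 2) \<noteq> 0"
proof -
  have "\<exists>i<C. \<exists>j<C. i \<noteq> j \<and> sin (real (b i) * \<bar>\<theta>\<bar> / 2) \<noteq> 0 \<and> sin (real (b j) * \<bar>\<theta>\<bar> / 2) \<noteq> 0"
    using assms unfolding separated_def by simp
  moreover have "sin (real n * \<bar>\<theta>\<bar> / 2) \<noteq> 0 \<longleftrightarrow> sin (real n * \<theta> / 2) \<noteq> 0" for n by (simp add: abs_if)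
  ultimately show ?thesis by simp
qed

lemma compact_annulus: "compact {\<theta>::real. \<delta> \<le> \<bar>\<theta>\<bar> \<and> \<bar>\<theta>\<bar> \<le> R}"
proof -
  have "{\<theta>::real. \<delta> \<le> \<bar>\<theta>\<bar> \<and> \<bar>\<theta>\<bar> \<le> R} = {-R..R} \<inter> {\<theta>. \<delta> \<le> \<bar>\<theta>\<bar>}" by (auto simp: abs_le_iff)
  moreover have "closed {\<theta>::real. \<delta> \<le> \<bar>\<theta>\<bar>}" by (intro closed_Collect_le continuous_intros)
  ultimately show ?thesis by (simp add: compact_Int_closed)
qed

lemma far_inner:
  assumes "separated b C" "R < pi" "\<delta> > 0"
  shows "\<exists>K\<ge>0. \<forall>\<theta>. \<delta> \<le> \<bar>\<theta>\<bar> \<and> \<bar>\<theta>\<bar> \<le> R \<longrightarrow> (sin \<theta>)\<^sup>2 \<le> K * paircover b C \<theta>"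
proof -
  have "\<exists>K\<ge>0. \<forall>\<theta>\<in>{\<theta>. \<delta> \<le> \<bar>\<theta>\<bar> \<and> \<bar>\<theta>\<bar> \<le> R}. (sin \<theta>)\<^sup>2 \<le> K * paircover b C \<theta>"
    by (rule far_compact[OF compact_annulus]) (use assms in \<open>auto intro!: separatedD\<close>)
  then show ?thesis by auto
qed

text \<open>Near \<open>\<pi>\<close> an odd frequency stays away from zero and any other one vanishes at most linearly.\<close>

lemma far_outer:
  assumes sep: "separated b C" and C: "C \<ge> 2" and b: "\<And>i. i < C \<Longrightarrow> b i \<ge> 1" and odd: "i0 < C" "odd (b i0)" and \<delta>: "\<delta> > 0"
  shows "\<exists>K\<ge>0. \<forall>\<theta>. \<delta> \<le> \<bar>\<theta>\<bar> \<and> \<bar>\<theta>\<bar> \<le> pi \<longrightarrow> (sin \<theta>)\<^sup>2 \<le> K * paircover b C \<theta>"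
proof -
  define B where "B = (\<Sum>i<C. real (b i)) + 1"
  have B: "B \<ge> 1" by (simp add: B_def sum_nonneg)
  have bB: "real (b i) \<le> B" if "i < C" for i
    using that member_le_sum[of i "{..<C}" "\<lambda>i. real (b i)"] by (simp add: B_def)
  obtain j where j: "j < C" "j \<noteq> i0"
    using C odd by (cases "i0 = 0") (auto intro: that[of 0] that[of 1])
  \<comment> \<open>16 is 4 times 4: the squared sine of the odd frequency is at least 1/4, and
    sin^2 \<theta> is at most 4 times the other squared sine. The distance 1 / B keeps all phases b
    \<phi> / 2 below 1/2.\<close>
  have lower: "(sin \<theta>)\<^sup>2 \<le> 16 * paircover b C \<theta>" if \<theta>: "pi - 1 / B \<le> \<bar>\<theta>\<bar>" "\<bar>\<theta>\<bar> \<le> pi" for \<theta>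
  proof -
    define \<phi> where "\<phi> = pi - \<bar>\<theta>\<bar>"
    have \<phi>: "0 \<le> \<phi>" "\<phi> \<le> 1 / B" using \<theta> by (auto simp: \<phi>_def)
    have small: "0 \<le> real (b i) * \<phi> / 2" "real (b i) * \<phi> / 2 \<le> 1 / 2" if "i < C" for i
    proof -
      have "real (b i) * \<phi> \<le> B * (1 / B)" using bB[OF that] \<phi> by (intro mult_mono) auto
      then show "real (b i) * \<phi> / 2 \<le> 1 / 2" using B by simp
    qed (use \<phi> in auto)
    have sinabs: "(sin (real n * \<theta> / 2))\<^sup>2 = (sin (real n * \<bar>\<theta>\<bar> / 2))\<^sup>2" for n by (simp add: abs_if)
    have arg: "real n * \<bar>\<theta>\<bar> / 2 = real n * pi / 2 - real n * \<phi> / 2" for n by (simp add: \<phi>_def field_simps)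
    have odd_case: "(sin (real (b i) * \<theta> / 2))\<^sup>2 \<ge> 1 / 4" if i: "i < C" "odd (b i)" for i
    proof -
      obtain m where m: "b i = 2 * m + 1" using i(2) by (elim oddE)
      define y where "y = real (b i) * \<phi> / 2"
      have y: "0 \<le> y" "y \<le> 1 / 2" using small[OF i(1)] by (auto simp: y_def)
      have "real (b i) * pi / 2 = real m * pi + pi / 2" by (simp add: m algebra_simps)
      then have "real (b i) * \<bar>\<theta>\<bar> / 2 = real m * pi + (pi / 2 - y)" using arg[of "b i"] unfolding y_def by linarith
      then have "sin (real (b i) * \<bar>\<theta>\<bar> / 2) = sin (real m * pi + (pi / 2 - y))" by (simp only:)
      also have "\<dots> = cos (real m * pi) * cos y"
        by (simp add: sin_add sin_npi sin_diff cos_diff)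
      finally have "(sin (real (b i) * \<theta> / 2))\<^sup>2 = (cos (real m * pi))\<^sup>2 * (cos y)\<^sup>2" unfolding sinabs by (simp add: power_mult_distrib)
      moreover have "(cos (real m * pi))\<^sup>2 = 1" by (simp add: cos_npi power_mult[symmetric] mult.commute[of m])
      moreover have "cos y \<ge> cos (pi / 3)" using y pi_gt3 by (intro cos_monotone_0_pi_le) auto
      then have "(cos y)\<^sup>2 \<ge> (1 / 2)\<^sup>2" by (intro power_mono) (auto simp: cos_60)
      ultimately show ?thesis by (simp add: power2_eq_square)
    qed
    have sin1: "(sin \<theta>)\<^sup>2 \<le> 1" by (simp add: abs_square_le_1)
    have "(sin \<theta>)\<^sup>2 \<le> 4 * (sin (real (b j) * \<theta> / 2))\<^sup>2"
    proof (cases "odd (b j)")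
      case True
      then show ?thesis using odd_case[OF j(1)] sin1 by linarith
    next
      case False
      then have "even (b j)" by simp
      then obtain m where m: "b j = 2 * m" by (elim evenE)
      define y where "y = real (b j) * \<phi> / 2"
      have y: "0 \<le> y" "y \<le> 1 / 2" using small[OF j(1)] by (auto simp: y_def)
      have "m \<ge> 1" using b[OF j(1)] m by simp
      then have "\<phi> \<le> y" using \<phi> mult_right_mono[of 1 "real m" \<phi>] by (simp add: y_def m)
      have "\<bar>sin y\<bar> \<ge> \<bar>y\<bar> / 2" using y pi_gt3 by (intro abs_sin_ge_half) auto
      moreover have "\<bar>sin \<phi>\<bar> \<le> \<bar>\<phi>\<bar>" by (rule abs_sin_x_le_abs_x)
      moreover have "\<bar>sin \<theta>\<bar> = \<bar>sin \<phi>\<bar>" by (simp add: \<phi>_def abs_if)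
      ultimately have 1: "\<bar>sin \<theta>\<bar> \<le> \<bar>2 * sin y\<bar>" using \<open>\<phi> \<le> y\<close> \<phi> y by (simp add: abs_mult)
      have "real (b j) * pi / 2 = real m * pi" by (simp add: m)
      then have "real (b j) * \<bar>\<theta>\<bar> / 2 = real m * pi - y" using arg[of "b j"] unfolding y_def by linarith
      then have "sin (real (b j) * \<bar>\<theta>\<bar> / 2) = sin (real m * pi - y)" by (simp only:)
      also have "\<dots> = - cos (real m * pi) * sin y" by (simp add: sin_diff sin_npi)
      finally have "(sin (real (b j) * \<theta> / 2))\<^sup>2 = (cos (real m * pi))\<^sup>2 * (sin y)\<^sup>2" unfolding sinabs by (simp add: power_mult_distrib)
      moreover have "(cos (real m * pi))\<^sup>2 = 1" by (simp add: cos_npi power_mult[symmetric] mult.commute[of m])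
      moreover have "(sin \<theta>)\<^sup>2 \<le> (2 * sin y)\<^sup>2" using 1 by (rule abs_le_square_iff[THEN iffD1])
      ultimately show ?thesis by (simp add: power_mult_distrib)
    qed
    also have "\<dots> = 16 * (1 / 4 * (sin (real (b j) * \<theta> / 2))\<^sup>2)" by simp
    also have "\<dots> \<le> 16 * ((sin (real (b i0) * \<theta> / 2))\<^sup>2 * (sin (real (b j) * \<theta> / 2))\<^sup>2)"
      using odd_case[OF odd] by (intro mult_left_mono mult_right_mono) auto
    also have "\<dots> \<le> 16 * paircover b C \<theta>" using j odd by (intro mult_left_mono paircover_ge) auto
    finally show ?thesis .
  qed
  obtain K where K: "K \<ge> 0" "\<And>\<theta>. \<delta> \<le> \<bar>\<theta>\<bar> \<Longrightarrow> \<bar>\<theta>\<bar> \<le> pi - 1 / B \<Longrightarrow> (sin \<theta>)\<^sup>2 \<le> K * paircover b C \<theta>"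
    using far_inner[OF sep _ \<delta>, of "pi - 1 / B"] B by auto
  have pc: "paircover b C \<theta> \<ge> 0" for \<theta> unfolding paircover_def by (intro sum_nonneg) auto
  show ?thesis
  proof (intro exI[of _ "max K 16"] conjI allI impI)
    fix \<theta> assume \<theta>: "\<delta> \<le> \<bar>\<theta>\<bar> \<and> \<bar>\<theta>\<bar> \<le> pi"
    have "(sin \<theta>)\<^sup>2 \<le> K * paircover b C \<theta> \<or> (sin \<theta>)\<^sup>2 \<le> 16 * paircover b C \<theta>"
      using \<theta> K(2)[of \<theta>] lower[of \<theta>] by linarith
    moreover have "K * paircover b C \<theta> \<le> max K 16 * paircover b C \<theta>" "16 * paircover b C \<theta> \<le> max K 16 * paircover b C \<theta>"
      using pc by (intro mult_right_mono; simp)+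
    ultimately show "(sin \<theta>)\<^sup>2 \<le> max K 16 * paircover b C \<theta>" by linarith
  qed simp
qed

text \<open>With even frequencies the denominators have period \<pi>, and the two sines of the
  numerator change by (-1)^(L + 1) and -1.\<close>

lemma kern_shift:
  assumes "\<And>i. i < C \<Longrightarrow> even (b i)"
  shows "kern b C L \<sigma> (\<theta> + pi) = (- 1) ^ L * kern b C L \<sigma> \<theta>"
proof -
  have "dnm (b i) \<sigma> (\<theta> + pi) = dnm (b i) \<sigma> \<theta>" if i: "i < C" for i
  proof -
    obtain m where m: "b i = 2 * m" using assms[OF i] by (elim evenE)
    have "real (b i) * (\<theta> + pi) / 2 = real m * \<theta> + real m * pi" by (simp add: m field_simps)
    then have "sin (real (b i) * (\<theta> + pi) / 2) = sin (real m * \<theta> + real m * pi)" by (simp only:)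
    also have "\<dots> = cos (real m * pi) * sin (real (b i) * \<theta> / 2)" by (simp add: sin_add sin_npi m)
    finally have "(sin (real (b i) * (\<theta> + pi) / 2))\<^sup>2 = (cos (real m * pi))\<^sup>2 * (sin (real (b i) * \<theta> / 2))\<^sup>2"
      by (simp add: power_mult_distrib)
    moreover have "(cos (real m * pi))\<^sup>2 = 1" by (simp add: cos_npi power_mult[symmetric] mult.commute[of m])
    ultimately show ?thesis by (simp add: dnm_def)
  qed
  then have "(\<Prod>i<C. 1 / dnm (b i) \<sigma> (\<theta> + pi)) = (\<Prod>i<C. 1 / dnm (b i) \<sigma> \<theta>)" by simp
  moreover have "numer L (\<theta> + pi) = (- 1) ^ L * numer L \<theta>"
  proof -
    have "sin (real (L + 1) * (\<theta> + pi)) = sin (real (L + 1) * \<theta> + real (L + 1) * pi)" by (simp only: distrib_left)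
    also have "\<dots> = (- 1) ^ (L + 1) * sin (real (L + 1) * \<theta>)"
      unfolding sin_add sin_npi cos_npi by simp
    finally show ?thesis by (simp only: numer_def sin_periodic_pi) simp
  qed
  ultimately show ?thesis by (simp add: kern_def)
qed

text \<open>The two outer quarters of the interval are translates by \<pi> and -\<pi> of the two
  halves of the inner one.\<close>

lemma integral_kern_even:
  assumes \<sigma>: "\<sigma> > 0" and b: "\<And>i. i < C \<Longrightarrow> even (b i)"
  shows "integral {-pi..pi} (kern b C L \<sigma>) = (1 + (- 1) ^ L) * integral {-(pi/2)..pi/2} (kern b C L \<sigma>)"
proof -
  let ?k = "kern b C L \<sigma>"
  have int: "?k integrable_on {x..y}" for x y by (intro integrable_continuous_interval continuous_kern \<sigma>)
  have "integral {pi/2..pi} ?k = integral {- (pi/2) + pi..0 + pi} ?k" by simp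
  also have "\<dots> = integral {-(pi/2)..0} (?k \<circ> (\<lambda>x. x + pi))"
    by (rule integral_shift[symmetric]) (intro continuous_kern \<sigma>)
  also have "?k \<circ> (\<lambda>x. x + pi) = (\<lambda>x. (- 1) ^ L * ?k x)" using kern_shift[OF b] by (auto simp: fun_eq_iff)
  finally have 1: "integral {pi/2..pi} ?k = (- 1) ^ L * integral {-(pi/2)..0} ?k" by simp
  have "integral {0..pi/2} ?k = integral {- pi + pi..-(pi/2) + pi} ?k" by simp
  also have "\<dots> = integral {-pi..-(pi/2)} (?k \<circ> (\<lambda>x. x + pi))"
    by (rule integral_shift[symmetric]) (intro continuous_kern \<sigma>)
  also have "?k \<circ> (\<lambda>x. x + pi) = (\<lambda>x. (- 1) ^ L * ?k x)" using kern_shift[OF b] by (auto simp: fun_eq_iff)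
  finally have "integral {0..pi/2} ?k = (- 1) ^ L * integral {-pi..-(pi/2)} ?k" by simp
  then have "(- 1) ^ L * integral {0..pi/2} ?k = ((- 1) ^ L * (- 1) ^ L) * integral {-pi..-(pi/2)} ?k" by (simp only: mult.assoc)
  then have 2: "integral {-pi..-(pi/2)} ?k = (- 1) ^ L * integral {0..pi/2} ?k" by (simp add: power_mult_distrib[symmetric])
  have comb: "integral {x..z} ?k = integral {x..y} ?k + integral {y..z} ?k" if "x \<le> y" "y \<le> z" for x y z
    by (rule Henstock_Kurzweil_Integration.integral_combine[symmetric, OF that int])
  have "integral {-pi..pi} ?k = integral {-pi..-(pi/2)} ?k + integral {-(pi/2)..pi} ?k"
    by (rule comb) (use pi_gt_zero in linarith)+
  moreover have "integral {-(pi/2)..pi} ?k = integral {-(pi/2)..pi/2} ?k + integral {pi/2..pi} ?k"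
    by (rule comb) (use pi_gt_zero in linarith)+
  moreover have "integral {-(pi/2)..pi/2} ?k = integral {-(pi/2)..0} ?k + integral {0..pi/2} ?k"
    by (rule comb) (use pi_gt_zero in linarith)+
  ultimately show ?thesis using 1 2 by (simp add: algebra_simps)
qed

text \<open>\<open>\<kappa>\<close> adds up the peaks: the one at zero counts 1, and in the even
  case the equally sharp one at \<pi> counts (-1)^L.\<close>

theorem kern_integral_asymp:
  fixes C L :: nat and b :: "nat \<Rightarrow> nat"
  assumes C: "C \<ge> 3" and b: "\<And>i. i < C \<Longrightarrow> b i \<ge> 1" and sep: "separated b C"
  defines "\<kappa> \<equiv> (if \<forall>i<C. even (b i) then 1 + (- 1) ^ L else 1 :: real)"
  shows "\<exists>M. \<forall>\<sigma>>0. \<bar>\<sigma> ^ (2 * C - 3) * integral {-pi..pi} (kern b C L \<sigma>) - \<kappa> * (2 * real (L + 1) * Jint (\<lambda>i. real (b i)) C)\<bar> \<le> M * \<sigma>\<^sup>2"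
proof (cases "\<forall>i<C. even (b i)")
  case True
  obtain M where M: "\<And>\<sigma>. \<sigma> > 0 \<Longrightarrow> \<bar>\<sigma> ^ (2 * C - 3) * integral {-(pi/2)..pi/2} (kern b C L \<sigma>) - 2 * real (L + 1) * Jint (\<lambda>i. real (b i)) C\<bar> \<le> M * \<sigma>\<^sup>2"
  proof -
    have "\<exists>M. \<forall>\<sigma>>0. \<bar>\<sigma> ^ (2 * C - 3) * integral {-(pi/2)..pi/2} (kern b C L \<sigma>) - 2 * real (L + 1) * Jint (\<lambda>i. real (b i)) C\<bar> \<le> M * \<sigma>\<^sup>2"
      by (rule kern_asymp[OF C b _ _ far_inner[OF sep]]) (use pi_gt_zero in auto)
    then show thesis using that by blast
  qed
  show ?thesis
  proof (intro exI[of _ "\<bar>\<kappa>\<bar> * M"] allI impI)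
    fix \<sigma> :: real assume \<sigma>: "\<sigma> > 0"
    have "integral {-pi..pi} (kern b C L \<sigma>) = \<kappa> * integral {-(pi/2)..pi/2} (kern b C L \<sigma>)"
      using integral_kern_even[OF \<sigma>, of C b L] True by (simp add: \<kappa>_def)
    then have "\<bar>\<sigma> ^ (2 * C - 3) * integral {-pi..pi} (kern b C L \<sigma>) - \<kappa> * (2 * real (L + 1) * Jint (\<lambda>i. real (b i)) C)\<bar>
      = \<bar>\<kappa>\<bar> * \<bar>\<sigma> ^ (2 * C - 3) * integral {-(pi/2)..pi/2} (kern b C L \<sigma>) - 2 * real (L + 1) * Jint (\<lambda>i. real (b i)) C\<bar>"
      by (simp add: abs_mult[symmetric] algebra_simps)
    also have "\<dots> \<le> \<bar>\<kappa>\<bar> * (M * \<sigma>\<^sup>2)" by (intro mult_left_mono M \<sigma>) simp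
    finally show "\<bar>\<sigma> ^ (2 * C - 3) * integral {-pi..pi} (kern b C L \<sigma>) - \<kappa> * (2 * real (L + 1) * Jint (\<lambda>i. real (b i)) C)\<bar> \<le> \<bar>\<kappa>\<bar> * M * \<sigma>\<^sup>2"
      by (simp add: mult.assoc)
  qed
next
  case False
  then obtain i0 where i0: "i0 < C" "odd (b i0)" by auto
  have "\<exists>M. \<forall>\<sigma>>0. \<bar>\<sigma> ^ (2 * C - 3) * integral {-pi..pi} (kern b C L \<sigma>) - 2 * real (L + 1) * Jint (\<lambda>i. real (b i)) C\<bar> \<le> M * \<sigma>\<^sup>2"
    by (rule kern_asymp[OF C b]) (use far_outer[OF sep _ b i0] C in auto)
  moreover have "\<kappa> = 1" using False by (auto simp: \<kappa>_def)
  ultimately show ?thesis by simp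
qed

section \<open>Schur polynomials\<close>

lemma polynomial_functions_add: "f \<in> polynomial_functions n \<Longrightarrow> g \<in> polynomial_functions n \<Longrightarrow> (\<lambda>x. f x + g x) \<in> polynomial_functions n"
  using cfun.span_add[of f "range (\<lambda>e x. \<Prod>i<n. x i ^ e i)" g] by (simp add: polynomial_functions_def plus_fun_def)

lemma polynomial_functions_scale: "f \<in> polynomial_functions n \<Longrightarrow> (\<lambda>x. c * f x) \<in> polynomial_functions n"
  using cfun.span_scale[of f "range (\<lambda>e x. \<Prod>i<n. x i ^ e i)" c] by (simp add: polynomial_functions_def cscale_def)

lemma polynomial_functions_monomial: "(\<lambda>x. \<Prod>i<n. x i ^ e i) \<in> polynomial_functions n"
  unfolding polynomial_functions_def by (intro cfun.span_base) auto

lemma polynomial_functions_const: "(\<lambda>x. c) \<in> polynomial_functions n"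
  using polynomial_functions_scale[OF polynomial_functions_monomial[where n = n and e = "\<lambda>_. 0"], of c] by simp

lemma polynomial_functions_var:
  assumes "i < n" shows "(\<lambda>x. x i) \<in> polynomial_functions n"
proof -
  have "(\<lambda>x. \<Prod>j<n. x j ^ (if j = i then 1 else 0)) = (\<lambda>x::nat \<Rightarrow> complex. x i)"
  proof
    fix x :: "nat \<Rightarrow> complex"
    have "(\<Prod>j<n. x j ^ (if j = i then 1 else 0)) = (\<Prod>j<n. if j = i then x i else 1)" by (rule prod.cong) auto
    then show "(\<Prod>j<n. x j ^ (if j = i then 1 else 0)) = x i" using assms by simp
  qed
  then show ?thesis using polynomial_functions_monomial[where n = n and e = "\<lambda>j. if j = i then 1 else 0"] by simp
qed

lemma polynomial_functions_mult:
  assumes "f \<in> polynomial_functions n" "g \<in> polynomial_functions n"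
  shows "(\<lambda>x. f x * g x) \<in> polynomial_functions n"
proof -
  have sub: "cfun.subspace (polynomial_functions n)" unfolding polynomial_functions_def by simp
  have 1: "(\<lambda>x. (\<Prod>i<n. x i ^ e i) * g x) \<in> polynomial_functions n" for e
  proof (rule cfun_span_linear_image[where E = "\<lambda>g x. (\<Prod>i<n. x i ^ e i) * g x", OF _ _ _ sub assms(2)[unfolded polynomial_functions_def]])
    fix g :: "(nat \<Rightarrow> complex) \<Rightarrow> complex" assume "g \<in> range (\<lambda>e x. \<Prod>i<n. x i ^ e i)"
    then obtain e' where e': "g = (\<lambda>x. \<Prod>i<n. x i ^ e' i)" by auto
    show "(\<lambda>x. (\<Prod>i<n. x i ^ e i) * g x) \<in> polynomial_functions n"
      using polynomial_functions_monomial[where n = n and e = "\<lambda>i. e i + e' i"] by (simp add: e' power_add prod.distrib)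
  qed (auto simp: fun_eq_iff cscale_def algebra_simps)
  show ?thesis
  proof (rule cfun_span_linear_image[where E = "\<lambda>f x. f x * g x", OF _ _ _ sub assms(1)[unfolded polynomial_functions_def]])
    fix f :: "(nat \<Rightarrow> complex) \<Rightarrow> complex" assume "f \<in> range (\<lambda>e x. \<Prod>i<n. x i ^ e i)"
    then show "(\<lambda>x. f x * g x) \<in> polynomial_functions n" using 1 by auto
  qed (auto simp: fun_eq_iff cscale_def algebra_simps)
qed

lemma polynomial_functions_sum: "(\<And>a. a \<in> A \<Longrightarrow> f a \<in> polynomial_functions n) \<Longrightarrow> (\<lambda>x. \<Sum>a\<in>A. f a x) \<in> polynomial_functions n"
  by (induction A rule: infinite_finite_induct) (auto intro: polynomial_functions_add polynomial_functions_const)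

lemma polynomial_functions_prod: "(\<And>a. a \<in> A \<Longrightarrow> f a \<in> polynomial_functions n) \<Longrightarrow> (\<lambda>x. \<Prod>a\<in>A. f a x) \<in> polynomial_functions n"
  by (induction A rule: infinite_finite_induct) (auto intro: polynomial_functions_mult polynomial_functions_const)

lemma polynomial_functions_power: "f \<in> polynomial_functions n \<Longrightarrow> (\<lambda>x. f x ^ k) \<in> polynomial_functions n"
  by (induction k) (auto intro: polynomial_functions_mult polynomial_functions_const)

lemma polynomial_functions_tendsto:
  assumes "f \<in> polynomial_functions n" "\<And>i. i < n \<Longrightarrow> ((\<lambda>t. g t i) \<longlongrightarrow> x i) F"
  shows "((\<lambda>t. f (g t)) \<longlongrightarrow> f x) F"
proof -
  have "f \<in> {f. ((\<lambda>t. f (g t)) \<longlongrightarrow> f x) F}"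
    using assms(1) unfolding polynomial_functions_def
  proof (rule cfun.span_minimal[THEN subsetD, rotated 2])
    show "range (\<lambda>e x. \<Prod>i<n. x i ^ e i) \<subseteq> {f. ((\<lambda>t. f (g t)) \<longlongrightarrow> f x) F}"
      using assms(2) by (auto intro!: tendsto_prod tendsto_power)
    show "cfun.subspace {f. ((\<lambda>t. f (g t)) \<longlongrightarrow> f x) F}"
      by (auto simp: cfun.subspace_def cscale_def intro!: tendsto_add tendsto_mult_left)
  qed
  then show ?thesis by simp
qed

text \<open>The complete homogeneous symmetric polynomial of degree k in the first m variables,
  sorted by the exponent of the last one.\<close>

fun hcomp :: "nat \<Rightarrow> nat \<Rightarrow> (nat \<Rightarrow> complex) \<Rightarrow> complex" where
  "hcomp 0 k x = (if k = 0 then 1 else 0)"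
| "hcomp (Suc m) k x = (\<Sum>j\<le>k. hcomp m j x * x m ^ (k - j))"

lemma hcomp_fps: "hcomp m k x = fps_nth (\<Prod>i<m. geo (x i)) k"
  by (induction m arbitrary: k) (auto simp: fps_mult_nth geo_def atLeast0AtMost)

lemma hcomp_polynomial: "m \<le> n \<Longrightarrow> (\<lambda>x. hcomp m k x) \<in> polynomial_functions n"
proof (induction m arbitrary: k)
  case 0
  have "(\<lambda>x. hcomp 0 k x) = (\<lambda>x. if k = 0 then 1 else 0)" by (rule ext) simp
  then show ?case by (simp only: polynomial_functions_const)
next
  case (Suc m)
  have "(\<lambda>x. hcomp (Suc m) k x) = (\<lambda>x. \<Sum>j\<le>k. hcomp m j x * x m ^ (k - j))" by (rule ext) simp
  moreover have "(\<lambda>x. \<Sum>j\<le>k. hcomp m j x * x m ^ (k - j)) \<in> polynomial_functions n"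
    using Suc by (intro polynomial_functions_sum polynomial_functions_mult polynomial_functions_power polynomial_functions_var) auto
  ultimately show ?case by (simp only:)
qed

text \<open>The generating-function form of a divided difference: 1/(1 - y X) - 1/(1 - z X) has
  numerator (y - z) X.\<close>

lemma geo_diff: "geo y = geo z + fps_const (y - z) * (fps_X * (geo z * geo y))"
proof -
  have g: "(1 - fps_const z * fps_X) * geo z = 1" for z
    by (rule fps_ext) (auto simp: geo_def algebra_simps power_eq_if)
  have "geo y - geo z = ((1 - fps_const z * fps_X) * geo z) * geo y - ((1 - fps_const y * fps_X) * geo y) * geo z"
    by (simp only: g mult_1)
  also have "\<dots> = (fps_const y - fps_const z) * (fps_X * (geo z * geo y))"
    by (simp add: algebra_simps del: fps_const_sub)
  finally have "geo y - geo z = fps_const (y - z) * (fps_X * (geo z * geo y))" by (simp only: fps_const_sub)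
  then show ?thesis unfolding diff_eq_eq by (simp only: add.commute)
qed

text \<open>Newton interpolation of \<open>y ^ k\<close> at the nodes \<open>x 0, x 1, \<dots>\<close>.\<close>

lemma newton_power:
  assumes "i < n"
  shows "x i ^ k = (\<Sum>m<n. (\<Prod>l<m. x i - x l) * (if m \<le> k then hcomp (Suc m) (k - m) x else 0))"
proof -
  \<comment> \<open>The complete homogeneous polynomial in x 0, ..., x (m - 1) and x i: the divided
    difference that remains after m nodes.\<close>
  define D where "D m k = fps_nth ((\<Prod>l<m. geo (x l)) * geo (x i)) k" for m k
  have D: "D m k = hcomp (Suc m) k x + (x i - x m) * (if k = 0 then 0 else D (Suc m) (k - 1))" for m k
  proof -
    have "(\<Prod>l<m. geo (x l)) * geo (x i) = (\<Prod>l<m. geo (x l)) * (geo (x m) + fps_const (x i - x m) * (fps_X * (geo (x m) * geo (x i))))"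
      by (rule arg_cong[OF geo_diff])
    also have "\<dots> = (\<Prod>l<Suc m. geo (x l)) + fps_const (x i - x m) * (fps_X * ((\<Prod>l<Suc m. geo (x l)) * geo (x i)))"
      by (simp add: algebra_simps)
    finally show ?thesis unfolding D_def hcomp_fps
      by (simp only: fps_add_nth fps_mult_left_const_nth fps_X_mult_nth)
  qed
  have "x i ^ k = (\<Sum>m<M. (\<Prod>l<m. x i - x l) * (if m \<le> k then hcomp (Suc m) (k - m) x else 0)) +
      (\<Prod>l<M. x i - x l) * (if M \<le> k then D M (k - M) else 0)" for M
  proof (induction M)
    case 0
    show ?case by (simp add: D_def geo_def)
  next
    case (Suc M)
    show ?case
    proof (cases "M \<le> k")
      case True
      show ?thesis
      proof (cases "k = M")
        case True
        then show ?thesis using Suc D[of M 0] by simp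
      next
        case False
        then have "Suc M \<le> k" "k - M \<noteq> 0" "k - M - 1 = k - Suc M" using True by auto
        then show ?thesis using Suc True D[of M "k - M"] by (simp add: algebra_simps del: hcomp.simps)
      qed
    qed (use Suc in simp)
  qed
  \<comment> \<open>For i < n the product in the remainder contains the factor x i - x i.\<close>
  from this[of n] show ?thesis using assms by (auto simp: prod_zero_iff)
qed

section \<open>Alternants as multiples of the Vandermonde product\<close>

definition vdm :: "nat \<Rightarrow> (nat \<Rightarrow> complex) \<Rightarrow> complex" where
  "vdm n x = (\<Prod>i<n. \<Prod>l<i. x i - x l)"

definition hmat :: "nat \<Rightarrow> (nat \<Rightarrow> nat) \<Rightarrow> (nat \<Rightarrow> complex) \<Rightarrow> complex Matrix.mat" where
  "hmat n k x = Matrix.mat n n (\<lambda>(m, j). if m \<le> k j then hcomp (Suc m) (k j - m) x else 0)"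

text \<open>Newton interpolation factors the matrix of powers into a lower triangular matrix with
  Vandermonde diagonal and the matrix of Newton coefficients. The second determinant is the
  polynomial quotient, valid at repeated coordinates as well.\<close>

lemma det_powers: "Determinant.det (Matrix.mat n n (\<lambda>(i, j). x i ^ k j)) = vdm n x * Determinant.det (hmat n k x)"
proof -
  define N where "N = Matrix.mat n n (\<lambda>(i, m). \<Prod>l<m. x i - x l)"
  have N: "N \<in> carrier_mat n n" by (simp add: N_def)
  have H: "hmat n k x \<in> carrier_mat n n" by (simp add: hmat_def)
  have "Matrix.mat n n (\<lambda>(i, j). x i ^ k j) = N * hmat n k x"
  proof (rule eq_matI)
    fix i j assume "i < dim_row (N * hmat n k x)" "j < dim_col (N * hmat n k x)"
    then have ij: "i < n" "j < n" by (auto simp: N_def hmat_def)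
    then have "(N * hmat n k x) $$ (i, j) = (\<Sum>m<n. (\<Prod>l<m. x i - x l) * (if m \<le> k j then hcomp (Suc m) (k j - m) x else 0))"
      by (auto simp: N_def hmat_def scalar_prod_def atLeast0LessThan simp del: hcomp.simps intro!: sum.cong)
    then show "Matrix.mat n n (\<lambda>(i, j). x i ^ k j) $$ (i, j) = (N * hmat n k x) $$ (i, j)"
      using newton_power[OF ij(1), of x "k j"] ij by simp
  qed (auto simp: N_def hmat_def)
  then have "Determinant.det (Matrix.mat n n (\<lambda>(i, j). x i ^ k j)) = Determinant.det N * Determinant.det (hmat n k x)"
    using det_mult[OF N H] by simp
  also have "Determinant.det N = prod_list (diag_mat N)"
    by (rule det_lower_triangular[OF _ N]) (auto simp: N_def prod_zero_iff)
  also have "\<dots> = vdm n x"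
  proof -
    have "diag_mat N = map (\<lambda>i. \<Prod>l<i. x i - x l) [0..<n]" by (auto simp: diag_mat_def N_def)
    then show ?thesis by (simp add: vdm_def prod.distinct_set_conv_list[symmetric] atLeast0LessThan)
  qed
  finally show ?thesis .
qed

text \<open>Reversing the columns gives an upper triangular matrix with diagonal entries h_0 = 1. A
  nonzero constant is all that is asked for, so the sign of the reversal stays undetermined.\<close>

lemma det_hmat_standard: "\<exists>c. c \<noteq> 0 \<and> (\<forall>x. Determinant.det (hmat n (\<lambda>j. n - 1 - j) x) = c)"
proof -
  define R :: "complex Matrix.mat" where "R = Matrix.mat n n (\<lambda>(i, j). if i = n - 1 - j then 1 else 0)"
  have R: "R \<in> carrier_mat n n" by (simp add: R_def)
  have one: "Determinant.det (hmat n (\<lambda>j. n - 1 - j) x) * Determinant.det R = 1" for x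
  proof -
    have H: "hmat n (\<lambda>j. n - 1 - j) x \<in> carrier_mat n n" by (simp add: hmat_def)
    have eq: "hmat n (\<lambda>j. n - 1 - j) x * R = hmat n (\<lambda>j. j) x"
    proof (rule eq_matI)
      fix i j assume "i < dim_row (hmat n (\<lambda>j. j) x)" "j < dim_col (hmat n (\<lambda>j. j) x)"
      then have ij: "i < n" "j < n" by (auto simp: hmat_def)
      define H' where "H' m = (if i \<le> n - 1 - m then hcomp (Suc i) (n - 1 - m - i) x else 0)" for m
      have "(hmat n (\<lambda>j. n - 1 - j) x * R) $$ (i, j) = (\<Sum>m<n. H' m * (if m = n - 1 - j then 1 else 0))"
        using ij by (auto simp: R_def hmat_def scalar_prod_def atLeast0LessThan H'_def simp del: hcomp.simps intro!: sum.cong)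
      also have "\<dots> = H' (n - 1 - j)" using ij by (simp add: if_distrib cong: if_cong)
      finally show "(hmat n (\<lambda>j. n - 1 - j) x * R) $$ (i, j) = hmat n (\<lambda>j. j) x $$ (i, j)"
        using ij by (simp add: hmat_def H'_def del: hcomp.simps)
    qed (auto simp: hmat_def R_def)
    have up: "Determinant.det (hmat n (\<lambda>j. j) x) = prod_list (diag_mat (hmat n (\<lambda>j. j) x))"
    proof (rule det_upper_triangular[of _ n])
      show "upper_triangular (hmat n (\<lambda>j. j) x)" by (auto simp: upper_triangular_def hmat_def)
    qed (simp add: hmat_def)
    have h0: "hcomp m 0 x = 1" for m by (induction m) auto
    have "diag_mat (hmat n (\<lambda>j. j) x) = map (\<lambda>_. 1) [0..<n]" by (auto simp: diag_mat_def hmat_def h0 simp del: hcomp.simps)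
    then have "prod_list (diag_mat (hmat n (\<lambda>j. j) x)) = 1" by (simp add: map_replicate_const)
    then show ?thesis using up det_mult[OF H R] by (simp only: eq)
  qed
  then have "Determinant.det R \<noteq> 0" by (metis mult_zero_right zero_neq_one)
  then show ?thesis using one by (intro exI[of _ "inverse (Determinant.det R)"]) (auto simp: field_simps)
qed

lemma det_polynomial:
  assumes "\<And>i j. i < m \<Longrightarrow> j < m \<Longrightarrow> (\<lambda>x. M x i j) \<in> polynomial_functions n"
  shows "(\<lambda>x. Determinant.det (Matrix.mat m m (\<lambda>(i, j). M x i j))) \<in> polynomial_functions n"
proof -
  have "Determinant.det (Matrix.mat m m (\<lambda>(i, j). M x i j)) =
     (\<Sum>p\<in>{p. p permutes {0..<m}}. signof p * (\<Prod>i\<in>{0..<m}. M x i (p i)))" for x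
  proof -
    have "Determinant.det (Matrix.mat m m (\<lambda>(i, j). M x i j)) =
     (\<Sum>p\<in>{p. p permutes {0..<m}}. signof p * (\<Prod>i\<in>{0..<m}. Matrix.mat m m (\<lambda>(i, j). M x i j) $$ (i, p i)))"
      by (rule det_def') simp
    also have "\<dots> = (\<Sum>p\<in>{p. p permutes {0..<m}}. signof p * (\<Prod>i\<in>{0..<m}. M x i (p i)))"
    proof (rule sum.cong)
      fix p assume "p \<in> {p. p permutes {0..<m}}"
      then have "\<And>i. i < m \<Longrightarrow> p i < m" using permutes_in_image[of p "{0..<m}"] by auto
      then show "signof p * (\<Prod>i\<in>{0..<m}. Matrix.mat m m (\<lambda>(i, j). M x i j) $$ (i, p i)) = signof p * (\<Prod>i\<in>{0..<m}. M x i (p i))"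
        by simp
    qed simp
    finally show ?thesis .
  qed
  moreover have "(\<lambda>x. \<Sum>p\<in>{p. p permutes {0..<m}}. signof p * (\<Prod>i\<in>{0..<m}. M x i (p i))) \<in> polynomial_functions n"
  proof (intro polynomial_functions_sum polynomial_functions_mult polynomial_functions_const polynomial_functions_prod)
    fix p i assume "p \<in> {p. p permutes {0..<m}}" "i \<in> {0..<m}"
    then show "(\<lambda>x. M x i (p i)) \<in> polynomial_functions n"
      using permutes_in_image[of p "{0..<m}" i] by (intro assms) auto
  qed
  ultimately show ?thesis by (simp only:)
qed

lemma hmat_det_polynomial: "(\<lambda>x. Determinant.det (hmat n k x)) \<in> polynomial_functions n"
  unfolding hmat_def
proof (rule det_polynomial)
  fix i j assume "i < n" "j < n"
  then show "(\<lambda>x. if i \<le> k j then hcomp (Suc i) (k j - i) x else 0) \<in> polynomial_functions n"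
    by (cases "i \<le> k j") (auto intro: hcomp_polynomial polynomial_functions_const simp del: hcomp.simps)
qed

lemma vdm_eq_0_iff: "vdm n x = 0 \<longleftrightarrow> \<not> inj_on x {..<n}"
proof -
  have "vdm n x = 0 \<longleftrightarrow> (\<exists>i<n. \<exists>l<i. x i = x l)" by (auto simp: vdm_def prod_zero_iff)
  also have "\<dots> \<longleftrightarrow> \<not> inj_on x {..<n}"
  proof
    assume "\<exists>i<n. \<exists>l<i. x i = x l"
    then obtain i l where "i < n" "l < i" "x i = x l" by blast
    then show "\<not> inj_on x {..<n}" using inj_onD[of x "{..<n}" i l] by auto
  next
    assume "\<not> inj_on x {..<n}"
    then obtain i l where "i < n" "l < n" "i \<noteq> l" "x i = x l" unfolding inj_on_def by auto
    moreover from this have "l < i \<or> i < l" by auto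
    ultimately show "\<exists>i<n. \<exists>l<i. x i = x l" by metis
  qed
  finally show ?thesis .
qed

text \<open>Points with distinct coordinates are dense: adding i / (m + 1) to coordinate i separates
  equal coordinates and, for large m, keeps different ones apart.\<close>

lemma polynomial_functions_generic_eq:
  assumes f: "f \<in> polynomial_functions n" and g: "g \<in> polynomial_functions n"
    and eq: "\<And>x. inj_on x {..<n} \<Longrightarrow> f x = g x"
  shows "f = g"
proof
  fix x :: "nat \<Rightarrow> complex"
  define y where "y m i = x i + of_nat i * (1 / of_nat (Suc m))" for m i
  have lim: "(\<lambda>m. y m i) \<longlonglongrightarrow> x i" for i
  proof -
    have "(\<lambda>m. x i + of_nat i * (1 / of_nat (Suc m))) \<longlonglongrightarrow> x i + of_nat i * 0"
      by (intro tendsto_intros LIMSEQ_Suc lim_1_over_n)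
    then show ?thesis by (simp add: y_def)
  qed
  have "\<forall>\<^sub>F m in sequentially. y m i \<noteq> y m j" if "i \<noteq> j" for i j
  proof (cases "x i = x j")
    case True
    have "of_nat (Suc m) \<noteq> (0 :: complex)" for m by (simp del: of_nat_Suc)
    then show ?thesis using that True by (simp add: y_def del: of_nat_Suc)
  next
    case False
    have "(\<lambda>m. y m i - y m j) \<longlonglongrightarrow> x i - x j" by (intro tendsto_diff lim)
    from tendsto_imp_eventually_ne[OF this, of 0] False show ?thesis by simp
  qed
  then have "\<forall>\<^sub>F m in sequentially. \<forall>i\<in>{..<n}. \<forall>j\<in>{..<n}. i \<noteq> j \<longrightarrow> y m i \<noteq> y m j"
    by (auto intro!: eventually_ball_finite)
  then have ev: "\<forall>\<^sub>F m in sequentially. f (y m) = g (y m)"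
    by (rule eventually_mono) (rule eq, rule inj_onI, blast)
  have "(\<lambda>m. f (y m)) \<longlonglongrightarrow> f x" by (rule polynomial_functions_tendsto[OF f]) (rule lim)
  from Lim_transform_eventually[OF this ev] have "(\<lambda>m. g (y m)) \<longlonglongrightarrow> f x" .
  moreover have "(\<lambda>m. g (y m)) \<longlonglongrightarrow> g x" by (rule polynomial_functions_tendsto[OF g]) (rule lim)
  ultimately show "f x = g x" by (rule LIMSEQ_unique)
qed

lemma alternant_vdm:
  "alternant \<rho> x = vdm (length \<rho>) x * Determinant.det (hmat (length \<rho>) (\<lambda>j. \<rho> ! j + (length \<rho> - 1 - j)) x)"
  unfolding alternant_def Let_def by (rule det_powers)

lemma alternant_zero:
  "\<exists>c. c \<noteq> 0 \<and> (\<forall>x. alternant (replicate n 0) x = vdm n x * c)"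
proof -
  obtain c where c: "c \<noteq> 0" "\<And>x. Determinant.det (hmat n (\<lambda>j. n - 1 - j) x) = c"
    using det_hmat_standard by blast
  have "hmat n (\<lambda>j. replicate n 0 ! j + (n - 1 - j)) x = hmat n (\<lambda>j. n - 1 - j) x" for x
    unfolding hmat_def by (rule eq_matI) auto
  then show ?thesis using c by (intro exI[of _ c]) (simp add: alternant_vdm)
qed

text \<open>Justifies the definite description in \<open>schur\<close>. The quotient of determinants
  of Newton coefficients exists as a polynomial, and it is unique because the Vandermonde product is
  nonzero at points with distinct coordinates.\<close>

lemma schur_exists1:
  "\<exists>!s. s \<in> polynomial_functions (length \<rho>) \<and> (\<forall>x. s x * alternant (replicate (length \<rho>) 0) x = alternant \<rho> x)"
proof -
  let ?n = "length \<rho>"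
  obtain c where c: "c \<noteq> 0" "\<And>x. alternant (replicate ?n 0) x = vdm ?n x * c" using alternant_zero by blast
  define s where "s x = (1 / c) * Determinant.det (hmat ?n (\<lambda>j. \<rho> ! j + (?n - 1 - j)) x)" for x
  have "s \<in> polynomial_functions ?n"
    unfolding s_def by (intro polynomial_functions_scale hmat_det_polynomial)
  moreover have "s x * alternant (replicate ?n 0) x = alternant \<rho> x" for x
    using c by (simp add: s_def alternant_vdm[of \<rho>])
  moreover have "s' = s" if "s' \<in> polynomial_functions ?n" "\<And>x. s' x * alternant (replicate ?n 0) x = alternant \<rho> x" for s'
  proof (rule polynomial_functions_generic_eq[OF that(1) calculation(1)])
    fix x :: "nat \<Rightarrow> complex" assume "inj_on x {..<?n}"
    then have "alternant (replicate ?n 0) x \<noteq> 0" using c vdm_eq_0_iff by simp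
    then show "s' x = s x" using that(2)[of x] \<open>\<And>x. s x * alternant (replicate ?n 0) x = alternant \<rho> x\<close>[of x]
      by (metis mult_right_cancel)
  qed
  ultimately show ?thesis by blast
qed

lemma schur_polynomial: "schur \<rho> \<in> polynomial_functions (length \<rho>)"
  and schur_alternant: "schur \<rho> x * alternant (replicate (length \<rho>) 0) x = alternant \<rho> x"
  using theI'[OF schur_exists1[of \<rho>], folded schur_def] by auto

lemma schur_eqI:
  assumes "s \<in> polynomial_functions (length \<rho>)" "\<And>x. s x * alternant (replicate (length \<rho>) 0) x = alternant \<rho> x"
  shows "schur \<rho> = s"
  unfolding schur_def by (rule the1_equality[OF schur_exists1]) (use assms in blast)

lemma alternant_cong: "length \<rho> = length \<rho>' \<Longrightarrow> (\<And>i j. i < length \<rho> \<Longrightarrow> j < length \<rho> \<Longrightarrow> x i ^ (\<rho> ! j + (length \<rho> - 1 - j)) = x' i ^ (\<rho>' ! j + (length \<rho> - 1 - j)))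
  \<Longrightarrow> alternant \<rho> x = alternant \<rho>' x'"
  unfolding alternant_def Let_def by (intro arg_cong[where f = Determinant.det] eq_matI) auto

lemma length_seqs [simp]: "length (\<delta>_seq C) = C" "length (\<rho>_seq C) = C"
  by (simp_all add: \<delta>_seq_def \<rho>_seq_def)

lemma nth_seqs: "j < C \<Longrightarrow> \<delta>_seq C ! j = C - 1 - j"
  "j < C \<Longrightarrow> \<rho>_seq C ! j = (if j < 2 then C - 3 else C - 1 - j)"
  by (simp_all add: \<delta>_seq_def \<rho>_seq_def del: upt_Suc)

lemma alternant_delta: "alternant (\<delta>_seq C) x = alternant (replicate C 0) (\<lambda>i. x i ^ 2)"
  by (rule alternant_cong) (auto simp: nth_seqs power_mult[symmetric] mult_2)

text \<open>Adding the staircase to itself doubles all exponents, so the quotient is the Vandermonde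
  product of the squares over that of the variables.\<close>

lemma schur_delta: "schur (\<delta>_seq C) = (\<lambda>x. \<Prod>i<C. \<Prod>l<i. x i + x l)"
proof (rule schur_eqI)
  show "(\<lambda>x. \<Prod>i<C. \<Prod>l<i. x i + x l) \<in> polynomial_functions (length (\<delta>_seq C))"
    by (intro polynomial_functions_prod polynomial_functions_add polynomial_functions_var) auto
  fix x
  obtain c where c: "\<And>x. alternant (replicate C 0) x = vdm C x * c" using alternant_zero by blast
  have "(\<Prod>i<C. \<Prod>l<i. x i + x l) * vdm C x = vdm C (\<lambda>i. x i ^ 2)"
    unfolding vdm_def prod.distrib[symmetric] by (intro prod.cong refl) (simp add: power2_eq_square algebra_simps)
  then show "(\<Prod>i<C. \<Prod>l<i. x i + x l) * alternant (replicate (length (\<delta>_seq C)) 0) x = alternant (\<delta>_seq C) x"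
    unfolding alternant_delta by (simp add: c mult.assoc[symmetric])
qed

section \<open>The two alternants and the integral of the Cauchy product\<close>

definition lagr :: "nat \<Rightarrow> (nat \<Rightarrow> complex) \<Rightarrow> (nat \<Rightarrow> complex) \<Rightarrow> complex poly" where
  "lagr C y f = (\<Sum>i<C. Polynomial.smult (f i / (\<Prod>k\<in>{..<C} - {i}. y i - y k)) (\<Prod>k\<in>{..<C} - {i}. [:- y k, 1:]))"

text \<open>The top coefficient is the divided difference of \<open>f\<close>; the same kind of sum
  comes out of the partial fractions of the integral.\<close>

lemma lagr:
  assumes inj: "inj_on y {..<C}" and C: "C \<ge> 1"
  shows "i < C \<Longrightarrow> poly (lagr C y f) (y i) = f i" "degree (lagr C y f) \<le> C - 1"
    and "poly.coeff (lagr C y f) (C - 1) = (\<Sum>i<C. f i / (\<Prod>k\<in>{..<C} - {i}. y i - y k))"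
proof -
  have nz: "(\<Prod>k\<in>{..<C} - {i}. y i - y k) \<noteq> 0" if "i < C" for i
    using inj that by (auto simp: inj_on_def)
  have deg: "degree (\<Prod>k\<in>{..<C} - {i}. [:- y k, 1:]) = C - 1" if "i < C" for i
    using that by (subst degree_prod_sum_eq) auto
  show "poly (lagr C y f) (y i) = f i" if i: "i < C"
  proof -
    have "poly (lagr C y f) (y i) = (\<Sum>j<C. f j / (\<Prod>k\<in>{..<C} - {j}. y j - y k) * (\<Prod>k\<in>{..<C} - {j}. y i - y k))"
      by (simp add: lagr_def poly_sum poly_prod)
    also have "\<dots> = (\<Sum>j<C. if j = i then f i else 0)"
    proof (rule sum.cong)
      fix j assume j: "j \<in> {..<C}"
      show "f j / (\<Prod>k\<in>{..<C} - {j}. y j - y k) * (\<Prod>k\<in>{..<C} - {j}. y i - y k) = (if j = i then f i else 0)"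
      proof (cases "j = i")
        case True then show ?thesis using nz[OF i] by simp
      next
        case False
        then have "(\<Prod>k\<in>{..<C} - {j}. y i - y k) = 0" using i by (intro prod_zero) auto
        then show ?thesis using False by simp
      qed
    qed simp
    finally show ?thesis using i by simp
  qed
  show "degree (lagr C y f) \<le> C - 1"
    unfolding lagr_def by (intro degree_sum_le) (auto intro: order.trans[OF degree_smult_le] simp: deg)
  have "poly.coeff (\<Prod>k\<in>{..<C} - {i}. [:- y k, 1:]) (C - 1) = 1" if "i < C" for i
    using lead_coeff_prod[of "\<lambda>k. [:- y k, 1:]" "{..<C} - {i}"] by (simp add: deg[OF that])
  then show "poly.coeff (lagr C y f) (C - 1) = (\<Sum>i<C. f i / (\<Prod>k\<in>{..<C} - {i}. y i - y k))"
    unfolding lagr_def coeff_sum by (intro sum.cong) auto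
qed

text \<open>Exchanging the first two columns turns the alternant of \<open>\<rho>_seq\<close> into a Vandermonde matrix in the
  squares whose leading column is replaced by the values of \<open>x ^ (2 C - 5)\<close>; the determinant then reads off
  the leading coefficient of the interpolating polynomial.\<close>

lemma alternant_rho:
  assumes C: "C \<ge> 3" and inj: "inj_on (\<lambda>i. x i ^ 2) {..<C}"
  shows "alternant (\<rho>_seq C) x =
    - (\<Sum>i<C. x i ^ (2 * C - 5) / (\<Prod>k\<in>{..<C} - {i}. x i ^ 2 - x k ^ 2)) * alternant (replicate C 0) (\<lambda>i. x i ^ 2)"
proof -
  define y where "y i = x i ^ 2" for i
  define p where "p = lagr C y (\<lambda>i. x i ^ (2 * C - 5))"
  have p: "\<And>i. i < C \<Longrightarrow> poly p (y i) = x i ^ (2 * C - 5)" "degree p \<le> C - 1"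
    "poly.coeff p (C - 1) = (\<Sum>i<C. x i ^ (2 * C - 5) / (\<Prod>k\<in>{..<C} - {i}. y i - y k))"
    unfolding p_def using lagr[of y C] C inj by (auto simp: y_def[abs_def])
  define Y where "Y = Matrix.mat C C (\<lambda>(i, j). y i ^ (C - 1 - j))"
  define T where "T = Matrix.mat C C (\<lambda>(m, j). if j = 0 then poly.coeff p (C - 1 - m) else if m = j then 1 else 0)"
  \<comment> \<open>The total exponents of \<open>\<rho>_seq\<close> are 2 C - 4, 2 C - 5, 2 C - 6,
    2 C - 8, ..., 0. The first belongs into the second column of the Vandermonde matrix in the
    squares, and the odd one takes the place of 2 C - 2.\<close>
  define \<tau> where "\<tau> j = (if j = 0 then 1 else if j = 1 then 0 else j)" for j :: nat
  define S where "S = Matrix.mat C C (\<lambda>(m, j). if m = \<tau> j then 1 else (0 :: complex))"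
  have car: "Y \<in> carrier_mat C C" "T \<in> carrier_mat C C" "S \<in> carrier_mat C C" by (auto simp: Y_def T_def S_def)
  have YT: "(Y * T) $$ (i, j) = (if j = 0 then x i ^ (2 * C - 5) else y i ^ (C - 1 - j))" if ij: "i < C" "j < C" for i j
  proof -
    have "(Y * T) $$ (i, j) = (\<Sum>m<C. y i ^ (C - 1 - m) * (if j = 0 then poly.coeff p (C - 1 - m) else if m = j then 1 else 0))"
      using ij by (auto simp: Y_def T_def scalar_prod_def atLeast0LessThan intro!: sum.cong)
    also have "\<dots> = (if j = 0 then x i ^ (2 * C - 5) else y i ^ (C - 1 - j))"
    proof (cases "j = 0")
      case True
      have "(\<Sum>m<C. y i ^ (C - 1 - m) * poly.coeff p (C - 1 - m)) = (\<Sum>m<C. y i ^ m * poly.coeff p m)"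
        by (rule sum.reindex_bij_witness[of _ "\<lambda>m. C - 1 - m" "\<lambda>m. C - 1 - m"]) auto
      also have "\<dots> = (\<Sum>m\<le>degree p. poly.coeff p m * y i ^ m)"
        using p(2) C by (intro sum.mono_neutral_cong_right) (auto simp: coeff_eq_0 not_le mult.commute)
      also have "\<dots> = x i ^ (2 * C - 5)" using p(1)[OF ij(1)] by (simp add: poly_altdef)
      finally show ?thesis using True by simp
    qed (use ij in \<open>simp add: if_distrib cong: if_cong\<close>)
    finally show ?thesis .
  qed
  define Z where "Z = Y * T"
  have Z: "Z \<in> carrier_mat C C" using car by (simp add: Z_def)
  note ZT = YT[folded Z_def]
  have "Matrix.mat C C (\<lambda>(i, j). x i ^ (\<rho>_seq C ! j + (C - 1 - j))) = Z * S"
  proof (rule eq_matI)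
    fix i j assume "i < dim_row (Z * S)" "j < dim_col (Z * S)"
    then have ij: "i < C" "j < C" using Z by (auto simp: S_def)
    have "(Z * S) $$ (i, j) = (\<Sum>m<C. Z $$ (i, m) * (if m = \<tau> j then 1 else 0))"
      using ij Z by (auto simp: S_def scalar_prod_def atLeast0LessThan intro!: sum.cong)
    also have "\<dots> = (\<Sum>m<C. if m = \<tau> j then Z $$ (i, m) else 0)" by (rule sum.cong) auto
    also have "\<dots> = Z $$ (i, \<tau> j)" using ij C by (simp add: \<tau>_def)
    also have "\<dots> = x i ^ (\<rho>_seq C ! j + (C - 1 - j))"
    proof -
      consider "j = 0" | "j = 1" | "j \<ge> 2" by linarith
      then show ?thesis
      proof cases
        case 1
        have "C - 3 + (C - 1 - 0) = 2 * (C - 1 - 1)" using C by simp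
        then have "x i ^ (C - 3 + (C - 1 - 0)) = y i ^ (C - 1 - 1)" by (simp only: y_def power_mult)
        then show ?thesis using ij C 1 by (simp add: ZT \<tau>_def nth_seqs)
      next
        case 2
        have "2 * C - 5 = C - 3 + (C - 1 - 1)" using C by simp
        then show ?thesis using ij C 2 by (simp add: ZT \<tau>_def nth_seqs)
      next
        case 3
        have "C - 1 - j + (C - 1 - j) = 2 * (C - 1 - j)" by simp
        then have "x i ^ (C - 1 - j + (C - 1 - j)) = y i ^ (C - 1 - j)" by (simp only: y_def power_mult)
        then show ?thesis using ij C 3 by (simp add: ZT \<tau>_def nth_seqs)
      qed
    qed
    finally show "Matrix.mat C C (\<lambda>(i, j). x i ^ (\<rho>_seq C ! j + (C - 1 - j))) $$ (i, j) = (Z * S) $$ (i, j)"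
      using ij by simp
  qed (use Z in \<open>auto simp: S_def\<close>)
  then have "alternant (\<rho>_seq C) x = Determinant.det (Z * S)" by (simp add: alternant_def Let_def)
  also have "\<dots> = Determinant.det Z * Determinant.det S" by (rule det_mult[OF Z car(3)])
  also have "Determinant.det Z = Determinant.det Y * Determinant.det T" unfolding Z_def by (rule det_mult[OF car(1,2)])
  also have "Determinant.det Y = alternant (replicate C 0) y"
    unfolding Y_def alternant_def Let_def by (intro arg_cong[where f = Determinant.det] eq_matI) auto
  also have "Determinant.det T = poly.coeff p (C - 1)"
  proof -
    have "Determinant.det T = prod_list (diag_mat T)"
      by (rule det_lower_triangular[OF _ car(2)]) (auto simp: T_def)
    also have "diag_mat T = map (\<lambda>m. if m = 0 then poly.coeff p (C - 1) else 1) [0..<C]"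
      by (auto simp: diag_mat_def T_def)
    also have "prod_list \<dots> = (\<Prod>m<C. if m = 0 then poly.coeff p (C - 1) else 1)"
      by (simp add: prod.distinct_set_conv_list[symmetric] atLeast0LessThan)
    also have "\<dots> = poly.coeff p (C - 1)" using C by simp
    finally show ?thesis .
  qed
  also have "Determinant.det S = - 1"
  proof -
    have "S = swaprows_mat C 0 1"
      using C by (intro eq_matI) (auto simp: S_def \<tau>_def)
    then show ?thesis using det_swaprows_mat[of 0 C 1] C by simp
  qed
  finally show ?thesis unfolding p(3) by (simp add: y_def[abs_def])
qed

text \<open>After clearing denominators, X is compared with a polynomial of degree at most C - 1 at
  the C distinct nodes -1 / y i.\<close>

lemma partial_fractions:
  fixes y :: "nat \<Rightarrow> real"
  assumes C: "C \<ge> 2" and pos: "\<And>i. i < C \<Longrightarrow> y i > 0" and inj: "inj_on y {..<C}" and X: "X \<ge> 0"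
  shows "X * (\<Prod>k<C. 1 / (1 + y k * X)) = (\<Sum>j<C. - (1 / y j) / (\<Prod>k\<in>{..<C} - {j}. 1 - y k / y j) * (1 / (1 + y j * X)))"
proof -
  define d where "d j = - (1 / y j) / (\<Prod>k\<in>{..<C} - {j}. 1 - y k / y j)" for j
  define q where "q = (\<Sum>j<C. Polynomial.smult (d j) (\<Prod>k\<in>{..<C} - {j}. [:1, y k:]))"
  have q: "poly q x = (\<Sum>j<C. d j * (\<Prod>k\<in>{..<C} - {j}. 1 + y k * x))" for x
    by (simp add: q_def poly_sum poly_prod mult.commute)
  have "[:0, 1:] = q"
  proof (rule poly_eqI_degree[where A = "(\<lambda>i. - 1 / y i) ` {..<C}"])
    have card: "card ((\<lambda>i. - 1 / y i) ` {..<C}) = C"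
      using inj pos by (subst card_image) (auto simp: inj_on_def)
    show "degree [:0, 1 :: real:] < card ((\<lambda>i. - 1 / y i) ` {..<C})" unfolding card using C by simp
    have "degree q \<le> C - 1"
      unfolding q_def
    proof (intro degree_sum_le)
      fix j assume j: "j \<in> {..<C}"
      have "degree (\<Prod>k\<in>{..<C} - {j}. [:1, y k:]) \<le> (\<Sum>k\<in>{..<C} - {j}. degree [:1, y k:])"
        using degree_prod_sum_le[of "{..<C} - {j}" "\<lambda>k. [:1, y k:]"] by (simp add: o_def)
      also have "\<dots> \<le> (\<Sum>k\<in>{..<C} - {j}. 1)" by (intro sum_mono) simp
      also have "\<dots> = C - 1" using j by simp
      finally show "degree (Polynomial.smult (d j) (\<Prod>k\<in>{..<C} - {j}. [:1, y k:])) \<le> C - 1"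
        by (rule order.trans[OF degree_smult_le])
    qed simp
    then show "degree q < card ((\<lambda>i. - 1 / y i) ` {..<C})" unfolding card using C by linarith
  next
    fix x assume "x \<in> (\<lambda>i. - 1 / y i) ` {..<C}"
    then obtain i where i: "i < C" "x = - 1 / y i" by auto
    have "poly q x = (\<Sum>j<C. if j = i then d i * (\<Prod>k\<in>{..<C} - {i}. 1 + y k * x) else 0)"
      unfolding q
    proof (rule sum.cong)
      fix j assume "j \<in> {..<C}"
      show "d j * (\<Prod>k\<in>{..<C} - {j}. 1 + y k * x) = (if j = i then d i * (\<Prod>k\<in>{..<C} - {i}. 1 + y k * x) else 0)"
      proof (cases "j = i")
        case False
        have "1 + y i * x = 0" using pos[OF i(1)] i by simp
        then have "(\<Prod>k\<in>{..<C} - {j}. 1 + y k * x) = 0" using i False by (intro prod_zero) auto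
        then show ?thesis using False by simp
      qed simp
    qed simp
    also have "\<dots> = d i * (\<Prod>k\<in>{..<C} - {i}. 1 - y k / y i)" using i by simp
    also have "(\<Prod>k\<in>{..<C} - {i}. 1 - y k / y i) \<noteq> 0"
      using inj i pos[OF i(1)] by (auto simp: inj_on_def)
    then have "d i * (\<Prod>k\<in>{..<C} - {i}. 1 - y k / y i) = x" by (simp add: d_def i)
    finally show "poly [:0, 1:] x = poly q x" by simp
  qed
  from arg_cong[OF this, of "\<lambda>p. poly p X"] have "X = poly q X" by simp
  then have "X = (\<Sum>j<C. d j * (\<Prod>k\<in>{..<C} - {j}. 1 + y k * X))" unfolding q .
  then have "X * (\<Prod>k<C. 1 / (1 + y k * X)) = (\<Sum>j<C. d j * (\<Prod>k\<in>{..<C} - {j}. 1 + y k * X)) * (\<Prod>k<C. 1 / (1 + y k * X))"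
    by simp
  also have "\<dots> = (\<Sum>j<C. d j * (1 / (1 + y j * X)))"
    unfolding sum_distrib_right
  proof (rule sum.cong)
    fix j assume j: "j \<in> {..<C}"
    have ne: "1 + y k * X \<noteq> 0" if "k < C" for k
      using mult_nonneg_nonneg[OF less_imp_le[OF pos[OF that]] X] by simp
    have "(\<Prod>k<C. 1 / (1 + y k * X)) = 1 / (1 + y j * X) * (\<Prod>k\<in>{..<C} - {j}. 1 / (1 + y k * X))"
      using j by (simp add: prod.remove)
    moreover have "(\<Prod>k\<in>{..<C} - {j}. 1 + y k * X) * (\<Prod>k\<in>{..<C} - {j}. 1 / (1 + y k * X)) = 1"
      unfolding prod.distrib[symmetric] by (rule prod.neutral) (use ne in auto)
    ultimately show "d j * (\<Prod>k\<in>{..<C} - {j}. 1 + y k * X) * (\<Prod>k<C. 1 / (1 + y k * X)) = d j * (1 / (1 + y j * X))"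
      by (simp only: mult.assoc mult.left_commute[of _ "1 / (1 + y j * X)"] mult_1_right) (rule mult.commute)
  qed simp
  finally show ?thesis by (simp add: d_def)
qed

text \<open>With X = x^2 each partial fraction is a Cauchy kernel of width 1 / a j and integrates to
  \<pi> a j before weighting. Collecting powers, one factor a, then a^(2 C - 2) over a^4, gives the
  exponent 2 C - 5.\<close>

lemma Jint_distinct:
  assumes C: "C \<ge> 3" and a: "\<And>i. i < C \<Longrightarrow> a i \<ge> 1" and inj: "inj_on a {..<C}"
  shows "Jint a C = - pi * (\<Sum>i<C. a i ^ (2 * C - 5) / (\<Prod>k\<in>{..<C} - {i}. a i ^ 2 - a k ^ 2))"
proof -
  define y where "y i = (a i)\<^sup>2" for i
  define d where "d j = - (1 / y j) / (\<Prod>k\<in>{..<C} - {j}. 1 - y k / y j)" for j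
  have apos: "a i > 0" if "i < C" for i using a[OF that] by simp
  have ypos: "y i > 0" if "i < C" for i using apos[OF that] by (simp add: y_def)
  have yinj: "inj_on y {..<C}"
  proof (rule inj_onI)
    fix i j assume ij: "i \<in> {..<C}" "j \<in> {..<C}" "y i = y j"
    then have "a i = a j" using apos[of i] apos[of j] by (simp add: y_def power2_eq_iff_nonneg less_imp_le)
    then show "i = j" using inj ij by (auto dest: inj_onD)
  qed
  have "cauchy_prod a C x = (\<Sum>j<C. (d j / y j) * (1 / ((1 / a j)\<^sup>2 + (x - 0)\<^sup>2)))" for x
  proof -
    have "cauchy_prod a C x = (\<Sum>j<C. d j * (1 / (1 + y j * x\<^sup>2)))"
      using partial_fractions[of C y "x\<^sup>2"] C ypos yinj by (simp add: cauchy_prod_def y_def d_def)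
    also have "\<dots> = (\<Sum>j<C. (d j / y j) * (1 / ((1 / a j)\<^sup>2 + (x - 0)\<^sup>2)))"
    proof (rule sum.cong)
      fix j assume "j \<in> {..<C}"
      then have p: "a j > 0" "y j > 0" using apos ypos by auto
      have "y j * ((1 / a j)\<^sup>2 + (x - 0)\<^sup>2) = 1 + y j * x\<^sup>2" using p by (simp add: y_def field_simps)
      from this[symmetric] show "d j * (1 / (1 + y j * x\<^sup>2)) = (d j / y j) * (1 / ((1 / a j)\<^sup>2 + (x - 0)\<^sup>2))"
        by (simp only: times_divide_times_eq mult_1_right times_divide_eq_right divide_divide_eq_left)
    qed simp
    finally show ?thesis .
  qed
  then have cp: "cauchy_prod a C = (\<lambda>x. \<Sum>j<C. (d j / y j) * (1 / ((1 / a j)\<^sup>2 + (x - 0)\<^sup>2)))" by (rule ext)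
  have hb: "has_bochner_integral lborel (\<lambda>x. \<Sum>j<C. (d j / y j) * (1 / ((1 / a j)\<^sup>2 + (x - 0)\<^sup>2))) (\<Sum>j<C. (d j / y j) * (pi / (1 / a j)))"
    by (intro has_bochner_integral_sum has_bochner_integral_mult_right has_bochner_integral_inverse_square) (use apos in auto)
  have "Jint a C = (\<Sum>j<C. (d j / y j) * (pi / (1 / a j)))"
    unfolding Jint_def cp by (rule has_bochner_integral_integral_eq[OF hb])
  also have "\<dots> = (\<Sum>j<C. - pi * (a j ^ (2 * C - 5) / (\<Prod>k\<in>{..<C} - {j}. a j ^ 2 - a k ^ 2)))"
  proof (rule sum.cong)
    fix j assume j: "j \<in> {..<C}"
    then have p: "a j > 0" "y j > 0" using apos ypos by auto
    define Q where "Q = (\<Prod>k\<in>{..<C} - {j}. y j - y k)"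
    have Q: "Q \<noteq> 0" using yinj j by (auto simp: Q_def inj_on_def)
    have "(\<Prod>k\<in>{..<C} - {j}. 1 - y k / y j) = (\<Prod>k\<in>{..<C} - {j}. (y j - y k) / y j)"
      using p by (intro prod.cong) (auto simp: field_simps)
    also have "\<dots> = Q / y j ^ (C - 1)" using j by (simp add: prod_dividef Q_def)
    finally have "d j = - (1 / y j) / (Q / y j ^ (C - 1))" by (simp add: d_def)
    then have "(d j / y j) * (pi / (1 / a j)) = - pi * (a j * y j ^ (C - 1) / (y j * y j)) / Q"
      using p by (simp add: mult_ac)
    also have "a j * y j ^ (C - 1) / (y j * y j) = a j ^ (2 * C - 5)"
    proof -
      obtain n where n: "C = n + 3" using C by (metis add.commute le_Suc_ex)
      show ?thesis using p by (simp add: n y_def power_add power_mult[symmetric] field_simps eval_nat_numeral)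
    qed
    finally show "(d j / y j) * (pi / (1 / a j)) = - pi * (a j ^ (2 * C - 5) / (\<Prod>k\<in>{..<C} - {j}. a j ^ 2 - a k ^ 2))"
      by (simp add: Q_def y_def)
  qed simp
  finally show ?thesis by (simp add: sum_distrib_left)
qed

text \<open>The minus sign of the partial fractions cancels that of the column exchange in
  \<open>alternant_rho\<close>. The product form of the identity passes to limits without
  dividing.\<close>

lemma Jint_schur_distinct:
  assumes C: "C \<ge> 3" and a: "\<And>i. i < C \<Longrightarrow> a i \<ge> 1" and inj: "inj_on a {..<C}"
  shows "of_real (Jint a C / pi) * schur (\<delta>_seq C) (\<lambda>i. of_real (a i)) = schur (\<rho>_seq C) (\<lambda>i. of_real (a i))"
proof -
  define x :: "nat \<Rightarrow> complex" where "x i = of_real (a i)" for i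
  have inj2: "inj_on (\<lambda>i. x i ^ 2) {..<C}"
  proof (rule inj_onI)
    fix i j assume ij: "i \<in> {..<C}" "j \<in> {..<C}" "x i ^ 2 = x j ^ 2"
    then have "complex_of_real (a i ^ 2) = of_real (a j ^ 2)" by (simp add: x_def)
    then have "a i ^ 2 = a j ^ 2" by (simp only: of_real_eq_iff)
    moreover have "a i \<ge> 0" "a j \<ge> 0" using a[of i] a[of j] ij by auto
    ultimately have "a i = a j" by (simp add: power2_eq_iff_nonneg)
    then show "i = j" using inj ij by (auto simp: inj_on_def)
  qed
  have x: "inj_on x {..<C}" using inj by (auto simp: inj_on_def x_def)
  obtain c where c: "c \<noteq> 0" "\<And>x. alternant (replicate C 0) x = vdm C x * c" using alternant_zero by blast
  have V: "alternant (replicate C 0) x \<noteq> 0" using c vdm_eq_0_iff[of C x] x by simp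
  have "Jint a C / pi = - (\<Sum>i<C. a i ^ (2 * C - 5) / (\<Prod>k\<in>{..<C} - {i}. a i ^ 2 - a k ^ 2))"
    using Jint_distinct[OF assms] by simp
  then have "of_real (Jint a C / pi) = - (\<Sum>i<C. x i ^ (2 * C - 5) / (\<Prod>k\<in>{..<C} - {i}. x i ^ 2 - x k ^ 2))"
    by (simp only:) (simp add: x_def)
  then have "of_real (Jint a C / pi) * alternant (\<delta>_seq C) x = alternant (\<rho>_seq C) x"
    unfolding alternant_rho[OF C inj2] alternant_delta by simp
  then have "(of_real (Jint a C / pi) * schur (\<delta>_seq C) x) * alternant (replicate C 0) x = schur (\<rho>_seq C) x * alternant (replicate C 0) x"
    using schur_alternant[of "\<delta>_seq C" x] schur_alternant[of "\<rho>_seq C" x] by (simp add: mult.assoc)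
  then have "of_real (Jint a C / pi) * schur (\<delta>_seq C) x = schur (\<rho>_seq C) x"
    by (rule mult_right_cancel[OF V, THEN iffD1])
  then show ?thesis by (simp only: x_def[abs_def])
qed

text \<open>Coinciding weights are reached as limits of distinct ones.\<close>

theorem Jint_schur:
  assumes C: "C \<ge> 3" and a: "\<And>i. i < C \<Longrightarrow> a i \<ge> 1"
  shows "of_real (Jint a C / pi) * schur (\<delta>_seq C) (\<lambda>i. of_real (a i)) = schur (\<rho>_seq C) (\<lambda>i. of_real (a i))"
proof -
  define b where "b n i = a i + real i * (1 / real (Suc n))" for n i
  have b1: "b n i \<ge> 1" if "i < C" for n i using a[OF that] by (simp add: b_def add_increasing2)
  have lim: "(\<lambda>n. b n i) \<longlonglongrightarrow> a i" for i
  proof -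
    have "(\<lambda>n. a i + real i * (1 / real (Suc n))) \<longlonglongrightarrow> a i + real i * 0"
      by (intro tendsto_intros LIMSEQ_Suc lim_1_over_n)
    then show ?thesis by (simp add: b_def)
  qed
  have "\<forall>\<^sub>F n in sequentially. b n i \<noteq> b n j" if "i \<noteq> j" for i j
  proof (cases "a i = a j")
    case True
    then show ?thesis using that by (simp add: b_def del: of_nat_Suc)
  next
    case False
    have "(\<lambda>n. b n i - b n j) \<longlonglongrightarrow> a i - a j" by (intro tendsto_diff lim)
    from tendsto_imp_eventually_ne[OF this, of 0] False show ?thesis by simp
  qed
  then have "\<forall>\<^sub>F n in sequentially. \<forall>i\<in>{..<C}. \<forall>j\<in>{..<C}. i \<noteq> j \<longrightarrow> b n i \<noteq> b n j"
    by (auto intro!: eventually_ball_finite)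
  then have ev: "\<forall>\<^sub>F n in sequentially. of_real (Jint (b n) C / pi) * schur (\<delta>_seq C) (\<lambda>i. of_real (b n i)) = schur (\<rho>_seq C) (\<lambda>i. of_real (b n i))"
    by (rule eventually_mono) (rule Jint_schur_distinct[OF C b1], assumption, rule inj_onI, blast)
  \<comment> \<open>The perturbed weights stay at least 1, so 1 / (1 + x^2) dominates for every
    n.\<close>
  have J: "(\<lambda>n. Jint (b n) C) \<longlonglongrightarrow> Jint a C"
    unfolding Jint_def
  proof (rule integral_dominated_convergence)
    show "integrable lborel (\<lambda>x::real. 1 / (1 + x\<^sup>2))" by (rule integrable.intros[OF has_bochner_integral_1_div_plus_square])
    have "0 < 1 + (a i)\<^sup>2 * x\<^sup>2" for i x by (intro add_pos_nonneg) auto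
    then have "1 + (a i)\<^sup>2 * x\<^sup>2 \<noteq> 0" for i x by (metis less_irrefl)
    then show "AE x in lborel. (\<lambda>n. cauchy_prod (b n) C x) \<longlonglongrightarrow> cauchy_prod a C x"
      unfolding cauchy_prod_def by (intro AE_I2 tendsto_intros lim) auto
    show "AE x in lborel. norm (cauchy_prod (b n) C x) \<le> 1 / (1 + x\<^sup>2)" for n
      using cauchy_prod_bounds[of C "b n"] C b1 by (intro AE_I2) auto
  qed auto
  have s: "(\<lambda>n. schur \<rho> (\<lambda>i. of_real (b n i))) \<longlonglongrightarrow> schur \<rho> (\<lambda>i. of_real (a i))" for \<rho>
    by (rule polynomial_functions_tendsto[OF schur_polynomial]) (intro tendsto_of_real lim)
  have "(\<lambda>n. of_real (Jint (b n) C / pi) * schur (\<delta>_seq C) (\<lambda>i. of_real (b n i))) \<longlonglongrightarrow>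
     of_real (Jint a C / pi) * schur (\<delta>_seq C) (\<lambda>i. of_real (a i))"
    by (intro tendsto_mult tendsto_of_real tendsto_divide J s tendsto_const) simp
  from Lim_transform_eventually[OF this ev] s[of "\<rho>_seq C"] show ?thesis by (rule LIMSEQ_unique)
qed

lemma schur_delta_nonzero:
  assumes "\<And>i. i < C \<Longrightarrow> a i \<ge> (1 :: real)"
  shows "schur (\<delta>_seq C) (\<lambda>i. of_real (a i)) \<noteq> 0"
proof -
  have "complex_of_real (a i) + of_real (a l) \<noteq> 0" if "i < C" "l < i" for i l
  proof -
    have "a i + a l \<noteq> 0" using assms[of i] assms[of l] that by simp
    then show ?thesis by (metis of_real_add of_real_eq_0_iff)
  qed
  then show ?thesis by (auto simp: schur_delta)
qed

section \<open>The Laurent coefficient\<close>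

definition block_weights :: "nat \<Rightarrow> int list" where
  "block_weights d = filter (\<lambda>a. a > 0) (map (\<lambda>i. 2 * int i - int d) [0..<d + 1])"

lemma pos_weights_concat: "pos_weights ds = concat (map block_weights ds)"
  by (induction ds) (simp_all add: pos_weights_def block_weights_def del: upt_Suc)

lemma set_block_weights: "set (block_weights d) = {a. a > 0 \<and> a \<le> int d \<and> even (a + int d)}"
proof (intro equalityI subsetI)
  fix a assume "a \<in> {a. a > 0 \<and> a \<le> int d \<and> even (a + int d)}"
  then have a: "a > 0" "a \<le> int d" "even (a + int d)" by auto
  then have "a = 2 * int (nat ((a + int d) div 2)) - int d" "nat ((a + int d) div 2) < d + 1" by auto
  then have "a \<in> (\<lambda>i. 2 * int i - int d) ` {0..<d + 1}"
    by (intro image_eqI[where x = "nat ((a + int d) div 2)"]) simp_all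
  then show "a \<in> set (block_weights d)" using a(1) unfolding block_weights_def set_filter set_map set_upt by blast
qed (auto simp: block_weights_def simp del: upt_Suc)

lemma distinct_block_weights: "distinct (block_weights d)"
  unfolding block_weights_def by (intro distinct_filter) (auto simp: distinct_map inj_on_def)

lemma prod_block:
  fixes F :: "int \<Rightarrow> 'a :: comm_monoid_mult"
  shows "(\<Prod>i\<le>d. F (2 * int i - int d)) = (if even d then F 0 else 1) * prod_list (map (\<lambda>a. F a * F (- a)) (block_weights d))"
proof -
  define S where "S = (\<lambda>i. 2 * int i - int d) ` {..d}"
  have S: "S = {a. \<bar>a\<bar> \<le> int d \<and> even (a + int d)}"
  proof (intro equalityI subsetI)
    fix a assume "a \<in> {a. \<bar>a\<bar> \<le> int d \<and> even (a + int d)}"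
    then have "a = 2 * int (nat ((a + int d) div 2)) - int d" "nat ((a + int d) div 2) \<le> d" by auto
    then show "a \<in> S" unfolding S_def by blast
  qed (auto simp: S_def)
  have fin: "finite S" by (simp add: S_def)
  have "(\<Prod>i\<le>d. F (2 * int i - int d)) = prod F S"
    unfolding S_def by (subst prod.reindex) (auto simp: inj_on_def)
  also have "S = {a \<in> S. a > 0} \<union> ({a \<in> S. a < 0} \<union> {a \<in> S. a = 0})" by auto
  also have "prod F \<dots> = prod F {a \<in> S. a > 0} * (prod F {a \<in> S. a < 0} * prod F {a \<in> S. a = 0})"
    using fin by (subst prod.union_disjoint; (subst prod.union_disjoint)?) auto
  also have "{a \<in> S. a = 0} = (if even d then {0} else {})" by (auto simp: S)
  also have "prod F {a \<in> S. a < 0} = (\<Prod>a\<in>{a \<in> S. a > 0}. F (- a))"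
    by (rule prod.reindex_bij_witness[of _ uminus uminus]) (auto simp: S)
  also have "{a \<in> S. a > 0} = set (block_weights d)" by (auto simp: S set_block_weights)
  finally have "(\<Prod>i\<le>d. F (2 * int i - int d)) = prod F (set (block_weights d)) *
    ((\<Prod>a\<in>set (block_weights d). F (- a)) * prod F (if even d then {0} else {}))" .
  moreover have "prod_list (map (\<lambda>a. F a * F (- a)) (block_weights d)) =
    prod F (set (block_weights d)) * (\<Prod>a\<in>set (block_weights d). F (- a))"
    unfolding prod.distinct_set_conv_list[OF distinct_block_weights, symmetric] prod.distrib ..
  ultimately show ?thesis by (simp only:) (simp add: mult_ac)
qed

lemma (in binary_forms) prod_indices:
  fixes F :: "int \<Rightarrow> 'a :: comm_monoid_mult"
  shows "(\<Prod>\<alpha>\<in>indices ds. F (wt \<alpha>)) = F 0 ^ length (filter even ds) * prod_list (map (\<lambda>a. F a * F (- a)) (pos_weights ds))"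
proof -
  have "(\<Prod>\<alpha>\<in>indices ds. F (wt \<alpha>)) = (\<Prod>k<length ds. \<Prod>i\<le>ds ! k. F (2 * int i - int (ds ! k)))"
  proof -
    have "(\<Prod>k<length ds. \<Prod>i\<le>ds ! k. F (2 * int i - int (ds ! k))) =
      (\<Prod>(k, i)\<in>indices ds. F (2 * int i - int (ds ! k)))"
      unfolding indices_def by (rule prod.Sigma) auto
    also have "\<dots> = (\<Prod>\<alpha>\<in>indices ds. F (wt \<alpha>))"
      by (rule prod.cong) (auto simp: indices_def wt_def deg_pair)
    finally show ?thesis ..
  qed
  also have "\<dots> = prod_list (map (\<lambda>d. \<Prod>i\<le>d. F (2 * int i - int d)) ds)"
    by (simp add: prod.list_conv_set_nth atLeast0LessThan)
  also have "\<dots> = F 0 ^ length (filter even ds) * prod_list (map (\<lambda>a. F a * F (- a)) (pos_weights ds))"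
    unfolding pos_weights_concat
  proof (induction ds)
    case (Cons d ds)
    then show ?case by (cases "even d"; simp add: prod_block; simp add: mult_ac)
  qed simp
  finally show ?thesis .
qed

text \<open>The product formula for the constant function 2 turns cardinalities into
  exponents.\<close>

lemma card_indices: "card (indices ds) = length (filter even ds) + 2 * length (pos_weights ds)"
proof -
  have "(2 :: nat) ^ card (indices ds) = 2 ^ (length (filter even ds) + 2 * length (pos_weights ds))"
    using binary_forms.prod_indices[of "\<lambda>_. 2 :: nat" ds]
    by (simp add: power_add power_mult map_replicate_const)
  then show ?thesis by simp
qed

lemma length_block_weights: "length (block_weights d) = (d + 1) div 2"
proof -
  have "card (indices [d]) = d + 1" by (simp add: indices_def)
  then show ?thesis using card_indices[of "[d]"] by (simp add: pos_weights_concat split: if_splits)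
qed

text \<open>Weights a and -a contribute conjugate factors, whose product is the reciprocal of t
  times \<open>dnm\<close>; the weight zero gives the powers of 1 - t. The character thus becomes a
  positive real function.\<close>

lemma (in binary_forms) character_product:
  assumes t: "0 < t" "t < 1"
  defines "C \<equiv> length (pos_weights ds)" and "b \<equiv> \<lambda>i. nat (pos_weights ds ! i)" and "E \<equiv> length (filter even ds)"
  shows "(\<Prod>\<alpha>\<in>indices ds. inverse (1 - of_real t * cis (of_int (wt \<alpha>) * \<theta>))) =
    complex_of_real ((1 / (1 - t)) ^ E * (1 / t) ^ C * (\<Prod>i<C. 1 / dnm (b i) ((1 - t) / sqrt t) \<theta>))"
proof -
  define F where "F a = inverse (1 - complex_of_real t * cis (of_int a * \<theta>))" for a :: int
  have F0: "F 0 = of_real (1 / (1 - t))" by (simp add: F_def inverse_eq_divide)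
  have Fa: "F a * F (- a) = complex_of_real (1 / t * (1 / dnm (nat a) ((1 - t) / sqrt t) \<theta>))" if "a > 0" for a
  proof -
    define x where "x = of_int a * \<theta>"
    have "(1 - complex_of_real t * cis x) * (1 - of_real t * cis (- x)) = of_real (1 - 2 * t * cos x + t\<^sup>2)"
      by (simp add: complex_eq_iff power2_eq_square algebra_simps) (simp add: distrib_left[symmetric] power2_eq_square[symmetric])
    also have "1 - 2 * t * cos x + t\<^sup>2 = t * dnm (nat a) ((1 - t) / sqrt t) \<theta>"
    proof -
      have "cos x = 1 - 2 * (sin (x / 2))\<^sup>2" using cos_double_sin[of "x / 2"] by simp
      moreover have "real (nat a) * \<theta> / 2 = x / 2" using that by (simp add: x_def)
      moreover have "((1 - t) / sqrt t)\<^sup>2 = (1 - t)\<^sup>2 / t" using t by (simp add: power_divide)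
      ultimately have "t * dnm (nat a) ((1 - t) / sqrt t) \<theta> = (1 - t)\<^sup>2 + 4 * t * (sin (x / 2))\<^sup>2"
        using t by (simp add: dnm_def distrib_left)
      also have "\<dots> = 1 - 2 * t * (1 - 2 * (sin (x / 2))\<^sup>2) + t\<^sup>2"
        by (simp add: power2_eq_square algebra_simps)
      finally show ?thesis using \<open>cos x = _\<close> by simp
    qed
    finally have "F a * F (- a) = inverse (of_real (t * dnm (nat a) ((1 - t) / sqrt t) \<theta>))"
      by (simp add: F_def x_def flip: inverse_mult_distrib)
    then show ?thesis by (simp add: inverse_eq_divide)
  qed
  have "(\<Prod>\<alpha>\<in>indices ds. F (wt \<alpha>)) = F 0 ^ E * prod_list (map (\<lambda>a. F a * F (- a)) (pos_weights ds))"
    unfolding E_def by (rule prod_indices)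
  also have "prod_list (map (\<lambda>a. F a * F (- a)) (pos_weights ds)) = (\<Prod>i<C. F (pos_weights ds ! i) * F (- (pos_weights ds ! i)))"
    by (simp add: prod.list_conv_set_nth atLeast0LessThan C_def)
  also have "\<dots> = (\<Prod>i<C. complex_of_real (1 / t * (1 / dnm (b i) ((1 - t) / sqrt t) \<theta>)))"
  proof (rule prod.cong)
    fix i assume "i \<in> {..<C}"
    then have "pos_weights ds ! i \<in> set (pos_weights ds)" by (simp add: C_def)
    then have "pos_weights ds ! i > 0" by (auto simp: pos_weights_def)
    then show "F (pos_weights ds ! i) * F (- (pos_weights ds ! i)) = complex_of_real (1 / t * (1 / dnm (b i) ((1 - t) / sqrt t) \<theta>))"
      unfolding b_def by (rule Fa)
  qed simp
  also have "\<dots> = complex_of_real ((1 / t) ^ C * (\<Prod>i<C. 1 / dnm (b i) ((1 - t) / sqrt t) \<theta>))"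
    by (simp only: of_real_prod[symmetric] prod.distrib prod_constant card_lessThan)
  also have "F 0 ^ E * \<dots> = complex_of_real ((1 / (1 - t)) ^ E * (1 / t) ^ C * (\<Prod>i<C. 1 / dnm (b i) ((1 - t) / sqrt t) \<theta>))"
    unfolding F0 by (simp only: of_real_mult[symmetric] of_real_power[symmetric] mult.assoc)
  finally show ?thesis by (simp only: F_def)
qed

lemma numer_eq: "cos (real L * \<theta>) - cos (real (L + 2) * \<theta>) = numer L \<theta>"
proof -
  have "real L * \<theta> = real (L + 1) * \<theta> - \<theta>" "real (L + 2) * \<theta> = real (L + 1) * \<theta> + \<theta>"
    by (simp_all add: algebra_simps)
  then show ?thesis by (simp only: cos_diff cos_add numer_def)
qed

text \<open>The two Fourier integrals have the frequencies -L and L + 2. The series is real, so it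
  is given by the real part of their difference, whose trigonometric factor is
  \<open>numer\<close>.\<close>

lemma (in binary_forms) hilbert_sums:
  assumes t: "0 < t" "t < 1"
  defines "C \<equiv> length (pos_weights ds)" and "b \<equiv> \<lambda>i. nat (pos_weights ds ! i)" and "E \<equiv> length (filter even ds)"
  shows "(\<lambda>n. real (cfun.dim (covariants ds L n)) * t ^ n) sums
    ((1 / (1 - t)) ^ E * (1 / t) ^ C * integral {-pi..pi} (kern b C L ((1 - t) / sqrt t)) / (2 * pi))"
proof -
  define K where "K = (1 / (1 - t)) ^ E * (1 / t) ^ C"
  define p where "p \<theta> = K * (\<Prod>i<C. 1 / dnm (b i) ((1 - t) / sqrt t) \<theta>)" for \<theta>
  have prod: "(\<Prod>\<alpha>\<in>indices ds. inverse (1 - of_real t * cis (of_int (wt \<alpha>) * \<theta>))) = complex_of_real (p \<theta>)" for \<theta>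
    unfolding p_def K_def C_def b_def E_def by (rule character_product[OF t])
  obtain S1 where S1: "((\<lambda>\<theta>. cis (- of_int (- int L) * \<theta>) * of_real (p \<theta>)) has_integral S1) {-pi..pi}"
    "(\<lambda>n. of_nat (wcount wt (indices ds) n (- int L)) * of_real t ^ n) sums (S1 / complex_of_real (2 * pi))"
    using wcount_sums[OF t finite_indices[of ds], where wt = wt and c = "- int L"] unfolding prod by blast
  obtain S2 where S2: "((\<lambda>\<theta>. cis (- of_int (int L + 2) * \<theta>) * of_real (p \<theta>)) has_integral S2) {-pi..pi}"
    "(\<lambda>n. of_nat (wcount wt (indices ds) n (int L + 2)) * of_real t ^ n) sums (S2 / complex_of_real (2 * pi))"
    using wcount_sums[OF t finite_indices[of ds], where wt = wt and c = "int L + 2"] unfolding prod by blast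
  have "((\<lambda>\<theta>. Re (cis (- of_int (- int L) * \<theta>) * of_real (p \<theta>) - cis (- of_int (int L + 2) * \<theta>) * of_real (p \<theta>))) has_integral Re (S1 - S2)) {-pi..pi}"
    using has_integral_linear[OF has_integral_diff[OF S1(1) S2(1)] bounded_linear_Re] by (simp add: o_def)
  moreover have "Re (cis (- of_int (- int L) * \<theta>) * of_real (p \<theta>) - cis (- of_int (int L + 2) * \<theta>) * of_real (p \<theta>)) = K * kern b C L ((1 - t) / sqrt t) \<theta>" for \<theta>
  proof -
    have "Re (cis (- of_int (- int L) * \<theta>) * of_real (p \<theta>) - cis (- of_int (int L + 2) * \<theta>) * of_real (p \<theta>))
      = (cos (real L * \<theta>) - cos (real (L + 2) * \<theta>)) * p \<theta>"
      using cos_minus[of "(real L + 2) * \<theta>"] by (simp add: left_diff_distrib algebra_simps)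
    then show ?thesis unfolding numer_eq by (simp add: p_def kern_def)
  qed
  ultimately have "((\<lambda>\<theta>. K * kern b C L ((1 - t) / sqrt t) \<theta>) has_integral Re (S1 - S2)) {-pi..pi}" by simp
  then have "integral {-pi..pi} (\<lambda>\<theta>. K * kern b C L ((1 - t) / sqrt t) \<theta>) = Re (S1 - S2)" by (rule integral_unique)
  then have Re: "Re (S1 - S2) = K * integral {-pi..pi} (kern b C L ((1 - t) / sqrt t))" by simp
  have "(\<lambda>n. of_nat (wcount wt (indices ds) n (- int L)) * of_real t ^ n - of_nat (wcount wt (indices ds) n (int L + 2)) * of_real t ^ n)
     sums (S1 / complex_of_real (2 * pi) - S2 / complex_of_real (2 * pi))" by (rule sums_diff[OF S1(2) S2(2)])
  moreover have "of_nat (wcount wt (indices ds) n (- int L)) * of_real t ^ n - of_nat (wcount wt (indices ds) n (int L + 2)) * of_real t ^ n =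
     complex_of_real (real (cfun.dim (covariants ds L n)) * t ^ n)" for n
  proof -
    have "real (cfun.dim (covariants ds L n)) = real (wcount wt (indices ds) n (- int L)) - real (wcount wt (indices ds) n (int L + 2))"
      using arg_cong[OF dim_covariants[of L n], of real_of_int] by simp
    then show ?thesis by (simp add: left_diff_distrib)
  qed
  ultimately have "(\<lambda>n. complex_of_real (real (cfun.dim (covariants ds L n)) * t ^ n)) sums ((S1 - S2) / complex_of_real (2 * pi))"
    by (simp add: diff_divide_distrib)
  from sums_Re[OF this] have "(\<lambda>n. real (cfun.dim (covariants ds L n)) * t ^ n) sums Re ((S1 - S2) / complex_of_real (2 * pi))"
    by (simp only: Re_complex_of_real)
  also have "Re ((S1 - S2) / complex_of_real (2 * pi)) = Re (S1 - S2) / (2 * pi)" by (rule Re_divide_of_real)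
  finally show ?thesis unfolding Re K_def .
qed

lemma (in binary_forms) rational_Hilb: "rational_fps (Hilb ds L)"
proof -
  have "Hilb ds L = wseries wt (indices ds) (- int L) + fps_of_poly [:- 1:] * wseries wt (indices ds) (int L + 2)"
  proof (rule fps_ext)
    fix n
    have "(of_nat (cfun.dim (covariants ds L n)) :: complex) = of_nat (wcount wt (indices ds) n (- int L)) - of_nat (wcount wt (indices ds) n (int L + 2))"
      using arg_cong[OF dim_covariants[of L n], of complex_of_int] by simp
    then show "fps_nth (Hilb ds L) n = fps_nth (wseries wt (indices ds) (- int L) + fps_of_poly [:- 1:] * wseries wt (indices ds) (int L + 2)) n"
      by (simp add: Hilb_def wseries_def fps_of_poly_const)
  qed
  then show ?thesis by (simp only:) (intro rational_fps_add rational_fps_mult rational_wseries finite_indices)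
qed

section \<open>From limits at t = 1 to Laurent coefficients\<close>

lemma poly_tendsto_at_right_0: "((\<lambda>u. poly p (complex_of_real u)) \<longlongrightarrow> poly.coeff p 0) (at_right 0)"
proof -
  have "((\<lambda>u. poly p (complex_of_real u)) \<longlongrightarrow> poly p (of_real 0)) (at_right 0)"
    by (intro tendsto_intros)
  then show ?thesis by (simp add: poly_0_coeff_0)
qed

lemma poly_difference_quotient_at_right_0:
  "((\<lambda>u. (poly p (complex_of_real u) - poly.coeff p 0) / of_real u) \<longlongrightarrow> poly.coeff p 1) (at_right 0)"
proof -
  obtain a q where p: "p = pCons a q" by (cases p)
  have "((\<lambda>u. poly q (complex_of_real u)) \<longlongrightarrow> poly.coeff q 0) (at_right 0)" by (rule poly_tendsto_at_right_0)
  moreover have "\<forall>\<^sub>F u in at_right (0::real). poly q (complex_of_real u) = (poly p (complex_of_real u) - poly.coeff p 0) / of_real u"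
    using eventually_at_right_less[of 0] by (rule eventually_mono) (simp add: p)
  ultimately show ?thesis using Lim_transform_eventually by (fastforce simp: p)
qed

text \<open>In u = 1 - t rationality gives u^N H = R / Q2 with Q2 nonzero at 0, once the finite
  limit \<open>A\<close> has ruled out a pole. Then \<open>A\<close> and \<open>B\<close> are the
  first two Taylor coefficients of this quotient.\<close>

lemma laurent_coeff_1:
  fixes H :: "complex fps" and f :: "real \<Rightarrow> complex"
  assumes rat: "rational_fps H"
    and sums: "\<And>u. 0 < u \<Longrightarrow> u < 1 \<Longrightarrow> (\<lambda>n. fps_nth H n * of_real (1 - u) ^ n) sums f u"
    and A: "((\<lambda>u. of_real u ^ N * f u) \<longlongrightarrow> A) (at_right 0)"
    and B: "((\<lambda>u. (of_real u ^ N * f u - A) / of_real u) \<longlongrightarrow> B) (at_right 0)"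
  shows "fls_nth (laurent_at_1 H) (1 - int N) = B"
proof -
  obtain P Q where Q: "Q \<noteq> 0" and PQ: "fps_of_poly Q * H = fps_of_poly P" using rat by (auto simp: rational_fps_def)
  define P1 Q1 where "P1 = pcompose P [:1, -1:]" and "Q1 = pcompose Q [:1, -1:]"
  have Q1: "Q1 \<noteq> 0" using Q by (simp add: Q1_def pcompose_eq_0_iff)
  \<comment> \<open>Needed to evaluate the formal identity between \<open>H\<close>,
    \<open>P\<close> and \<open>Q\<close> inside the unit disc.\<close>
  have rad: "fps_conv_radius H \<ge> 1"
    unfolding fps_conv_radius_def
  proof (rule conv_radius_geI_ex)
    fix r :: real assume r: "0 < r" "ereal r < 1"
    then have "summable (\<lambda>n. fps_nth H n * of_real r ^ n)"
      using sums[of "1 - r"] by (auto simp: sums_iff)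
    then show "\<exists>z. norm z = r \<and> summable (\<lambda>n. fps_nth H n * z ^ n)" using r by (intro exI[of _ "of_real r"]) simp
  qed
  have PQu: "poly Q1 (of_real u) * f u = poly P1 (of_real u)" if u: "0 < u" "u < 1" for u
  proof -
    define z where "z = complex_of_real (1 - u)"
    have "norm z < 1" using u unfolding z_def norm_of_real by simp
    then have nz: "ereal (norm z) < fps_conv_radius H" using rad by (metis ereal_less(3) order_less_le_trans)
    have "eval_fps (fps_of_poly Q * H) z = eval_fps (fps_of_poly Q) z * eval_fps H z"
      by (rule eval_fps_mult) (use nz in auto)
    moreover have "eval_fps H z = f u" using sums[OF u] by (simp add: eval_fps_def sums_iff z_def)
    ultimately have "poly P z = poly Q z * f u" by (simp add: PQ)
    moreover have "z = 1 - of_real u" by (simp add: z_def)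
    ultimately show ?thesis by (simp add: P1_def Q1_def poly_pcompose)
  qed
  define g where "g u = of_real u ^ N * f u" for u
  define q where "q = order 0 Q1"
  obtain Q2 where Q2: "Q1 = [:0, 1:] ^ q * Q2" "poly Q2 0 \<noteq> 0"
    using order_decomp[OF Q1, of 0] by (auto simp: q_def poly_eq_0_iff_dvd)
  have "\<exists>R. [:0, 1:] ^ N * P1 = [:0, 1:] ^ q * R"
  proof (cases "P1 = 0")
    case False
    then have nz: "[:0, 1:] ^ N * P1 \<noteq> 0" by simp
    define m where "m = order 0 ([:0, 1:] ^ N * P1)"
    obtain R where R: "[:0, 1:] ^ N * P1 = [:0, 1:] ^ m * R" "poly R 0 \<noteq> 0"
      using order_decomp[OF nz, of 0] by (auto simp: m_def poly_eq_0_iff_dvd)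
    \<comment> \<open>If the denominator vanished to higher order than the numerator, a finite limit
      of u^N f(u) would force R to vanish at 0.\<close>
    have "q \<le> m"
    proof (rule ccontr)
      assume "\<not> q \<le> m"
      then have qm: "q = m + Suc (q - m - 1)" by simp
      have "poly R (of_real u) = of_real u ^ Suc (q - m - 1) * (poly Q2 (of_real u) * g u)" if u: "0 < u" "u < 1" for u
      proof -
        have "of_real u ^ m * poly R (of_real u) = of_real u ^ N * poly P1 (of_real u)"
          using arg_cong[OF R(1), of "\<lambda>p. poly p (of_real u)"] by simp
        also have "\<dots> = of_real u ^ q * poly Q2 (of_real u) * g u"
          using PQu[OF u] arg_cong[OF Q2(1), of "\<lambda>p. poly p (of_real u)"] by (simp add: g_def mult_ac)
        also have "of_real u ^ q = of_real u ^ m * (of_real u ^ Suc (q - m - 1) :: complex)"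
          by (subst qm) (simp only: power_add)
        finally show ?thesis using u by simp
      qed
      then have ev: "\<forall>\<^sub>F u in at_right 0. of_real u ^ Suc (q - m - 1) * (poly Q2 (of_real u) * g u) = poly R (of_real u)"
        by (intro eventually_at_rightI[of 0 1]) auto
      have u0: "(complex_of_real \<longlongrightarrow> 0) (at_right 0)"
        using tendsto_of_real[OF tendsto_ident_at, of 0 "{0<..}"] by simp
      have "((\<lambda>u. complex_of_real u ^ Suc (q - m - 1) * (poly Q2 (of_real u) * g u)) \<longlongrightarrow> 0 ^ Suc (q - m - 1) * (poly.coeff Q2 0 * A)) (at_right 0)"
        unfolding g_def by (intro tendsto_mult tendsto_power u0 poly_tendsto_at_right_0 A)
      from Lim_transform_eventually[OF this ev] have "((\<lambda>u. poly R (complex_of_real u)) \<longlongrightarrow> 0) (at_right 0)" by simp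
      from tendsto_unique[OF _ this poly_tendsto_at_right_0] have "poly R 0 = 0" by (simp add: poly_0_coeff_0)
      then show False using R(2) by simp
    qed
    then have "[:0, 1:] ^ N * P1 = [:0, 1:] ^ q * ([:0, 1:] ^ (m - q) * R)"
      unfolding R(1) by (simp add: power_add[symmetric] mult.assoc[symmetric])
    then show ?thesis ..
  qed (auto intro: exI[of _ 0])
  then obtain R where R: "[:0, 1:] ^ N * P1 = [:0, 1:] ^ q * R" ..
  have Rg: "poly R (of_real u) = poly Q2 (of_real u) * g u" if u: "0 < u" "u < 1" for u
  proof -
    have "of_real u ^ q * poly R (of_real u) = of_real u ^ N * poly P1 (of_real u)"
      using arg_cong[OF R, of "\<lambda>p. poly p (of_real u)"] by simp
    also have "\<dots> = of_real u ^ q * (poly Q2 (of_real u) * g u)"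
      using PQu[OF u] arg_cong[OF Q2(1), of "\<lambda>p. poly p (of_real u)"] by (simp add: g_def mult_ac)
    finally show ?thesis using u by simp
  qed
  have Q20: "poly.coeff Q2 0 \<noteq> 0" using Q2(2) by (simp add: poly_0_coeff_0)
  have "\<forall>\<^sub>F u in at_right 0. poly Q2 (of_real u) * g u = poly R (of_real u)"
    by (intro eventually_at_rightI[of 0 1]) (auto simp: Rg)
  moreover have "((\<lambda>u. poly Q2 (of_real u) * g u) \<longlongrightarrow> poly.coeff Q2 0 * A) (at_right 0)"
    unfolding g_def by (intro tendsto_mult poly_tendsto_at_right_0 A)
  ultimately have "((\<lambda>u. poly R (of_real u)) \<longlongrightarrow> poly.coeff Q2 0 * A) (at_right 0)"
    by (rule Lim_transform_eventually[rotated])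
  from tendsto_unique[OF _ poly_tendsto_at_right_0 this] have R0: "poly.coeff R 0 = poly.coeff Q2 0 * A" by simp
  have "\<forall>\<^sub>F u in at_right 0. poly Q2 (of_real u) * ((g u - A) / of_real u) + A * ((poly Q2 (of_real u) - poly.coeff Q2 0) / of_real u)
     = (poly R (of_real u) - poly.coeff R 0) / of_real u"
    by (intro eventually_at_rightI[of 0 1]) (auto simp: Rg R0 field_simps)
  moreover have "((\<lambda>u. poly Q2 (of_real u) * ((g u - A) / of_real u) + A * ((poly Q2 (of_real u) - poly.coeff Q2 0) / of_real u))
     \<longlongrightarrow> poly.coeff Q2 0 * B + A * poly.coeff Q2 1) (at_right 0)"
    unfolding g_def by (intro tendsto_add tendsto_mult poly_tendsto_at_right_0 B tendsto_const poly_difference_quotient_at_right_0)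
  ultimately have "((\<lambda>u. (poly R (of_real u) - poly.coeff R 0) / of_real u) \<longlongrightarrow> poly.coeff Q2 0 * B + A * poly.coeff Q2 1) (at_right 0)"
    by (rule Lim_transform_eventually[rotated])
  from tendsto_unique[OF _ poly_difference_quotient_at_right_0 this]
  have R1: "poly.coeff R 1 = poly.coeff Q2 0 * B + A * poly.coeff Q2 1" by simp
  \<comment> \<open>The formal Taylor series of u^N f(u); its first two coefficients follow from
    those of \<open>R\<close> and \<open>Q2\<close> through G Q2 = R.\<close>
  define G where "G = fps_of_poly R * inverse (fps_of_poly Q2)"
  have G: "fps_of_poly Q2 * G = fps_of_poly R"
    using inverse_mult_eq_1[of "fps_of_poly Q2"] Q20 by (simp add: G_def mult.left_commute mult.commute)
  have G0: "fps_nth G 0 = A"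
    using arg_cong[OF G, of "\<lambda>F. fps_nth F 0"] Q20 R0 by simp
  have "poly.coeff Q2 0 * fps_nth G 1 + poly.coeff Q2 1 * fps_nth G 0 = poly.coeff R 1"
    using arg_cong[OF G, of "\<lambda>F. fps_nth F 1"] by (simp add: fps_mult_nth)
  then have G1: "fps_nth G 1 = B" using G0 R1 Q20 by (simp add: mult.commute)
  have X: "fps_of_poly ([:0, 1:] ^ k) = (fps_X :: complex fps) ^ k" for k
    by (simp add: fps_of_poly_power fps_of_poly_pCons)
  define L where "L = laurent_at_1 H"
  have L: "L = expand_at_1 P / expand_at_1 Q" unfolding L_def by (rule laurent_at_1_eq[OF Q PQ])
  have eQ: "expand_at_1 Q = fls_X ^ q * fps_to_fls (fps_of_poly Q2)"
    unfolding expand_at_1_def Q1_def[symmetric] Q2(1) fps_of_poly_mult X by (simp add: fls_times_fps_to_fls fps_to_fls_power)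
  have "fps_of_poly ([:0, 1:] ^ N * P1) = fps_of_poly ([:0, 1:] ^ q * R)" by (simp only: R)
  then have "fps_to_fls (fps_X ^ N * fps_of_poly P1) = fps_to_fls (fps_X ^ q * fps_of_poly R)"
    by (simp only: fps_of_poly_mult X)
  then have eP: "fls_X ^ N * expand_at_1 P = fls_X ^ q * fps_to_fls (fps_of_poly R)"
    unfolding expand_at_1_def P1_def[symmetric] by (simp add: fls_times_fps_to_fls fps_to_fls_power)
  have "expand_at_1 Q * (fls_X ^ N * L) = fls_X ^ N * expand_at_1 P"
    unfolding L using Q by (simp add: expand_at_1_eq_0_iff)
  also have "\<dots> = fls_X ^ q * (fps_to_fls (fps_of_poly Q2) * fps_to_fls G)"
    unfolding eP fls_times_fps_to_fls[symmetric] G ..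
  also have "\<dots> = expand_at_1 Q * fps_to_fls G" unfolding eQ by (simp only: mult.assoc)
  finally have "fls_X ^ N * L = fps_to_fls G" using Q by (simp add: expand_at_1_eq_0_iff)
  then have "fls_nth (fls_X ^ N * L) 1 = B" using G1 by simp
  then show ?thesis by (simp add: fls_X_power_times_conv_shift L_def)
qed

lemma three_halves_derivative:
  "((\<lambda>u. 1 / sqrt (1 - u) ^ 3) has_real_derivative 3 / 2) (at 0)"
  by (auto intro!: derivative_eq_intros)

text \<open>Since \<open>(1 - t)\<^sup>2 + 4 t sin\<^sup>2 (a \<theta> / 2) = t (\<sigma>\<^sup>2 + 4 sin\<^sup>2 (a \<theta> / 2))\<close> with \<open>\<sigma> = (1 - t) / sqrt t\<close>, the
  factor \<open>t ^ (- 3 / 2)\<close> is all that remains of the first two terms of the expansion; this is where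
  the ratio \<open>3 / 2\<close> of the two leading coefficients comes from.\<close>

lemma (in binary_forms) gamma_1:
  defines "C \<equiv> length (pos_weights ds)" and "b \<equiv> \<lambda>i. nat (pos_weights ds ! i)"
  assumes C: "C \<ge> 3" and sep: "separated b C"
  shows "\<gamma> ds 1 L = complex_of_real (3 / 2 * ((if \<forall>i<C. even (b i) then 1 + (- 1) ^ L else 1) * real (L + 1) * (Jint (\<lambda>i. real (b i)) C / pi)))"
proof -
  define E where "E = length (filter even ds)"
  \<comment> \<open>The exponent that keeps u^N f(u) bounded: E from the weight zero, 2 C - 3 from
    the peak of the kernel. As D = E + 2 C, the coefficient index 4 - D is 1 - N.\<close>
  define N where "N = E + (2 * C - 3)"
  have b: "b i \<ge> 1" if "i < C" for i
  proof -
    have "pos_weights ds ! i \<in> set (pos_weights ds)" using that by (simp add: C_def)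
    then have "pos_weights ds ! i > 0" by (auto simp: pos_weights_def)
    then show ?thesis by (simp add: b_def)
  qed
  define \<kappa> where "\<kappa> = (if \<forall>i<C. even (b i) then 1 + (- 1) ^ L else 1 :: real)"
  define A' where "A' = \<kappa> * (2 * real (L + 1) * Jint (\<lambda>i. real (b i)) C)"
  define A where "A = A' / (2 * pi)"
  define I where "I u = integral {-pi..pi} (kern b C L (u / sqrt (1 - u)))" for u
  define f where "f u = (1 / u) ^ E * (1 / (1 - u)) ^ C * I u / (2 * pi)" for u
  define w where "w u = 1 / sqrt (1 - u) ^ 3" for u :: real
  define e where "e u = (u / sqrt (1 - u)) ^ (2 * C - 3) * I u - A'" for u
  obtain M where M: "\<And>\<sigma>. \<sigma> > 0 \<Longrightarrow> \<bar>\<sigma> ^ (2 * C - 3) * integral {-pi..pi} (kern b C L \<sigma>) - A'\<bar> \<le> M * \<sigma>\<^sup>2"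
    using kern_integral_asymp[OF C b sep, of L] unfolding A'_def \<kappa>_def by blast
  \<comment> \<open>An error of order u^2 still tends to zero after division by u, so it does not
    reach the second coefficient.\<close>
  have e: "\<bar>e u\<bar> \<le> M * (u\<^sup>2 / (1 - u))" if u: "0 < u" "u < 1" for u
    using M[of "u / sqrt (1 - u)"] u by (simp add: e_def I_def power_divide)
  have uf: "u ^ N * f u = w u * (A' + e u) / (2 * pi)" if u: "0 < u" "u < 1" for u
  proof -
    define s where "s = sqrt (1 - u)"
    have s: "s > 0" "s\<^sup>2 = 1 - u" using u by (auto simp: s_def)
    have "2 * C = (2 * C - 3) + 3" using C by simp
    then have "s ^ (2 * C) = s ^ (2 * C - 3) * s ^ 3" by (metis power_add)
    then have t: "(1 - u) ^ C = s ^ (2 * C - 3) * s ^ 3" by (simp only: s(2)[symmetric] power_mult[symmetric])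
    have "u ^ N * f u = u ^ (2 * C - 3) / (1 - u) ^ C * I u / (2 * pi)"
      using u by (simp add: f_def N_def power_add power_divide)
    also have "\<dots> = w u * ((u / s) ^ (2 * C - 3) * I u) / (2 * pi)"
      unfolding t w_def s_def[symmetric] using s by (simp add: power_divide)
    finally show ?thesis by (simp add: e_def s_def)
  qed

  have w0: "w 0 = 1" by (simp add: w_def)
  have wd: "(w has_real_derivative 3 / 2) (at 0)" unfolding w_def by (rule three_halves_derivative)
  have w1: "(w \<longlongrightarrow> 1) (at_right 0)"
    using tendsto_mono[OF at_le[OF subset_UNIV] DERIV_isCont[OF wd, unfolded isCont_def]] by (simp only: w0)
  have w2: "((\<lambda>u. (w u - 1) / u) \<longlongrightarrow> 3 / 2) (at_right 0)"
    using tendsto_mono[OF at_le[OF subset_UNIV] wd[unfolded has_field_derivative_iff]] by (simp only: w0 diff_0_right)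
  have e1: "((\<lambda>u. e u / u) \<longlongrightarrow> 0) (at_right 0)"
  proof (rule Lim_null_comparison)
    show "\<forall>\<^sub>F u in at_right 0. norm (e u / u) \<le> M * (u / (1 - u))"
    proof (rule eventually_at_rightI[of 0 1])
      fix u :: real assume u: "u \<in> {0<..<1}"
      then have "\<bar>e u\<bar> / u \<le> M * (u\<^sup>2 / (1 - u)) / u" using e[of u] by (intro divide_right_mono) auto
      then show "norm (e u / u) \<le> M * (u / (1 - u))" using u by (simp add: power2_eq_square)
    qed simp
    have "((\<lambda>u. M * (u / (1 - u))) \<longlongrightarrow> M * (0 / (1 - 0))) (at_right 0)"
      by (intro tendsto_intros) auto
    then show "((\<lambda>u. M * (u / (1 - u))) \<longlongrightarrow> 0) (at_right 0)" by simp
  qed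
  have quot: "((\<lambda>u. (u ^ N * f u - A) / u) \<longlongrightarrow> 3 / 2 * A) (at_right 0)"
  proof -
    have "\<forall>\<^sub>F u in at_right 0. A * ((w u - 1) / u) + w u * (e u / u) / (2 * pi) = (u ^ N * f u - A) / u"
    proof (rule eventually_at_rightI[of 0 1])
      fix u :: real assume u: "u \<in> {0<..<1}"
      then have "u ^ N * f u = w u * (A' + e u) / (2 * pi)" by (intro uf) auto
      then show "A * ((w u - 1) / u) + w u * (e u / u) / (2 * pi) = (u ^ N * f u - A) / u"
        using u by (simp only: A_def) (simp add: field_simps)
    qed simp
    moreover have "((\<lambda>u. A * ((w u - 1) / u) + w u * (e u / u) / (2 * pi)) \<longlongrightarrow> A * (3 / 2) + 1 * 0 / (2 * pi)) (at_right 0)"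
      by (intro tendsto_add tendsto_mult tendsto_divide w1 w2 e1 tendsto_const) auto
    ultimately have "((\<lambda>u. (u ^ N * f u - A) / u) \<longlongrightarrow> A * (3 / 2) + 1 * 0 / (2 * pi)) (at_right 0)"
      by (rule Lim_transform_eventually[rotated])
    then show ?thesis by (simp add: mult.commute)
  qed
  have lead: "((\<lambda>u. u ^ N * f u) \<longlongrightarrow> A) (at_right 0)"
  proof -
    have "\<forall>\<^sub>F u in at_right 0. (u ^ N * f u - A) / u * u + A = u ^ N * f u"
      by (intro eventually_at_rightI[of 0 1]) auto
    moreover have "((\<lambda>u. (u ^ N * f u - A) / u * u + A) \<longlongrightarrow> 3 / 2 * A * 0 + A) (at_right 0)"
      by (intro tendsto_add tendsto_mult quot tendsto_const tendsto_ident_at)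
    ultimately have "((\<lambda>u. u ^ N * f u) \<longlongrightarrow> 3 / 2 * A * 0 + A) (at_right 0)"
      by (rule Lim_transform_eventually[rotated])
    then show ?thesis by simp
  qed
  have "fls_nth (laurent_at_1 (Hilb ds L)) (1 - int N) = complex_of_real (3 / 2 * A)"
  proof (rule laurent_coeff_1[OF rational_Hilb, where f = "\<lambda>u. complex_of_real (f u)" and A = "complex_of_real A"])
    fix u :: real assume u: "0 < u" "u < 1"
    have "(\<lambda>n. real (cfun.dim (covariants ds L n)) * (1 - u) ^ n) sums f u"
      using hilbert_sums[of "1 - u" L] u unfolding f_def I_def E_def C_def b_def by simp
    from sums_of_real[OF this, where 'a = complex]
    show "(\<lambda>n. fps_nth (Hilb ds L) n * complex_of_real (1 - u) ^ n) sums complex_of_real (f u)"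
      by (simp add: Hilb_def)
  next
    show "((\<lambda>u. complex_of_real u ^ N * complex_of_real (f u)) \<longlongrightarrow> complex_of_real A) (at_right 0)"
      using tendsto_of_real[OF lead, where 'a = complex] by simp
    show "((\<lambda>u. (complex_of_real u ^ N * complex_of_real (f u) - complex_of_real A) / complex_of_real u) \<longlongrightarrow> complex_of_real (3 / 2 * A)) (at_right 0)"
      using tendsto_of_real[OF quot, where 'a = complex] by simp
  qed
  moreover have "int 1 + 3 - int (cfun.dim (W ds)) = 1 - int N"
    using C unfolding dim_W card_indices by (simp add: N_def E_def C_def of_nat_diff)
  moreover have "A = \<kappa> * real (L + 1) * (Jint (\<lambda>i. real (b i)) C / pi)" by (simp add: A_def A'_def field_simps)
  ultimately have "\<gamma> ds 1 L = complex_of_real (3 / 2 * (\<kappa> * real (L + 1) * (Jint (\<lambda>i. real (b i)) C / pi)))"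
    by (simp only: \<gamma>_def)
  then show ?thesis by (simp only: \<kappa>_def)
qed

section \<open>Which representations have enough weights\<close>

lemma length_pos_weights: "length (pos_weights ds) = (\<Sum>d\<leftarrow>ds. (d + 1) div 2)"
  by (simp add: pos_weights_concat length_concat o_def length_block_weights)

lemma separated_of_list:
  assumes "\<And>\<theta>. 0 < \<theta> \<Longrightarrow> \<theta> < pi \<Longrightarrow> \<exists>i<length xs. \<exists>j<length xs. i \<noteq> j \<and>
     sin (real_of_int (xs ! i) * \<theta> / 2) \<noteq> 0 \<and> sin (real_of_int (xs ! j) * \<theta> / 2) \<noteq> 0"
    and pos: "\<And>x. x \<in> set xs \<Longrightarrow> x > 0"
  shows "separated (\<lambda>i. nat (xs ! i)) (length xs)"
  unfolding separated_def
proof (intro allI impI)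
  fix \<theta> :: real assume "0 < \<theta> \<and> \<theta> < pi"
  then obtain i j where ij: "i < length xs" "j < length xs" "i \<noteq> j"
    "sin (real_of_int (xs ! i) * \<theta> / 2) \<noteq> 0" "sin (real_of_int (xs ! j) * \<theta> / 2) \<noteq> 0" using assms(1) by blast
  have conv: "real (nat (xs ! k)) = real_of_int (xs ! k)" if "k < length xs" for k
    using pos[of "xs ! k"] that by simp
  show "\<exists>i<length xs. \<exists>j<length xs. i \<noteq> j \<and> sin (real (nat (xs ! i)) * \<theta> / 2) \<noteq> 0 \<and> sin (real (nat (xs ! j)) * \<theta> / 2) \<noteq> 0"
    using ij conv[OF ij(1)] conv[OF ij(2)] by (intro exI[of _ i] exI[of _ j] conjI) (simp_all only: simp_thms)
qed

text \<open>The weights 1 and 2 are those whose half-angle sine has no zero strictly between 0 and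
  \<pi>, so each block supplies one factor that never vanishes there.\<close>

lemma block_weight_small:
  assumes "d \<ge> 1" shows "\<exists>a\<in>set (block_weights d). a = 1 \<or> a = 2"
proof (cases "even d")
  case True
  then have "2 \<le> d" using assms by presburger
  then have "2 \<in> set (block_weights d)" using True by (simp add: set_block_weights)
  then show ?thesis by blast
next
  case False
  then have "1 \<in> set (block_weights d)" using assms by (simp add: set_block_weights)
  then show ?thesis by blast
qed

lemma sin_small_weight: "0 < \<theta> \<Longrightarrow> \<theta> < pi \<Longrightarrow> a = 1 \<or> a = 2 \<Longrightarrow> sin (real_of_int a * \<theta> / 2) \<noteq> 0"
  using sin_gt_zero[of \<theta>] sin_gt_zero[of "\<theta> / 2"] by auto

lemma sin_add_zero:
  assumes "sin (x :: real) = 0" "sin (x + y) = 0" shows "sin y = 0"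
proof -
  have "cos x * sin y = 0" using assms by (simp add: sin_add)
  moreover have "cos x \<noteq> 0" using assms(1) sin_cos_squared_add[of x] by auto
  ultimately show ?thesis by simp
qed

text \<open>The smallest weight never vanishes. The next two, 4 and 6 or 3 and 5, have half-angle
  arguments differing by \<theta>, so their sines cannot both be zero.\<close>

lemma separated_block:
  assumes d: "d \<ge> 5" shows "separated (\<lambda>i. nat (block_weights d ! i)) (length (block_weights d))"
proof (rule separated_of_list)
  fix \<theta> :: real assume \<theta>: "0 < \<theta>" "\<theta> < pi"
  have s: "sin \<theta> \<noteq> 0" "sin (\<theta> / 2) \<noteq> 0" using sin_gt_zero[of \<theta>] sin_gt_zero[of "\<theta> / 2"] \<theta> by auto
  have "\<exists>a\<in>set (block_weights d). \<exists>c\<in>set (block_weights d). a \<noteq> c \<and> sin (real_of_int a * \<theta> / 2) \<noteq> 0 \<and> sin (real_of_int c * \<theta> / 2) \<noteq> 0"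
  proof (cases "even d")
    case True
    then have "d \<ge> 6" using d by presburger
    then have mem: "2 \<in> set (block_weights d)" "4 \<in> set (block_weights d)" "6 \<in> set (block_weights d)"
      using True by (auto simp: set_block_weights)
    have s2: "sin (real_of_int 2 * \<theta> / 2) \<noteq> 0" using s(1) by simp
    have e: "real_of_int 4 * \<theta> / 2 = 2 * \<theta>" "real_of_int 6 * \<theta> / 2 = 2 * \<theta> + \<theta>" by simp_all
    have "sin (real_of_int 4 * \<theta> / 2) \<noteq> 0 \<or> sin (real_of_int 6 * \<theta> / 2) \<noteq> 0"
      unfolding e using sin_add_zero[of "2 * \<theta>" \<theta>] s(1) by blast
    then show ?thesis
    proof
      assume "sin (real_of_int 4 * \<theta> / 2) \<noteq> 0"
      then show ?thesis using s2 by (intro bexI[OF _ mem(1)] bexI[OF _ mem(2)] conjI) simp_all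
    next
      assume "sin (real_of_int 6 * \<theta> / 2) \<noteq> 0"
      then show ?thesis using s2 by (intro bexI[OF _ mem(1)] bexI[OF _ mem(3)] conjI) simp_all
    qed
  next
    case False
    then have mem: "1 \<in> set (block_weights d)" "3 \<in> set (block_weights d)" "5 \<in> set (block_weights d)"
      using d by (auto simp: set_block_weights)
    have s1: "sin (real_of_int 1 * \<theta> / 2) \<noteq> 0" using s(2) by simp
    have e: "real_of_int 3 * \<theta> / 2 = 3 * \<theta> / 2" "real_of_int 5 * \<theta> / 2 = 3 * \<theta> / 2 + \<theta>" by simp_all
    have "sin (real_of_int 3 * \<theta> / 2) \<noteq> 0 \<or> sin (real_of_int 5 * \<theta> / 2) \<noteq> 0"
      unfolding e using sin_add_zero[of "3 * \<theta> / 2" \<theta>] s(1) by blast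
    then show ?thesis
    proof
      assume "sin (real_of_int 3 * \<theta> / 2) \<noteq> 0"
      then show ?thesis using s1 by (intro bexI[OF _ mem(1)] bexI[OF _ mem(2)] conjI) simp_all
    next
      assume "sin (real_of_int 5 * \<theta> / 2) \<noteq> 0"
      then show ?thesis using s1 by (intro bexI[OF _ mem(1)] bexI[OF _ mem(3)] conjI) simp_all
    qed
  qed
  then obtain a c where ac: "a \<in> set (block_weights d)" "c \<in> set (block_weights d)" "a \<noteq> c"
    "sin (real_of_int a * \<theta> / 2) \<noteq> 0" "sin (real_of_int c * \<theta> / 2) \<noteq> 0" by blast
  obtain i where i: "i < length (block_weights d)" "block_weights d ! i = a" using ac(1) unfolding in_set_conv_nth by blast
  obtain j where j: "j < length (block_weights d)" "block_weights d ! j = c" using ac(2) unfolding in_set_conv_nth by blast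
  have "i \<noteq> j" using i j ac(3) by blast
  then show "\<exists>i<length (block_weights d). \<exists>j<length (block_weights d). i \<noteq> j \<and>
     sin (real_of_int (block_weights d ! i) * \<theta> / 2) \<noteq> 0 \<and> sin (real_of_int (block_weights d ! j) * \<theta> / 2) \<noteq> 0"
    using i j ac(4,5) by (intro exI[of _ i] exI[of _ j] conjI) (simp_all only: simp_thms)
qed (simp add: set_block_weights)

text \<open>One small weight from each of the first two blocks; \<open>separated\<close> asks for
  different positions, so equal weights are allowed.\<close>

lemma separated_blocks:
  assumes "d \<ge> 1" "d' \<ge> 1"
  shows "separated (\<lambda>i. nat (pos_weights (d # d' # ds) ! i)) (length (pos_weights (d # d' # ds)))"
proof (rule separated_of_list)
  fix \<theta> :: real assume \<theta>: "0 < \<theta>" "\<theta> < pi"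
  let ?xs = "pos_weights (d # d' # ds)"
  obtain a where a: "a \<in> set (block_weights d)" "a = 1 \<or> a = 2" using block_weight_small[OF assms(1)] by blast
  obtain c where c: "c \<in> set (block_weights d')" "c = 1 \<or> c = 2" using block_weight_small[OF assms(2)] by blast
  obtain i where i: "i < length (block_weights d)" "block_weights d ! i = a" using a(1) by (auto simp: in_set_conv_nth)
  obtain j where j: "j < length (block_weights d')" "block_weights d' ! j = c" using c(1) by (auto simp: in_set_conv_nth)
  have xs: "?xs = block_weights d @ block_weights d' @ pos_weights ds" by (simp add: pos_weights_concat)
  show "\<exists>i<length ?xs. \<exists>j<length ?xs. i \<noteq> j \<and> sin (real_of_int (?xs ! i) * \<theta> / 2) \<noteq> 0 \<and> sin (real_of_int (?xs ! j) * \<theta> / 2) \<noteq> 0"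
  proof (intro exI conjI)
    show "i < length ?xs" using i(1) by (simp only: xs length_append)
    show "length (block_weights d) + j < length ?xs" using j(1) by (simp only: xs length_append)
    show "i \<noteq> length (block_weights d) + j" using i(1) by simp
    have "?xs ! i = a" using i by (simp only: xs nth_append if_True)
    then show "sin (real_of_int (?xs ! i) * \<theta> / 2) \<noteq> 0" using sin_small_weight[OF \<theta> a(2)] by (simp only: not_False_eq_True)
    have "?xs ! (length (block_weights d) + j) = c" using j unfolding xs nth_append_length_plus by (simp add: nth_append)
    then show "sin (real_of_int (?xs ! (length (block_weights d) + j)) * \<theta> / 2) \<noteq> 0" using sin_small_weight[OF \<theta> c(2)] by (simp only: not_False_eq_True)
  qed
qed (auto simp: pos_weights_def simp del: upt_Suc)

text \<open>The constant form in a block of degree zero is fixed; hence a representation without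
  invariants has only blocks of positive degree.\<close>

lemma trivial_summand_invariant:
  assumes k: "k < length ds" "ds ! k = 0"
  shows "invariants copies_act (W ds) \<noteq> {0}"
proof -
  define w :: "nat \<times> (complex^2) \<Rightarrow> complex" where "w = (\<lambda>(k', v). if k' = k then 1 else 0)"
  have "(\<lambda>v. w (k', v)) \<in> V (ds ! k')" if "k' < length ds" for k'
    unfolding V_def mem_Collect_eq
  proof (rule exI[of _ "\<lambda>_. if k' = k then 1 else 0"], rule allI)
    fix v show "w (k', v) = (\<Sum>i\<le>ds ! k'. (if k' = k then 1 else 0) * vec_nth v 1 ^ i * vec_nth v 2 ^ (ds ! k' - i))"
      using k by (simp add: w_def)
  qed
  moreover have "w (k', v) = 0" if "k' \<ge> length ds" for k' v using that k by (simp add: w_def)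
  ultimately have "w \<in> W ds" unfolding W_def by blast
  moreover have "pullback copies_act g w = w" for g
    by (simp add: pullback_def copies_act_def w_def case_prod_unfold)
  ultimately have "w \<in> invariants copies_act (W ds)" by (simp add: invariants_def)
  moreover have "w \<noteq> 0"
  proof
    assume "w = 0"
    from fun_cong[OF this, of "(k, 0)"] show False by (simp add: w_def)
  qed
  ultimately show ?thesis by blast
qed

lemma rep_iso_refl: "rep_iso act U act U"
  unfolding rep_iso_def
  by (intro exI[of _ "\<lambda>x. x"]) (auto simp: cfun.linear_ident bij_betw_def)

lemma rep_iso_single: "rep_iso copies_act (W [d]) (*v) (V d)"
proof -
  define \<phi> :: "(nat \<times> (complex^2) \<Rightarrow> complex) \<Rightarrow> complex^2 \<Rightarrow> complex" where "\<phi> w = (\<lambda>v. w (0, v))" for w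
  have "Vector_Spaces.linear cscale cscale \<phi>"
    unfolding Vector_Spaces.linear_iff
    by (intro conjI allI cfun.vector_space_axioms) (simp_all add: \<phi>_def cscale_def fun_eq_iff)
  moreover have "bij_betw \<phi> (W [d]) (V d)"
  proof (rule bij_betw_byWitness[where f' = "\<lambda>h (k, v). if k = 0 then h v else 0"])
    show "\<forall>w\<in>W [d]. (\<lambda>(k, v). if k = 0 then \<phi> w v else 0) = w"
      by (auto simp: W_def \<phi>_def fun_eq_iff)
    show "\<forall>h\<in>V d. \<phi> (\<lambda>(k, v). if k = 0 then h v else 0) = h"
      by (auto simp: \<phi>_def)
    show "\<phi> ` W [d] \<subseteq> V d" by (auto simp: W_def \<phi>_def)
    show "(\<lambda>h (k, v). if k = 0 then h v else 0) ` V d \<subseteq> W [d]" by (auto simp: W_def)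
  qed
  moreover have "\<phi> (pullback copies_act g u) = pullback (*v) g (\<phi> u)" for g u
    by (simp add: \<phi>_def pullback_def copies_act_def)
  ultimately show ?thesis unfolding rep_iso_def by blast
qed

text \<open>A block of degree d has (d + 1) div 2 positive weights. With sorted positive degrees a
  total below three occurs only for a single block of degree at most 4 and for [1, 1], [1, 2],
  [2, 2].\<close>

lemma generic_weights:
  assumes "ds \<noteq> []" "sorted ds" and ge1: "\<And>d. d \<in> set ds \<Longrightarrow> d \<ge> 1"
    and "\<And>d. ds = [d] \<Longrightarrow> d \<ge> 5" "ds \<noteq> [1, 1]" "ds \<noteq> [1, 2]" "ds \<noteq> [2, 2]"
  shows "length (pos_weights ds) \<ge> 3 \<and> separated (\<lambda>i. nat (pos_weights ds ! i)) (length (pos_weights ds))"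
proof (cases ds)
  case (Cons d ds')
  show ?thesis
  proof (cases ds')
    case Nil
    then have "d \<ge> 5" using assms(4) Cons by simp
    then show ?thesis using separated_block[of d] by (simp add: Cons Nil pos_weights_concat length_block_weights)
  next
    case (Cons d' ds'')
    have ds: "ds = d # d' # ds''" using \<open>ds = d # ds'\<close> Cons by simp
    have d: "d \<ge> 1" "d' \<ge> 1" "d \<le> d'" using ge1 assms(2) by (auto simp: ds)
    have "length (pos_weights ds) \<ge> 3"
    proof (cases ds'')
      case Nil
      have "d' \<ge> 3"
      proof (rule ccontr)
        assume "\<not> d' \<ge> 3"
        then have "(d = 1 \<and> d' = 1) \<or> (d = 1 \<and> d' = 2) \<or> (d = 2 \<and> d' = 2)" using d by linarith
        then show False using assms(5-7) by (auto simp: ds Nil)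
      qed
      then have "(d + 1) div 2 \<ge> 1" "(d' + 1) div 2 \<ge> 2" using d(1) by presburger+
      then show ?thesis by (simp add: length_pos_weights ds Nil)
    next
      case (Cons e es)
      have "e \<ge> 1" using ge1 by (simp add: ds Cons)
      then have "(d + 1) div 2 \<ge> 1" "(d' + 1) div 2 \<ge> 1" "(e + 1) div 2 \<ge> 1" using d(1,2) by presburger+
      then show ?thesis by (simp add: length_pos_weights ds Cons)
    qed
    then show ?thesis using separated_blocks[OF d(1,2), of ds''] by (simp add: ds)
  qed
qed (use assms in simp)

text \<open>All weights of a block have the parity of its degree, and every block of positive degree
  has a positive weight to show it.\<close>

lemma even_weights_iff:
  assumes ge1: "\<And>d. d \<in> set ds \<Longrightarrow> d \<ge> 1"
  shows "(\<forall>i<length (pos_weights ds). even (nat (pos_weights ds ! i))) \<longleftrightarrow> (\<forall>d\<in>set ds. even d)"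
proof -
  have "(\<forall>i<length (pos_weights ds). even (nat (pos_weights ds ! i))) \<longleftrightarrow> (\<forall>a\<in>set (pos_weights ds). even (nat a))"
    by (simp add: all_set_conv_all_nth)
  also have "\<dots> \<longleftrightarrow> (\<forall>d\<in>set ds. \<forall>a\<in>set (block_weights d). even (nat a))" by (auto simp: pos_weights_concat)
  also have "\<dots> \<longleftrightarrow> (\<forall>d\<in>set ds. even d)"
  proof (rule ball_cong)
    fix d assume "d \<in> set ds"
    then obtain a where a: "a \<in> set (block_weights d)" using block_weight_small[OF ge1] by blast
    have "even (nat c) \<longleftrightarrow> even d" if "c \<in> set (block_weights d)" for c
    proof -
      have "c > 0" "even (c + int d)" using that by (simp_all add: set_block_weights)
      then show ?thesis by (simp add: even_nat_iff)
    qed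
    then show "(\<forall>a\<in>set (block_weights d). even (nat a)) \<longleftrightarrow> even d" using a by blast
  qed simp
  finally show ?thesis .
qed

theorem theorem3p8:
  fixes ds :: "nat list" and L C :: nat and a :: "nat \<Rightarrow> complex"
  assumes "ds \<noteq> []"
    and "sorted ds"
    and "invariants copies_act (W ds) = {0}"
    and "\<forall>d\<le>4. \<not> rep_iso copies_act (W ds) (*v) (V d)"
    and "\<not> rep_iso copies_act (W ds) copies_act (W [1, 1])"
    and "\<not> rep_iso copies_act (W ds) copies_act (W [1, 2])"
    and "\<not> rep_iso copies_act (W ds) copies_act (W [2, 2])"
    and "C = length (pos_weights ds)"
    and "a = (\<lambda>i. of_int (pos_weights ds ! i))"
  shows "((\<exists>d\<in>set ds. odd d) \<longrightarrow>
            \<gamma> ds 1 L = of_nat (L + 1) * \<gamma> ds 1 0 \<and>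
            \<gamma> ds 1 L = 3 * of_nat (L + 1) * schur (\<rho>_seq C) a / (2 * schur (\<delta>_seq C) a)) \<and>
         ((\<forall>d\<in>set ds. even d) \<longrightarrow>
            \<gamma> ds 1 L = (1 + (-1) ^ L) * of_nat (L + 1) * \<gamma> ds 1 0 / 2 \<and>
            \<gamma> ds 1 L = 3 * (1 + (-1) ^ L) * of_nat (L + 1) * schur (\<rho>_seq C) a
                        / (2 * schur (\<delta>_seq C) a))"
proof -
  interpret binary_forms ds .
  define b where "b = (\<lambda>i. nat (pos_weights ds ! i))"
  have ge1: "d \<ge> 1" if "d \<in> set ds" for d
  proof (rule ccontr)
    assume "\<not> d \<ge> 1"
    then obtain k where "k < length ds" "ds ! k = 0" using \<open>d \<in> set ds\<close> by (auto simp: in_set_conv_nth)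
    then show False using trivial_summand_invariant assms(3) by blast
  qed
  have "length (pos_weights ds) \<ge> 3 \<and> separated (\<lambda>i. nat (pos_weights ds ! i)) (length (pos_weights ds))"
  proof (rule generic_weights[OF assms(1,2) ge1])
    fix d assume "ds = [d]"
    have "\<not> d \<le> 4" using assms(4) rep_iso_single[of d] unfolding \<open>ds = [d]\<close> by blast
    then show "d \<ge> 5" by simp
  next
    show "ds \<noteq> [1, 1]" using assms(5) rep_iso_refl[of copies_act "W [1, 1]"] by blast
    show "ds \<noteq> [1, 2]" using assms(6) rep_iso_refl[of copies_act "W [1, 2]"] by blast
    show "ds \<noteq> [2, 2]" using assms(7) rep_iso_refl[of copies_act "W [2, 2]"] by blast
  qed
  then have C: "C \<ge> 3" and sep: "separated b C" by (simp_all add: assms(8) b_def)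
  have pos: "pos_weights ds ! i > 0" if "i < C" for i
  proof -
    have "pos_weights ds ! i \<in> set (pos_weights ds)" using that by (simp add: assms(8))
    then show ?thesis by (auto simp: pos_weights_def)
  qed
  have b1: "real (b i) \<ge> 1" if "i < C" for i using pos[OF that] unfolding b_def by linarith
  have a_b: "a i = complex_of_real (real (b i))" if "i < C" for i
    using less_imp_le[OF pos[OF that]] by (simp add: assms(9) b_def)
  define j where "j = complex_of_real (Jint (\<lambda>i. real (b i)) C / pi)"
  \<comment> \<open>Beyond the length of the list the two arguments may differ. A Schur polynomial
    sees only the first C coordinates, and continuity along a constant sequence extracts
    this.\<close>
  have a: "schur \<rho> a = schur \<rho> (\<lambda>i. complex_of_real (real (b i)))" if "length \<rho> = C" for \<rho>
  proof -
    have "((\<lambda>_::nat. schur \<rho> a) \<longlongrightarrow> schur \<rho> (\<lambda>i. complex_of_real (real (b i)))) sequentially"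
      by (rule polynomial_functions_tendsto[OF schur_polynomial, where g = "\<lambda>_. a"])
        (simp_all add: a_b that)
    then show ?thesis by (simp add: LIMSEQ_const_iff)
  qed
  have "j * schur (\<delta>_seq C) a = schur (\<rho>_seq C) a" "schur (\<delta>_seq C) a \<noteq> 0"
    unfolding a[OF length_seqs(1)] a[OF length_seqs(2)] j_def
    by (rule Jint_schur[OF C b1], assumption, rule schur_delta_nonzero[OF b1])
  then have j: "schur (\<rho>_seq C) a / (2 * schur (\<delta>_seq C) a) = j / 2" by (simp add: field_simps)
  have even: "(\<forall>i<C. even (b i)) \<longleftrightarrow> (\<forall>d\<in>set ds. even d)"
    unfolding b_def assms(8) by (rule even_weights_iff[OF ge1])
  have gamma: "\<gamma> ds 1 L = 3 / 2 * ((if \<forall>d\<in>set ds. even d then 1 + (- 1) ^ L else 1) * of_nat (L + 1) * j)" for L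
  proof -
    have g: "\<gamma> ds 1 L = complex_of_real (3 / 2 * ((if \<forall>i<C. even (b i) then 1 + (- 1) ^ L else 1) * real (L + 1) * (Jint (\<lambda>i. real (b i)) C / pi)))"
      unfolding b_def assms(8) by (rule gamma_1[OF C[unfolded assms(8)] sep[unfolded assms(8) b_def]])
    show ?thesis
    proof (cases "\<forall>d\<in>set ds. even d")
      case True
      then have e: "\<forall>i<C. even (b i)" using even by (rule iffD2[rotated])
      show ?thesis unfolding g if_P[OF e] if_P[OF True] j_def by simp
    next
      case False
      then have e: "\<not> (\<forall>i<C. even (b i))" unfolding even .
      show ?thesis unfolding g if_not_P[OF e] if_not_P[OF False] j_def by simp
    qed
  qed
  show ?thesis
  proof (intro conjI impI)
    assume "\<exists>d\<in>set ds. odd d"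
    then have odd: "\<not> (\<forall>d\<in>set ds. even d)" by blast
    show "\<gamma> ds 1 L = of_nat (L + 1) * \<gamma> ds 1 0" unfolding gamma if_not_P[OF odd] by simp
    have "\<gamma> ds 1 L = 3 * of_nat (L + 1) * (j / 2)" unfolding gamma if_not_P[OF odd] by simp
    then show "\<gamma> ds 1 L = 3 * of_nat (L + 1) * schur (\<rho>_seq C) a / (2 * schur (\<delta>_seq C) a)"
      unfolding j[symmetric] by simp
  next
    assume even: "\<forall>d\<in>set ds. even d"
    \<comment> \<open>At L = 0 the parity factor equals 2, which the division by 2 cancels.\<close>
    show "\<gamma> ds 1 L = (1 + (-1) ^ L) * of_nat (L + 1) * \<gamma> ds 1 0 / 2" unfolding gamma if_P[OF even] by simp
    have "\<gamma> ds 1 L = 3 * (1 + (-1) ^ L) * of_nat (L + 1) * (j / 2)" unfolding gamma if_P[OF even] by simp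
    then show "\<gamma> ds 1 L = 3 * (1 + (-1) ^ L) * of_nat (L + 1) * schur (\<rho>_seq C) a / (2 * schur (\<delta>_seq C) a)"
      unfolding j[symmetric] by simp
  qed
qed

end
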